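(* Let $N\ge3$ and assume (V), (K) with $a_0,a\in\mathbb{R}$, $b_0>\min\{a_0,-\frac{N-a_0}{2},-\frac{N+2}{2}\}$ and $b<\max\{a,-2\}$. Then $-\Delta u+V(|x|)u=K(|x|)f(u)$ in $\mathbb{R}^N$ has a nonnegative nontrivial radial solution for every continuous $f:\mathbb{R}\to\mathbb{R}$ with $f(0)=0$ satisfying: (f7) $\sup_{t>0}\frac{|f(t)|}{\min\{t^{q_1-1},t^{q_2-1}\}}<+\infty$ for some $q_1,q_2<2$ with $q_1\in\mathcal{I}_1(a_0,b_0)$ and $q_2\in\mathcal{I}_2(a,b)$; (f8) there exists $\theta<2$ such that $\liminf_{t\to0^+}F(t)/t^\theta>0$.
   Context: $F(t)=\int_0^tf(s)ds$. (V): $V:(0,\infty)\to[0,\infty)$ continuous with $\liminf_{r\to0^+}V(r)/r^{a_0}>0$, $\liminf_{r\to\infty}V(r)/r^a>0$. (K): $K:(0,\infty)\to(0,\infty)$ continuous with $\limsup_{r\to0^+}K(r)/r^{b_0}<\infty$, $\limsup_{r\to\infty}K(r)/r^b<\infty$. $H^1_{V,r}$: radial $u\in D^{1,2}(\mathbb{R}^N)$ with $\int V(|x|)u^2<\infty$, norm $\|u\|^2=\int|\nabla u|^2+\int V(|x|)u^2$. Radial solution: $u\in H^1_{V,r}$ with $\int\nabla u\cdot\nabla h+\int V(|x|)uh=\int K(|x|)f(u)h$ for all $h\in H^1_{V,r}$. $q_*(a_0,b_0):=\max\{1,2\frac{N+b_0}{N+a_0},2\frac{2N-2+2b_0-a_0}{2N-2+a_0}\}$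 if $a_0<-(2N-2)$; $\max\{1,2\frac{N+b_0}{N+a_0}\}$ if $-(2N-2)\le a_0<-N$; $1$ if $a_0\ge -N$. $q^*(a_0,b_0):=+\infty$ if $a_0\le-(2N-2)$; $2\frac{2N-2+2b_0-a_0}{2N-2+a_0}$ if $-(2N-2)<a_0\le -N$; $\min\{2\frac{N+b_0}{N+a_0},2\frac{2N-2+2b_0-a_0}{2N-2+a_0}\}$ if $-N<a_0<-2$; $2\frac{N+b_0}{N-2}$ if $a_0\ge-2$. $\mathcal{I}_1(a_0,b_0):=(q_*,q^* )$. $q_{**}(a,b):=\max\{1,2\frac{N+b}{N-2}\}$ if $a\le-2$; $\max\{1,2\frac{N+b}{N+a},2\frac{2N-2+2b-a}{2N-2+a}\}$ if $a>-2$. $\mathcal{I}_2(a,b):=(q_{**},+\infty)$. *)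

theory Defs
  imports "HOL-Analysis.Analysis" "HOL-Library.Liminf_Limsup"
begin

definition test_fun :: "(real^'n \<Rightarrow> real) \<Rightarrow> bool" where
  "test_fun \<phi> \<longleftrightarrow> (\<forall>x. \<phi> differentiable (at x))
     \<and> (\<forall>i. continuous_on UNIV (\<lambda>x. frechet_derivative \<phi> (at x) (axis i 1)))
     \<and> (\<exists>C. compact C \<and> (\<forall>x. x \<notin> C \<longrightarrow> \<phi> x = 0))"

definition weak_grad :: "(real^'n \<Rightarrow> real) \<Rightarrow> (real^'n \<Rightarrow> real^'n) \<Rightarrow> bool" where
  "weak_grad u g \<longleftrightarrow> g \<in> borel_measurable lebesgue \<and>
     (\<forall>i \<phi>. test_fun \<phi> \<longrightarrow>
        integrable lebesgue (\<lambda>x. u x * frechet_derivative \<phi> (at x) (axis i 1))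
      \<and> integrable lebesgue (\<lambda>x. g x $ i * \<phi> x)
      \<and> (\<integral>x. u x * frechet_derivative \<phi> (at x) (axis i 1) \<partial>lebesgue)
          = - (\<integral>x. g x $ i * \<phi> x \<partial>lebesgue))"

definition D12 :: "(real^'n \<Rightarrow> real) \<Rightarrow> bool" where
  "D12 u \<longleftrightarrow> u \<in> borel_measurable lebesgue
     \<and> integrable lebesgue (\<lambda>x. \<bar>u x\<bar> powr (2 * real CARD('n) / (real CARD('n) - 2)))
     \<and> (\<exists>g. weak_grad u g \<and> integrable lebesgue (\<lambda>x. (norm (g x))\<^sup>2))"

definition radial :: "(real^'n \<Rightarrow> real) \<Rightarrow> bool" where
  "radial u \<longleftrightarrow> (\<exists>v. AE x in lebesgue. u x = v (norm x))"

definition H1Vr :: "(real \<Rightarrow> real) \<Rightarrow> (real^'n \<Rightarrow> real) \<Rightarrow> bool" where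
  "H1Vr V u \<longleftrightarrow> D12 u \<and> radial u \<and> integrable lebesgue (\<lambda>x. V (norm x) * (u x)\<^sup>2)"

definition radial_solution ::
  "(real \<Rightarrow> real) \<Rightarrow> (real \<Rightarrow> real) \<Rightarrow> (real \<Rightarrow> real) \<Rightarrow> (real^'n \<Rightarrow> real) \<Rightarrow> bool" where
  "radial_solution V K f u \<longleftrightarrow> H1Vr V u \<and>
     (\<forall>g h gh. weak_grad u g \<longrightarrow> H1Vr V h \<longrightarrow> weak_grad h gh \<longrightarrow>
        integrable lebesgue (\<lambda>x. g x \<bullet> gh x)
      \<and> integrable lebesgue (\<lambda>x. V (norm x) * u x * h x)
      \<and> integrable lebesgue (\<lambda>x. K (norm x) * f (u x) * h x)
      \<and> (\<integral>x. g x \<bullet> gh x \<partial>lebesgue) + (\<integral>x. V (norm x) * u x * h x \<partial>lebesgue)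
          = (\<integral>x. K (norm x) * f (u x) * h x \<partial>lebesgue))"

definition Fprim :: "(real \<Rightarrow> real) \<Rightarrow> real \<Rightarrow> real" where
  "Fprim f t = integral {0..t} f"

definition q_low1 :: "real \<Rightarrow> real \<Rightarrow> real \<Rightarrow> real" where
  "q_low1 N a0 b0 =
    (if a0 < -(2*N-2) then Max {1, 2*(N+b0)/(N+a0), 2*(2*N-2+2*b0-a0)/(2*N-2+a0)}
     else if a0 < -N then max 1 (2*(N+b0)/(N+a0))
     else 1)"

definition q_up1 :: "real \<Rightarrow> real \<Rightarrow> real \<Rightarrow> ereal" where
  "q_up1 N a0 b0 =
    (if a0 \<le> -(2*N-2) then \<infinity>
     else if a0 \<le> -N then ereal (2*(2*N-2+2*b0-a0)/(2*N-2+a0))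
     else if a0 < -2 then ereal (min (2*(N+b0)/(N+a0)) (2*(2*N-2+2*b0-a0)/(2*N-2+a0)))
     else ereal (2*(N+b0)/(N-2)))"

definition I1 :: "real \<Rightarrow> real \<Rightarrow> real \<Rightarrow> real set" where
  "I1 N a0 b0 = {q. q_low1 N a0 b0 < q \<and> ereal q < q_up1 N a0 b0}"

definition q_low2 :: "real \<Rightarrow> real \<Rightarrow> real \<Rightarrow> real" where
  "q_low2 N a b =
    (if a \<le> -2 then max 1 (2*(N+b)/(N-2))
     else Max {1, 2*(N+b)/(N+a), 2*(2*N-2+2*b-a)/(2*N-2+a)})"

definition I2 :: "real \<Rightarrow> real \<Rightarrow> real \<Rightarrow> real set" where
  "I2 N a b = {q. q_low2 N a b < q}"

end

theory Submission
  imports Defs "HOL-Complex_Analysis.Great_Picard"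
begin

text \<open>
  Both exponents are below 2, so Hoelder's inequality alone controls the nonlinear term. Put
  \<open>W = V + 1 / |x|\<^sup>2\<close>. By Hardy's inequality \<open>\<integral> W u\<^sup>2\<close> is bounded by the squared norm of \<open>u\<close>, and
  \<open>K |u|\<^sup>q \<le> \<epsilon> W u\<^sup>2 + C\<^sub>\<epsilon> w\<close>, where \<open>w = K powr (2/(2-q)) * W powr (-q/(2-q))\<close> is integrable near 0 for
  \<open>q = q\<^sub>1\<close> and near infinity for \<open>q = q\<^sub>2\<close> exactly because of the conditions defining the intervals
  \<open>I1\<close> and \<open>I2\<close>. Hence the energy \<open>E u = \<parallel>u\<parallel>\<^sup>2 / 2 - J u\<close>, \<open>J u = \<integral> K F(u)\<close>, is coercive and \<open>J\<close> is
  continuous along norm-bounded sequences that converge almost everywhere.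

  A radial function in \<open>D12\<close> is almost everywhere equal to a continuous profile \<open>v(|x|)\<close>, recovered from
  the gradient through the flux of the divergence-free field \<open>x / |x| ^ n\<close>. The profiles of a bounded
  sequence are equicontinuous away from the origin, so a minimizing sequence converges pointwise along a
  subsequence, and the parallelogram identity makes its gradients a Cauchy sequence.
  Replacing \<open>u\<close> by its positive part does not increase the energy, which gives a nonnegative minimizer;
  its energy is negative by (f8), and its Euler--Lagrange equation is the weak form of the problem.
\<close>

section \<open>Test functions and weak gradients\<close>

text \<open>The term 1/|x|^2 in \<open>W\<close> keeps \<open>W\<close> positive where
  \<open>V\<close> vanishes, so that negative powers of \<open>W\<close> make sense, and it is the
  larger term when \<open>a0 > -2\<close> near the origin or \<open>a < -2\<close> near infinity.
  Hence \<open>min a0 (-2)\<close> and \<open>max a (-2)\<close> are the exponents that govern the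
  weights. \<open>Fprim f t\<close> is 0 for t < 0, the integral there being over an empty interval;
  it is a primitive of \<open>f (max 0 t)\<close>, so \<open>J\<close> is the truncated functional
  from the start. \<open>J\<close> has no convexity, which is why the averages of a minimizing
  sequence need their own convergence argument before the parallelogram identity can be used. The
  derivative of the positive part would normally come from a chain rule for Sobolev functions; here
  continuity of the profile replaces it: the positivity set is a union of shells bounded by zeros of
  the profile, and one integrates by parts on each shell. Finally, solutions are tested against
  radial functions only, so minimality among radial functions yields the equation directly, without
  a symmetry principle.\<close>

definition C1grad :: "(real^'n \<Rightarrow> real) \<Rightarrow> (real^'n \<Rightarrow> real^'n) \<Rightarrow> bool" where
  "C1grad \<phi> G \<longleftrightarrow> (\<forall>x. (\<phi> has_derivative (\<lambda>h. G x \<bullet> h)) (at x)) \<and> continuous_on UNIV G"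

lemma C1gradD:
  assumes "C1grad \<phi> G"
  shows "(\<phi> has_derivative (\<lambda>h. G x \<bullet> h)) (at x)" "continuous_on UNIV G" "continuous_on UNIV \<phi>"
  using assms unfolding C1grad_def
  by (auto simp: continuous_on_eq_continuous_within intro: has_derivative_continuous)

lemma C1grad_partial:
  assumes "C1grad \<phi> G"
  shows "frechet_derivative \<phi> (at x) (axis i 1) = G x $ i"
  using frechet_derivative_at[OF C1gradD(1)[OF assms, of x]]
  by (metis cart_eq_inner_axis)

lemma C1grad_test_fun:
  fixes \<phi> :: "real^'n \<Rightarrow> real"
  assumes "C1grad \<phi> G" "\<And>x. norm x > R \<Longrightarrow> \<phi> x = 0"
  shows "test_fun \<phi>"
  unfolding test_fun_def
proof (intro conjI allI)
  fix x show "\<phi> differentiable at x" using C1gradD(1)[OF assms(1)] differentiableI by blast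
next
  fix i show "continuous_on UNIV (\<lambda>x. frechet_derivative \<phi> (at x) (axis i 1))"
    unfolding C1grad_partial[OF assms(1)] using C1gradD(2)[OF assms(1)] by (intro continuous_intros)
next
  show "\<exists>C. compact C \<and> (\<forall>x. x \<notin> C \<longrightarrow> \<phi> x = 0)"
    by (rule exI[of _ "cball 0 R"]) (auto simp: assms(2))
qed

lemma C1grad_zero_outside:
  fixes \<phi> :: "real^'n \<Rightarrow> real"
  assumes "C1grad \<phi> G" "\<And>x. norm x > R \<Longrightarrow> \<phi> x = 0" "norm x > R"
  shows "G x = 0"
proof -
  have o: "open {x::real^'n. R < norm x}"
    by (intro open_Collect_less continuous_intros)
  have "((\<lambda>x::real^'n. 0::real) has_derivative (\<lambda>h. G x \<bullet> h)) (at x)"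
    by (rule has_derivative_transform_within_open[OF C1gradD(1)[OF assms(1)] o]) (use assms in auto)
  moreover have "((\<lambda>x::real^'n. 0::real) has_derivative (\<lambda>h. 0)) (at x)" by simp
  ultimately have "(\<lambda>h. G x \<bullet> h) = (\<lambda>h. 0)" by (rule has_derivative_unique)
  then have "G x \<bullet> G x = 0" by metis
  then show ?thesis by simp
qed

text \<open>Linearity of the derivative turns its values on the axes into one gradient field. From
  here on test functions are handled as pairs with an explicit gradient, which can be differentiated
  by rules instead of through \<open>frechet_derivative\<close>.\<close>

lemma test_fun_C1grad:
  fixes \<phi> :: "real^'n \<Rightarrow> real"
  assumes "test_fun \<phi>"
  shows "\<exists>G R. C1grad \<phi> G \<and> R > 0 \<and> (\<forall>x. norm x > R \<longrightarrow> \<phi> x = 0)"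
proof -
  define G where "G x = (\<chi> i. frechet_derivative \<phi> (at x) (axis i 1))" for x
  have d: "(\<phi> has_derivative frechet_derivative \<phi> (at x)) (at x)" for x
    using assms unfolding test_fun_def using frechet_derivative_works by blast
  have "frechet_derivative \<phi> (at x) h = G x \<bullet> h" for x h
  proof -
    have l: "linear (frechet_derivative \<phi> (at x))" using d has_derivative_linear by blast
    have "frechet_derivative \<phi> (at x) h = frechet_derivative \<phi> (at x) (\<Sum>i\<in>UNIV. (h$i) *\<^sub>R axis i 1)"
      using basis_expansion[of h] by (simp add: scalar_mult_eq_scaleR)
    also have "\<dots> = (\<Sum>i\<in>UNIV. h$i * frechet_derivative \<phi> (at x) (axis i 1))"
      by (simp add: linear_sum[OF l] linear_cmul[OF l])
    finally show ?thesis by (simp add: G_def inner_vec_def mult.commute)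
  qed
  then have 1: "(\<phi> has_derivative (\<lambda>h. G x \<bullet> h)) (at x)" for x using d[of x] by presburger
  have 2: "continuous_on UNIV G"
    unfolding G_def using assms by (auto simp: test_fun_def intro!: continuous_intros)
  obtain C where C: "compact C" "\<And>x. x \<notin> C \<Longrightarrow> \<phi> x = 0" using assms unfolding test_fun_def by blast
  obtain R where R: "R > 0" "\<And>x. x \<in> C \<Longrightarrow> norm x \<le> R"
    using compact_imp_bounded[OF C(1)] unfolding bounded_pos by blast
  have 3: "C1grad \<phi> G" using 1 2 by (simp add: C1grad_def)
  have 4: "\<phi> x = 0" if "norm x > R" for x using C(2) R(2) that by (metis not_le)
  show ?thesis using 3 R(1) 4 by blast
qed

lemma weak_gradI:
  fixes u :: "real^'n \<Rightarrow> real"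
  assumes "g \<in> borel_measurable lebesgue"
    and "\<And>i \<phi> G R. C1grad \<phi> G \<Longrightarrow> R > 0 \<Longrightarrow> (\<And>x. norm x > R \<Longrightarrow> \<phi> x = 0) \<Longrightarrow>
        integrable lebesgue (\<lambda>x. u x * G x $ i)
      \<and> integrable lebesgue (\<lambda>x. g x $ i * \<phi> x)
      \<and> (\<integral>x. u x * G x $ i \<partial>lebesgue) = - (\<integral>x. g x $ i * \<phi> x \<partial>lebesgue)"
  shows "weak_grad u g"
  unfolding weak_grad_def
proof (intro conjI assms(1) allI impI)
  fix i and \<phi> :: "real^'n \<Rightarrow> real" assume t: "test_fun \<phi>"
  obtain G R where G: "C1grad \<phi> G" "R > 0" "\<forall>x. norm x > R \<longrightarrow> \<phi> x = 0"
    using test_fun_C1grad[OF t] by blast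
  note * = assms(2)[OF G(1,2) G(3)[rule_format], of i]
  show "integrable lebesgue (\<lambda>x. u x * frechet_derivative \<phi> (at x) (axis i 1))"
    and "integrable lebesgue (\<lambda>x. g x $ i * \<phi> x)"
    and "(\<integral>x. u x * frechet_derivative \<phi> (at x) (axis i 1) \<partial>lebesgue) = - (\<integral>x. g x $ i * \<phi> x \<partial>lebesgue)"
    using * unfolding C1grad_partial[OF G(1)] by auto
qed

lemma weak_gradD:
  assumes "weak_grad u g" "C1grad \<phi> G" "\<And>x. norm x > R \<Longrightarrow> \<phi> x = 0"
  shows "integrable lebesgue (\<lambda>x. u x * G x $ i)"
    and "integrable lebesgue (\<lambda>x. g x $ i * \<phi> x)"
    and "(\<integral>x. u x * G x $ i \<partial>lebesgue) = - (\<integral>x. g x $ i * \<phi> x \<partial>lebesgue)"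
proof -
  have t: "test_fun \<phi>" by (rule C1grad_test_fun[OF assms(2,3)])
  show "integrable lebesgue (\<lambda>x. u x * G x $ i)"
    and "integrable lebesgue (\<lambda>x. g x $ i * \<phi> x)"
    and "(\<integral>x. u x * G x $ i \<partial>lebesgue) = - (\<integral>x. g x $ i * \<phi> x \<partial>lebesgue)"
    using assms(1)[unfolded weak_grad_def, THEN conjunct2, rule_format, OF t, where i=i]
    unfolding C1grad_partial[OF assms(2)] by simp_all
qed

lemma C1grad_mult:
  assumes "C1grad \<phi> G" "C1grad \<psi> H"
  shows "C1grad (\<lambda>x. \<phi> x * \<psi> x) (\<lambda>x. \<psi> x *\<^sub>R G x + \<phi> x *\<^sub>R H x)"
  unfolding C1grad_def
proof (intro conjI allI)
  fix x
  show "((\<lambda>x. \<phi> x * \<psi> x) has_derivative (\<lambda>h. (\<psi> x *\<^sub>R G x + \<phi> x *\<^sub>R H x) \<bullet> h)) (at x)"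
    by (rule has_derivative_eq_rhs[OF has_derivative_mult[OF C1gradD(1)[OF assms(1)] C1gradD(1)[OF assms(2)]]])
      (auto simp: algebra_simps inner_add_left)
qed (auto intro!: continuous_intros C1gradD(2-)[OF assms(1)] C1gradD(2-)[OF assms(2)])

lemma C1grad_component: "C1grad (\<lambda>x::real^'a. x $ i) (\<lambda>x. axis i 1)"
  unfolding C1grad_def
proof (intro conjI allI)
  have "(\<lambda>h. axis i 1 \<bullet> h) = (\<lambda>h::real^'a. h $ i)" by (simp add: fun_eq_iff inner_axis')
  then show "((\<lambda>x. x $ i) has_derivative (\<lambda>h. axis i 1 \<bullet> h)) (at x)" for x
    by (simp add: bounded_linear_imp_has_derivative[OF bounded_linear_vec_nth])
qed auto

lemma C1grad_compose:
  assumes "C1grad \<phi> G" "\<And>t. (m has_real_derivative m' t) (at t)" "continuous_on UNIV m'"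
  shows "C1grad (\<lambda>x. m (\<phi> x)) (\<lambda>x. m' (\<phi> x) *\<^sub>R G x)"
  unfolding C1grad_def
proof (intro conjI allI)
  fix x
  have "(m has_derivative (\<lambda>h. m' (\<phi> x) * h)) (at (\<phi> x))"
    using assms(2) by (simp add: has_field_derivative_def)
  from has_derivative_compose[OF C1gradD(1)[OF assms(1)] this]
  show "((\<lambda>x. m (\<phi> x)) has_derivative (\<lambda>h. (m' (\<phi> x) *\<^sub>R G x) \<bullet> h)) (at x)"
    by simp
  show "continuous_on UNIV (\<lambda>x. m' (\<phi> x) *\<^sub>R G x)"
    by (intro continuous_intros C1gradD(2)[OF assms(1)] continuous_on_compose2[OF assms(3) C1gradD(3)[OF assms(1)]]) auto
qed

text \<open>Functions of the norm need no regularity at the origin when the profile is constant near 0.\<close>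

lemma C1grad_radial:
  fixes m m' :: "real \<Rightarrow> real"
  assumes r0: "r0 > 0" and const: "\<And>r. r < r0 \<Longrightarrow> m r = c" "\<And>r. r < r0 \<Longrightarrow> m' r = 0"
    and der: "\<And>r. r > 0 \<Longrightarrow> (m has_real_derivative m' r) (at r)"
    and cont: "continuous_on {0<..} m'"
  shows "C1grad (\<lambda>x::real^'n. m (norm x)) (\<lambda>x. (m' (norm x) / norm x) *\<^sub>R x)"
  unfolding C1grad_def
proof (intro conjI allI)
  fix x :: "real^'n"
  show "((\<lambda>x. m (norm x)) has_derivative (\<lambda>h. ((m' (norm x) / norm x) *\<^sub>R x) \<bullet> h)) (at x)"
  proof (cases "norm x < r0")
    case True
    have o: "open {x::real^'n. norm x < r0}" by (intro open_Collect_less continuous_intros)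
    have "((\<lambda>x. m (norm x)) has_derivative (\<lambda>h. 0)) (at x)"
      by (rule has_derivative_transform_within_open[OF has_derivative_const o]) (use True const in auto)
    then show ?thesis using const(2)[OF True] by simp
  next
    case False
    then have x: "x \<noteq> 0" "norm x > 0" using r0 by auto
    have "(m has_derivative (\<lambda>h. m' (norm x) * h)) (at (norm x))"
      using der[OF x(2)] by (simp add: has_field_derivative_def)
    from has_derivative_compose[OF has_derivative_norm[OF x(1)] this]
    show ?thesis by (simp add: sgn_div_norm inner_commute divide_inverse algebra_simps)
  qed
next
  have o: "open {x::real^'n. norm x < r0}" by (intro open_Collect_less continuous_intros)
  have "continuous_on ({x::real^'n. norm x < r0} \<union> -{0}) (\<lambda>x. (m' (norm x) / norm x) *\<^sub>R x)"
  proof (rule continuous_on_open_Un[OF o])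
    show "continuous_on {x::real^'n. norm x < r0} (\<lambda>x. (m' (norm x) / norm x) *\<^sub>R x)"
      using const(2) by (auto intro!: continuous_on_eq[OF continuous_on_const])
    show "continuous_on (-{0::real^'n}) (\<lambda>x. (m' (norm x) / norm x) *\<^sub>R x)"
      by (intro continuous_intros continuous_on_compose2[OF cont]) auto
  qed auto
  moreover have "{x::real^'n. norm x < r0} \<union> -{0} = UNIV" using r0 by auto
  ultimately show "continuous_on UNIV (\<lambda>x::real^'n. (m' (norm x) / norm x) *\<^sub>R x)" by simp
qed

lemma integrable_continuous_bounded_support:
  fixes f :: "'a::euclidean_space \<Rightarrow> real"
  assumes "continuous_on UNIV f" "\<And>x. norm x > R \<Longrightarrow> f x = 0"
  shows "integrable lborel f" "integrable lebesgue f"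
proof -
  have "integrable lborel (\<lambda>x. indicator (cball 0 R) x *\<^sub>R f x)"
    by (rule borel_integrable_compact) (auto intro: continuous_on_subset[OF assms(1)])
  moreover have "(\<lambda>x. indicator (cball 0 R) x *\<^sub>R f x) = f"
    using assms(2) by (auto simp: indicator_def fun_eq_iff)
  ultimately show "integrable lborel f" by simp
  then show "integrable lebesgue f" by (subst integrable_completion) auto
qed

lemma bounded_continuous_bounded_support:
  fixes f :: "'a::euclidean_space \<Rightarrow> 'b::real_normed_vector"
  assumes "continuous_on UNIV f" "\<And>x. norm x > R \<Longrightarrow> f x = 0"
  obtains B where "B > 0" "\<And>x. norm (f x) \<le> B"
proof -
  have "compact (f ` cball 0 R)"
    by (intro compact_continuous_image continuous_on_subset[OF assms(1)]) auto
  then obtain B where B: "B > 0" "\<And>y. y \<in> f ` cball 0 R \<Longrightarrow> norm y \<le> B"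
    using compact_imp_bounded bounded_pos by metis
  show ?thesis
  proof (rule that[OF B(1)])
    fix x show "norm (f x) \<le> B"
      using B assms(2)[of x] by (cases "norm x \<le> R") auto
  qed
qed

text \<open>Translation invariance makes the integral of every difference quotient zero. The
  quotients are bounded by the sup norm of the gradient on a fixed ball, so dominated convergence
  passes to the derivative.\<close>

lemma integral_partial_eq_0:
  fixes \<phi> :: "real^'n \<Rightarrow> real"
  assumes C: "C1grad \<phi> G" and supp: "\<And>x. norm x > R \<Longrightarrow> \<phi> x = 0"
  shows "(\<integral>x. G x $ i \<partial>lebesgue) = 0"
proof -
  have G0: "G x = 0" if "norm x > R" for x by (rule C1grad_zero_outside[OF C supp that])
  obtain B where B: "B > 0" "\<And>x. norm (G x) \<le> B"
    using bounded_continuous_bounded_support[OF C1gradD(2)[OF C] G0] by metis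
  \<comment> \<open>Steps of length at most 1 keep all translated supports inside the ball of radius
    \<open>R + 1\<close>, which carries the dominating function.\<close>
  define t where "t k = 1 / (real k + 1)" for k
  have t: "t k > 0" "t k \<le> 1" for k by (auto simp: t_def)
  have norm_axis: "norm (axis i s :: real^'n) = \<bar>s\<bar>" for s
    by (simp add: norm_eq_sqrt_inner inner_axis_axis)
  let ?s = "\<lambda>k x. (\<phi> (axis i (t k) + x) - \<phi> x) / t k"
  have cont: "continuous_on UNIV \<phi>" by (rule C1gradD(3)[OF C])
  have [measurable]: "\<phi> \<in> borel_measurable borel" using cont by (rule borel_measurable_continuous_onI)
  have lim: "(\<lambda>k. ?s k x) \<longlonglongrightarrow> G x $ i" for x
  proof -
    have "((\<lambda>s. s *\<^sub>R axis i 1 + x) has_derivative (\<lambda>h. h *\<^sub>R axis i 1)) (at 0)"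
      by (auto intro!: derivative_eq_intros)
    moreover have "(\<phi> has_derivative (\<lambda>h. G x \<bullet> h)) (at (0 *\<^sub>R axis i 1 + x))"
      using C1gradD(1)[OF C] by simp
    ultimately have "((\<lambda>s. \<phi> (s *\<^sub>R axis i 1 + x)) has_derivative (\<lambda>h. G x \<bullet> (h *\<^sub>R axis i 1))) (at 0)"
      by (rule has_derivative_compose)
    then have "((\<lambda>s. \<phi> (s *\<^sub>R axis i 1 + x)) has_real_derivative G x $ i) (at 0)"
      by (simp add: has_field_derivative_def inner_axis mult.commute[of _ "G x $ i"] cart_eq_inner_axis[symmetric])
    then have l: "(\<lambda>h. (\<phi> (h *\<^sub>R axis i 1 + x) - \<phi> x) / h) \<midarrow>0\<rightarrow> G x $ i"
      by (simp add: DERIV_def)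
    have "filterlim t (at 0) sequentially"
      unfolding filterlim_at
    proof
      show "\<forall>\<^sub>F k in sequentially. t k \<in> UNIV \<and> t k \<noteq> 0" using t(1) by (auto simp: less_imp_neq[symmetric])
      show "t \<longlonglongrightarrow> 0" unfolding t_def using LIMSEQ_inverse_real_of_nat by (simp add: inverse_eq_divide add.commute)
    qed
    from filterlim_compose[OF l this] show ?thesis
      by (simp add: axis_def scaleR_vec_def if_distrib cong: if_cong)
  qed
  have on: "onorm (\<lambda>h. G x \<bullet> h) \<le> B" for x
  proof (rule onorm_le)
    fix h
    have "\<bar>G x \<bullet> h\<bar> \<le> norm (G x) * norm h" by (rule Cauchy_Schwarz_ineq2)
    also have "\<dots> \<le> B * norm h" by (intro mult_right_mono B) auto
    finally show "norm (G x \<bullet> h) \<le> B * norm h" by simp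
  qed
  have lip: "\<bar>\<phi> (axis i (t k) + x) - \<phi> x\<bar> \<le> B * t k" for k x
    using differentiable_bound[of UNIV \<phi> "\<lambda>x h. G x \<bullet> h" B "axis i (t k) + x" x] C1gradD(1)[OF C] on t(1)[of k]
    by (auto simp: norm_axis)
  have bd: "norm (?s k x) \<le> B * indicator (cball 0 (R+1)) x" for k x
  proof (cases "norm x \<le> R + 1")
    case True
    then show ?thesis using lip[of k x] t(1)[of k] by (simp add: field_simps)
  next
    case False
    have "norm x \<le> norm (axis i (t k) + x) + norm (axis i (t k) :: real^'n)"
      using norm_triangle_ineq4[of "axis i (t k) + x" "axis i (t k)"] by simp
    then have "norm (axis i (t k) + x) > R" using False t[of k] by (simp add: norm_axis)
    then show ?thesis using False supp t[of k] by simp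
  qed
  have int0: "integrable lborel \<phi>" by (rule integrable_continuous_bounded_support[OF cont supp])
  have tr: "integrable lborel (\<lambda>x. \<phi> (c + x)) \<and> (\<integral>x. \<phi> (c + x) \<partial>lborel) = (\<integral>x. \<phi> x \<partial>lborel)" for c
  proof -
    have "integrable (distr lborel borel ((+) c)) \<phi>" using int0 by (simp add: lborel_distr_plus)
    moreover have "(\<integral>x. \<phi> x \<partial>distr lborel borel ((+) c)) = (\<integral>x. \<phi> x \<partial>lborel)" by (simp add: lborel_distr_plus)
    ultimately show ?thesis by (simp add: integrable_distr_eq integral_distr)
  qed
  have z: "(\<integral>x. ?s k x \<partial>lborel) = 0" for k
    using tr[of "axis i (t k)"] int0 by simp
  have "(\<lambda>k. (\<integral>x. ?s k x \<partial>lborel)) \<longlonglongrightarrow> (\<integral>x. G x $ i \<partial>lborel)"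
  proof (rule integral_dominated_convergence)
    show "(\<lambda>x. G x $ i) \<in> borel_measurable lborel"
      using C1gradD(2)[OF C] by (auto intro!: borel_measurable_continuous_onI continuous_intros)
    show "integrable lborel (\<lambda>x::real^'n. B * indicator (cball 0 (R+1)) x)"
      by (intro integrable_mult_right integrable_real_indicator emeasure_lborel_cball_finite) auto
  qed (use lim bd in auto)
  then have "(\<integral>x. G x $ i \<partial>lborel) = 0" by (simp only: z LIMSEQ_const_iff)
  moreover have "(\<integral>x. G x $ i \<partial>lebesgue) = (\<integral>x. G x $ i \<partial>lborel)"
    by (rule integral_completion) (use C1gradD(2)[OF C] in \<open>auto intro!: borel_measurable_continuous_onI continuous_intros\<close>)
  ultimately show ?thesis by simp
qed

text \<open>The product with a test function again has bounded support, so the vanishing integral of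
  its partial derivative is the integration by parts formula.\<close>

lemma weak_grad_C1grad:
  fixes \<phi> :: "real^'n \<Rightarrow> real"
  assumes C: "C1grad \<phi> G"
  shows "weak_grad \<phi> G"
proof (rule weak_gradI)
  have "G \<in> borel_measurable borel" using C1gradD(2)[OF C] by (rule borel_measurable_continuous_onI)
  then show "G \<in> borel_measurable lebesgue" by (simp add: measurable_completion)
next
  fix i R and \<psi> :: "real^'n \<Rightarrow> real" and H assume D: "C1grad \<psi> H" "R > 0" and s: "\<And>x. norm x > R \<Longrightarrow> \<psi> x = 0"
  have H0: "H x = 0" if "norm x > R" for x by (rule C1grad_zero_outside[OF D(1) s that])
  have cont: "continuous_on UNIV (\<lambda>x. \<phi> x * H x $ i)" "continuous_on UNIV (\<lambda>x. G x $ i * \<psi> x)"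
    using C1gradD(2,3)[OF C] C1gradD(2,3)[OF D(1)] by (auto intro!: continuous_intros)
  have 1: "integrable lebesgue (\<lambda>x. \<phi> x * H x $ i)"
    by (rule integrable_continuous_bounded_support[OF cont(1), of R]) (use H0 in auto)
  have 2: "integrable lebesgue (\<lambda>x. G x $ i * \<psi> x)"
    by (rule integrable_continuous_bounded_support[OF cont(2), of R]) (use s in auto)
  have "(\<integral>x. (\<psi> x *\<^sub>R G x + \<phi> x *\<^sub>R H x) $ i \<partial>lebesgue) = 0"
    by (rule integral_partial_eq_0[OF C1grad_mult[OF C D(1)], of R]) (use s in auto)
  then have "(\<integral>x. G x $ i * \<psi> x \<partial>lebesgue) + (\<integral>x. \<phi> x * H x $ i \<partial>lebesgue) = 0"
    using 1 2 by (simp add: mult.commute[of "\<psi> _"])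
  then show "integrable lebesgue (\<lambda>x. \<phi> x * H x $ i) \<and> integrable lebesgue (\<lambda>x. G x $ i * \<psi> x)
      \<and> (\<integral>x. \<phi> x * H x $ i \<partial>lebesgue) = - (\<integral>x. G x $ i * \<psi> x \<partial>lebesgue)"
    using 1 2 by linarith
qed

section \<open>C^1 step functions and cutoffs\<close>

definition sstep :: "real \<Rightarrow> real" where
  "sstep t = 2 * (max 0 t)\<^sup>2 - 4 * (max 0 (t - 1/2))\<^sup>2 + 2 * (max 0 (t - 1))\<^sup>2"

text \<open>The hat function on [0,1] with peak 2 at 1/2 and integral 1; \<open>sstep\<close> is its
  primitive, a piecewise quadratic C^1 step from 0 to 1.\<close>

definition sstep' :: "real \<Rightarrow> real" where
  "sstep' t = 4 * max 0 t - 8 * max 0 (t - 1/2) + 4 * max 0 (t - 1)"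

lemma has_real_derivative_max_0_square:
  "((\<lambda>t::real. (max 0 t)\<^sup>2) has_real_derivative 2 * max 0 t) (at t)"
proof -
  consider "t < 0" | "t > 0" | "t = 0" by linarith
  then show ?thesis
  proof cases
    case 1
    have "((\<lambda>t::real. (max 0 t)\<^sup>2) has_real_derivative 0) (at t)"
      by (rule has_field_derivative_transform_within_open[of "\<lambda>_. 0" _ _ "{..<0}"]) (use 1 in auto)
    then show ?thesis using 1 by simp
  next
    case 2
    have "((\<lambda>t::real. (max 0 t)\<^sup>2) has_real_derivative 2 * t) (at t)"
      by (rule has_field_derivative_transform_within_open[of "\<lambda>t. t\<^sup>2" _ _ "{0<..}"])
        (use 2 in \<open>auto intro!: derivative_eq_intros\<close>)
    then show ?thesis using 2 by simp
  next
    case 3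
    have "((\<lambda>h::real. (max 0 h)\<^sup>2 / h) \<longlongrightarrow> 0) (at 0)"
    proof (rule Lim_null_comparison)
      show "\<forall>\<^sub>F h::real in at 0. norm ((max 0 h)\<^sup>2 / h) \<le> \<bar>h\<bar>"
        by (rule always_eventually) (auto simp: max_def power2_eq_square)
      show "((\<lambda>h::real. \<bar>h\<bar>) \<longlongrightarrow> 0) (at 0)" by (intro tendsto_eq_intros) auto
    qed
    then show ?thesis using 3 by (simp add: DERIV_def)
  qed
qed

lemma sstep_has_real_derivative: "(sstep has_real_derivative sstep' t) (at t)"
proof -
  have "((\<lambda>t::real. (max 0 (t - c))\<^sup>2) has_real_derivative 2 * max 0 (t - c)) (at t)" for c
    by (rule DERIV_cong[OF DERIV_chain2[OF has_real_derivative_max_0_square, where Db=1]])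
      (auto intro!: derivative_eq_intros)
  note * = this[of 0, simplified] this
  show ?thesis unfolding sstep_def[abs_def] sstep'_def
    by (rule derivative_eq_intros * refl | simp)+
qed

lemma continuous_on_sstep' [continuous_intros]:
  "continuous_on S f \<Longrightarrow> continuous_on S (\<lambda>x. sstep' (f x))"
  unfolding sstep'_def by (intro continuous_intros)

lemma continuous_on_sstep [continuous_intros]:
  "continuous_on S f \<Longrightarrow> continuous_on S (\<lambda>x. sstep (f x))"
  unfolding sstep_def by (intro continuous_intros)

lemma sstep_eq_0: "t \<le> 0 \<Longrightarrow> sstep t = 0" "t \<le> 0 \<Longrightarrow> sstep' t = 0"
  by (auto simp: sstep_def sstep'_def)

lemma sstep_eq_1: "t \<ge> 1 \<Longrightarrow> sstep t = 1" "t \<ge> 1 \<Longrightarrow> sstep' t = 0"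
  by (auto simp: sstep_def sstep'_def power2_eq_square algebra_simps)

lemma sstep_bounds: "0 \<le> sstep t" "sstep t \<le> 1"
proof -
  consider "t \<le> 0" | "0 < t" "t \<le> 1/2" | "1/2 < t" "t < 1" | "t \<ge> 1" by linarith
  then have "0 \<le> sstep t \<and> sstep t \<le> 1"
  proof cases
    case 2
    then have "sstep t = 2 * t\<^sup>2" by (simp add: sstep_def)
    moreover have "t\<^sup>2 \<le> (1/2)\<^sup>2" using 2 by (intro power_mono) auto
    ultimately show ?thesis by (simp add: power2_eq_square)
  next
    case 3
    then have "sstep t = 1 - 2 * (1 - t)\<^sup>2" by (simp add: sstep_def power2_eq_square algebra_simps)
    moreover have "(1 - t)\<^sup>2 \<le> (1/2)\<^sup>2" using 3 by (intro power_mono) auto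
    ultimately show ?thesis by (simp add: power2_eq_square)
  qed (auto simp: sstep_eq_0 sstep_eq_1)
  then show "0 \<le> sstep t" "sstep t \<le> 1" by auto
qed

lemma sstep_pos:
  assumes "s > 0"
  shows "sstep s > 0"
proof -
  consider "s \<le> 1/2" | "1/2 < s" "s < 1" | "s \<ge> 1" by linarith
  then show ?thesis
  proof cases
    case 1
    then show ?thesis using assms by (simp add: sstep_def)
  next
    case 2
    then have "sstep s = 1 - 2 * (1 - s)\<^sup>2" by (simp add: sstep_def power2_eq_square algebra_simps)
    moreover have "(1 - s)\<^sup>2 \<le> (1/2)\<^sup>2" using 2 by (intro power_mono) auto
    ultimately show ?thesis by (simp add: power2_eq_square)
  qed (simp add: sstep_eq_1)
qed

lemma sstep'_bounds: "0 \<le> sstep' t" "sstep' t \<le> 2"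
  by (auto simp: sstep'_def max_def)

text \<open>Since \<open>sstep 0 = 0\<close>, the limit at t = 0 is 0 for every k; the limit is
  therefore the indicator of the open half-line, matching the open orthants and open exteriors of
  balls used later.\<close>

lemma sstep_scaled_tendsto: "(\<lambda>k. sstep (real k * t)) \<longlonglongrightarrow> indicator {0<..} t"
proof (cases "t > 0")
  case True
  obtain k0 :: nat where k0: "1 / t < real k0" using reals_Archimedean2 by blast
  have "sstep (real k * t) = 1" if "k \<ge> k0" for k
  proof (rule sstep_eq_1)
    have "1 / t < real k" using k0 that by linarith
    then show "1 \<le> real k * t" using True by (simp add: field_simps)
  qed
  then have "\<forall>\<^sub>F k in sequentially. sstep (real k * t) = 1"
    unfolding eventually_sequentially by blast
  then show ?thesis using True by (simp add: tendsto_eventually)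
next
  case False
  then show ?thesis by (auto simp: sstep_eq_0 mult_nonneg_nonpos)
qed

lemma C1grad_cutoff:
  assumes "R > 0"
  shows "C1grad (\<lambda>x::real^'n. sstep (R + 1 - norm x)) (\<lambda>x. (- sstep' (R + 1 - norm x) / norm x) *\<^sub>R x)"
proof (rule C1grad_radial[OF assms])
  show "((\<lambda>r. sstep (R + 1 - r)) has_real_derivative - sstep' (R + 1 - r)) (at r)" for r
    by (rule DERIV_cong[OF DERIV_chain2[OF sstep_has_real_derivative, where Db="-1"]])
      (auto intro!: derivative_eq_intros)
qed (auto simp: sstep_eq_1 intro!: continuous_intros)

text \<open>Open orthants generate the Borel sets and are stable under intersection, so by the
  Dynkin argument the signed measure with density \<open>Z\<close> vanishes on every Borel set; a
  density is determined almost everywhere by its integrals.\<close>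

lemma AE_zero_if_orthants:
  fixes Z :: "'a::ordered_euclidean_space \<Rightarrow> real"
  assumes Z: "integrable lborel Z"
    and orth: "\<And>a. (\<integral>x\<in>{x. eucl_less a x}. Z x \<partial>lborel) = 0"
  shows "AE x in lborel. Z x = 0"
proof -
  let ?G = "range (\<lambda>a::'a. {x. eucl_less a x})"
  have meas: "{x. eucl_less a x} \<in> sets borel" for a :: 'a
    unfolding borel_eq_greaterThan by auto
  have si: "set_integrable lborel A Z" if "A \<in> sets borel" for A
    using integrable_mult_indicator[of A lborel Z] Z that by (simp add: set_integrable_def)
  \<comment> \<open>The orthants with corner (-k, ..., -k) exhaust the space. The total integral is
    needed for the complement case of the induction below.\<close>
  have tot: "(\<integral>x. Z x \<partial>lborel) = 0"
  proof -
    have "(\<lambda>k::nat. (\<integral>x\<in>{x. eucl_less (- real k *\<^sub>R One) x}. Z x \<partial>lborel)) \<longlonglongrightarrow> (\<integral>x. Z x \<partial>lborel)"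
      unfolding set_lebesgue_integral_def
    proof (rule integral_dominated_convergence)
      show "Z \<in> borel_measurable lborel" using Z by auto
      show "(\<lambda>x. indicator {x. eucl_less (- real k *\<^sub>R One) x} x *\<^sub>R Z x) \<in> borel_measurable lborel" for k
        using Z meas by auto
      show "integrable lborel (\<lambda>x. norm (Z x))" using Z by auto
      show "AE x in lborel. (\<lambda>k. indicator {x. eucl_less (- real k *\<^sub>R One) x} x *\<^sub>R Z x) \<longlonglongrightarrow> Z x"
      proof (rule AE_I2)
        fix x :: 'a
        obtain k0 :: nat where k0: "norm x < real k0" using reals_Archimedean2 by blast
        have "eucl_less (- real k *\<^sub>R One) x" if "k \<ge> k0" for k
          unfolding eucl_less_def
        proof
          fix i :: 'a assume i: "i \<in> Basis"
          have "\<bar>x \<bullet> i\<bar> \<le> norm x" by (rule Basis_le_norm[OF i])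
          then show "(- real k *\<^sub>R One) \<bullet> i < x \<bullet> i" using k0 that i by simp
        qed
        then have "\<forall>\<^sub>F k in sequentially. indicator {x. eucl_less (- real k *\<^sub>R One) x} x *\<^sub>R Z x = Z x"
          unfolding eventually_sequentially by (intro exI[of _ k0]) auto
        then show "(\<lambda>k. indicator {x. eucl_less (- real k *\<^sub>R One) x} x *\<^sub>R Z x) \<longlonglongrightarrow> Z x"
          by (rule tendsto_eventually)
      qed
    qed (auto simp: indicator_def)
    then show ?thesis by (simp only: orth LIMSEQ_const_iff)
  qed
  have "(\<integral>x\<in>A. Z x \<partial>lborel) = 0" if A: "A \<in> sets lborel" for A
  proof -
    have As: "A \<in> sigma_sets UNIV ?G" using A unfolding sets_lborel borel_eq_greaterThan by simp
    have Is: "Int_stable ?G"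
    proof (rule Int_stableI_image)
      fix a b :: 'a
      have "{x. eucl_less a x} \<inter> {x. eucl_less b x} = {x. eucl_less (\<Sum>i\<in>Basis. max (a \<bullet> i) (b \<bullet> i) *\<^sub>R i) x}"
        by (auto simp: eucl_less_def)
      then show "\<exists>c\<in>UNIV. {x. eucl_less a x} \<inter> {x. eucl_less b x} = {x. eucl_less c x}" by blast
    qed
    have Ps: "?G \<subseteq> Pow UNIV" by simp
    from Is Ps As show ?thesis
    proof (induction rule: sigma_sets_induct_disjoint)
      case (compl A)
      then have A: "A \<in> sets borel" unfolding borel_eq_greaterThan by simp
      have "(\<integral>x\<in>UNIV - A. Z x \<partial>lborel) = (\<integral>x. Z x - indicator A x *\<^sub>R Z x \<partial>lborel)"
        unfolding set_lebesgue_integral_def by (intro Bochner_Integration.integral_cong) (auto simp: indicator_def)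
      also have "\<dots> = 0"
        using compl tot Z si[OF A] by (simp add: set_lebesgue_integral_def set_integrable_def)
      finally show ?case .
    next
      case (union A)
      then have A: "A i \<in> sets borel" for i unfolding borel_eq_greaterThan by auto
      have "(\<integral>x\<in>(\<Union>i. A i). Z x \<partial>lborel) = (\<Sum>i. (\<integral>x\<in>A i. Z x \<partial>lborel))"
        by (rule lebesgue_integral_countable_add) (use union A si in \<open>auto simp: disjoint_family_on_def\<close>)
      then show ?case using union by simp
    qed (auto simp: orth set_lebesgue_integral_def[of _ "{}"])
  qed
  then show ?thesis
    using density_unique_real[OF Z integrable_zero] by (simp add: set_lebesgue_integral_def)
qed

section \<open>The fundamental lemma and uniqueness of weak gradients\<close>

lemma C1grad_const: "C1grad (\<lambda>_. c) (\<lambda>_. 0)"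
  by (auto simp: C1grad_def)

lemma C1grad_orthant_step:
  fixes a :: "real^'n"
  assumes "finite S"
  shows "\<exists>G. C1grad (\<lambda>x::real^'n. \<Prod>i\<in>S. sstep (k * (x $ i - a $ i))) G"
  using assms
proof induction
  case empty
  then show ?case using C1grad_const by auto
next
  case (insert i S)
  have "C1grad (\<lambda>x::real^'n. sstep (k * (x $ i - a $ i))) (\<lambda>x. (k * sstep' (k * (x $ i - a $ i))) *\<^sub>R axis i 1)"
  proof (rule C1grad_compose[OF C1grad_component])
    show "((\<lambda>t. sstep (k * (t - a $ i))) has_real_derivative k * sstep' (k * (t - a $ i))) (at t)" for t
      by (rule DERIV_cong[OF DERIV_chain2[OF sstep_has_real_derivative, where Db=k]])
        (auto intro!: derivative_eq_intros)
  qed (intro continuous_intros)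
  then show ?case using insert C1grad_mult by fastforce
qed

text \<open>Nothing is assumed on \<open>z\<close> itself; multiplying by a cutoff that is 1 on a
  ball makes it integrable, hence measurable. Products of one-dimensional steps times the cutoff are
  admissible test functions, and they converge to indicators of open orthants.\<close>

lemma fundamental_lemma:
  fixes z :: "real^'n \<Rightarrow> real"
  assumes int: "\<And>\<phi> G R. C1grad \<phi> G \<Longrightarrow> (\<And>x. norm x > R \<Longrightarrow> \<phi> x = 0) \<Longrightarrow> integrable lebesgue (\<lambda>x. z x * \<phi> x)"
    and zero: "\<And>\<phi> G R. C1grad \<phi> G \<Longrightarrow> (\<And>x. norm x > R \<Longrightarrow> \<phi> x = 0) \<Longrightarrow> (\<integral>x. z x * \<phi> x \<partial>lebesgue) = 0"
  shows "AE x in lebesgue. z x = 0"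
proof -
  have ball: "AE x in lebesgue. norm x \<le> R \<longrightarrow> z x = 0" if R: "R > 0" for R
  proof -
    define \<xi> where "\<xi> = (\<lambda>x::real^'n. sstep (R + 1 - norm x))"
    obtain H where H: "C1grad \<xi> H" unfolding \<xi>_def using C1grad_cutoff[OF R] by blast
    have s: "\<xi> x = 0" if "norm x > R + 1" for x using that by (simp add: \<xi>_def sstep_eq_0)
    define Z where "Z x = z x * \<xi> x" for x
    have Z: "integrable lebesgue Z" unfolding Z_def by (rule int[OF H s])
    \<comment> \<open>A Borel version is needed because the orthant criterion is about the Borel
      measure \<open>lborel\<close>, while \<open>Z\<close> is only Lebesgue measurable.\<close>
    obtain Y where Y: "Y \<in> borel_measurable lborel" "AE x in lborel. Z x = Y x"
      using completion_ex_borel_measurable_real[of Z lborel] Z by auto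
    have YZ: "AE x in lebesgue. Z x = Y x" using Y(2) by (rule AE_completion)
    have Y': "integrable lebesgue Y"
      using Z YZ Y(1) by (subst integrable_cong_AE[of Y _ Z]) (auto intro: measurable_completion)
    then have Yi: "integrable lborel Y" using Y(1) by (simp add: integrable_completion)
    have "AE x in lborel. Y x = 0"
    proof (rule AE_zero_if_orthants[OF Yi])
      fix a :: "real^'n"
      define p where "p k x = (\<Prod>i\<in>UNIV. sstep (real k * (x $ i - a $ i)))" for k :: nat and x :: "real^'n"
      have p01: "0 \<le> p k x" "p k x \<le> 1" for k x
        by (auto simp: p_def intro!: prod_nonneg prod_le_1 sstep_bounds)
      have pm: "p k \<in> borel_measurable lebesgue" for k
      proof -
        have "continuous_on UNIV (p k)" unfolding p_def by (intro continuous_intros)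
        then have "p k \<in> borel_measurable borel" by (rule borel_measurable_continuous_onI)
        then show ?thesis by (simp add: measurable_completion)
      qed
      have lim: "(\<lambda>k. p k x) \<longlonglongrightarrow> indicator {x. eucl_less a x} x" for x
      proof -
        have "(\<lambda>k. p k x) \<longlonglongrightarrow> (\<Prod>i\<in>UNIV. indicator {0<..} (x $ i - a $ i))"
          unfolding p_def by (intro tendsto_prod sstep_scaled_tendsto)
        moreover have "(\<Prod>i\<in>UNIV. indicator {0<..} (x $ i - a $ i)) = (indicator {x. eucl_less a x} x :: real)"
        proof (cases "\<forall>i. a $ i < x $ i")
          case True
          then have "eucl_less a x" by (auto simp: eucl_less_def Basis_vec_def inner_axis)
          then show ?thesis using True by simp
        next
          case False
          then obtain i where i: "\<not> a $ i < x $ i" by blast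
          then have "\<not> eucl_less a x"
            by (auto simp: eucl_less_def cart_eq_inner_axis)
          moreover have "(\<Prod>i\<in>UNIV. indicator {0<..} (x $ i - a $ i)) = (0::real)"
            by (rule prod_zero) (use i in \<open>auto intro!: exI[of _ i]\<close>)
          ultimately show ?thesis by simp
        qed
        ultimately show ?thesis by simp
      qed
      have "(\<lambda>k. (\<integral>x. p k x * Z x \<partial>lebesgue)) \<longlonglongrightarrow> (\<integral>x. indicator {x. eucl_less a x} x * Y x \<partial>lebesgue)"
      proof (rule integral_dominated_convergence)
        have "{x. eucl_less a x} \<in> sets borel" unfolding borel_eq_greaterThan by auto
        then show "(\<lambda>x. indicator {x. eucl_less a x} x * Y x) \<in> borel_measurable lebesgue"
          using Y(1) by (intro measurable_completion) auto
        show "(\<lambda>x. p k x * Z x) \<in> borel_measurable lebesgue" for k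
          using pm Z by auto
        show "integrable lebesgue (\<lambda>x. norm (Z x))" using Z by auto
        show "AE x in lebesgue. (\<lambda>k. p k x * Z x) \<longlonglongrightarrow> indicator {x. eucl_less a x} x * Y x"
          using YZ by eventually_elim (auto intro!: tendsto_mult lim)
        show "AE x in lebesgue. norm (p k x * Z x) \<le> norm (Z x)" for k
          using p01[of k] by (auto simp: abs_mult intro!: mult_left_le_one_le)
      qed
      moreover have "(\<integral>x. p k x * Z x \<partial>lebesgue) = 0" for k
      proof -
        obtain G where G: "C1grad (p k) G"
          using C1grad_orthant_step[of UNIV "real k" a] unfolding p_def by auto
        have "(\<integral>x. z x * (p k x * \<xi> x) \<partial>lebesgue) = 0"
          by (rule zero[OF C1grad_mult[OF G H], of "R + 1"]) (use s in auto)
        then show ?thesis by (simp add: Z_def algebra_simps)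
      qed
      ultimately have "(\<integral>x. indicator {x. eucl_less a x} x * Y x \<partial>lebesgue) = 0"
        by (simp add: LIMSEQ_const_iff)
      moreover have "(\<integral>x. indicator {x. eucl_less a x} x * Y x \<partial>lebesgue) = (\<integral>x. indicator {x. eucl_less a x} x * Y x \<partial>lborel)"
      proof (rule integral_completion)
        have "{x. eucl_less a x} \<in> sets borel" unfolding borel_eq_greaterThan by auto
        then show "(\<lambda>x. indicator {x. eucl_less a x} x * Y x) \<in> borel_measurable lborel" using Y(1) by auto
      qed
      ultimately show "(\<integral>x\<in>{x. eucl_less a x}. Y x \<partial>lborel) = 0" by (simp add: set_lebesgue_integral_def)
    qed
    then have "AE x in lebesgue. Y x = 0" by (rule AE_completion)
    with YZ show ?thesis
    proof eventually_elim
      case (elim x)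
      then have "z x * \<xi> x = 0" by (simp add: Z_def)
      moreover have "\<xi> x = 1" if "norm x \<le> R" using that by (simp add: \<xi>_def sstep_eq_1)
      ultimately show ?case by auto
    qed
  qed
  have "AE x in lebesgue. \<forall>k::nat. norm x \<le> real k + 1 \<longrightarrow> z x = 0"
    unfolding AE_all_countable using ball by auto
  then show ?thesis
  proof eventually_elim
    case (elim x)
    obtain k :: nat where "norm x < real k" using reals_Archimedean2 by blast
    then show ?case using elim[rule_format, of k] by simp
  qed
qed

lemma weak_grad_unique:
  assumes "weak_grad u g" "weak_grad u h"
  shows "AE x in lebesgue. g x = h x"
proof -
  have "AE x in lebesgue. g x $ i - h x $ i = 0" for i
  proof (rule fundamental_lemma)
    fix \<phi> :: "real^'a \<Rightarrow> real" and G R assume C: "C1grad \<phi> G" and s: "\<And>x. norm x > R \<Longrightarrow> \<phi> x = 0"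
    note g = weak_gradD[OF assms(1) C s, where i=i] and h = weak_gradD[OF assms(2) C s, where i=i]
    show "integrable lebesgue (\<lambda>x. (g x $ i - h x $ i) * \<phi> x)"
      using g(2) h(2) by (simp add: left_diff_distrib)
    show "(\<integral>x. (g x $ i - h x $ i) * \<phi> x \<partial>lebesgue) = 0"
      using g h by (simp add: left_diff_distrib)
  qed
  then have "AE x in lebesgue. \<forall>i. g x $ i = h x $ i" by (simp add: AE_all_countable)
  then show ?thesis by (simp add: vec_eq_iff)
qed

section \<open>Integration of radial functions\<close>

lemma AE_norm_neq: "AE x::'a::euclidean_space in lebesgue. norm x \<noteq> r"
proof -
  have "sphere (0::'a) r \<in> null_sets lebesgue" using negligible_sphere negligible_iff_null_sets by blast
  then have "AE x::'a in lebesgue. x \<notin> sphere 0 r" by (rule AE_not_in)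
  then show ?thesis by simp
qed

text \<open>The surface area of the unit sphere.\<close>

definition sphere_vol :: "'a::euclidean_space itself \<Rightarrow> real" where
  "sphere_vol _ = real DIM('a) * unit_ball_vol (real DIM('a))"

lemma sphere_vol_pos: "sphere_vol TYPE('a::euclidean_space) > 0"
  by (simp add: sphere_vol_def)

text \<open>Polar coordinates for radial functions. Both measures give a half-line up to r the
  volume of the ball of radius r, and such half-lines determine a measure.\<close>

lemma distr_norm_lborel:
  "distr lborel borel (norm :: 'a::euclidean_space \<Rightarrow> real) =
    density lborel (\<lambda>r. ennreal (indicator {0..} r * (sphere_vol TYPE('a) * r ^ (DIM('a) - 1))))"
    (is "?M = density lborel ?f")
proof (rule measure_eqI_generator_eq)
  show "Int_stable (range (\<lambda>a::real. {..a}))"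
    by (auto simp: Int_stable_def)
  show "sets ?M = sigma_sets UNIV (range (\<lambda>a::real. {..a}))" "sets (density lborel ?f) = sigma_sets UNIV (range (\<lambda>a::real. {..a}))"
    by (auto simp: borel_eq_atMost)
  show "(\<Union>i::nat. {..real i}) = UNIV" by (auto intro: real_arch_simple)
  have M: "emeasure ?M {..r} = (if r < 0 then 0 else ennreal (unit_ball_vol (real DIM('a)) * r ^ DIM('a)))" for r
  proof -
    have "emeasure ?M {..r} = emeasure lborel (cball (0::'a) r)"
      by (subst emeasure_distr) (auto intro!: arg_cong2[where f=emeasure])
    then show ?thesis by (auto simp: emeasure_cball)
  qed
  show "emeasure ?M {..real i} \<noteq> \<infinity>" for i :: nat by (simp add: M)
  fix X assume "X \<in> range (\<lambda>a::real. {..a})"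
  then obtain r where X: "X = {..r}" by blast
  have "emeasure (density lborel ?f) X = (\<integral>\<^sup>+s. ?f s * indicator {..r} s \<partial>lborel)"
    unfolding X by (rule emeasure_density) auto
  also have "\<dots> = (\<integral>\<^sup>+s. ennreal (sphere_vol TYPE('a) * s ^ (DIM('a) - 1)) * indicator {0..r} s \<partial>lborel)"
    by (intro nn_integral_cong) (auto simp: indicator_def)
  also have "\<dots> = emeasure ?M X"
  proof (cases "r < 0")
    case True
    then show ?thesis by (simp add: M X)
  next
    case False
    have "(\<integral>\<^sup>+s. ennreal (sphere_vol TYPE('a) * s ^ (DIM('a) - 1)) * indicator {0..r} s \<partial>lborel)
        = ennreal (unit_ball_vol (real DIM('a)) * r ^ DIM('a) - unit_ball_vol (real DIM('a)) * 0 ^ DIM('a))"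
    proof (rule nn_integral_FTC_Icc)
      show "((\<lambda>r. unit_ball_vol (real DIM('a)) * r ^ DIM('a)) has_real_derivative sphere_vol TYPE('a) * s ^ (DIM('a) - 1))
        (at s)" for s
        by (auto intro!: derivative_eq_intros simp: sphere_vol_def)
    qed (use False sphere_vol_pos[where 'a='a] in auto)
    then show ?thesis using False by (simp add: M X)
  qed
  finally show "emeasure ?M X = emeasure (density lborel ?f) X" by simp
qed auto

lemma nn_integral_radial:
  fixes p :: "real \<Rightarrow> ennreal"
  assumes [measurable]: "p \<in> borel_measurable borel"
  shows "(\<integral>\<^sup>+x. p (norm (x::'a::euclidean_space)) \<partial>lborel) =
    (\<integral>\<^sup>+r. ennreal (indicator {0..} r * (sphere_vol TYPE('a) * r ^ (DIM('a) - 1))) * p r \<partial>lborel)"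
proof -
  have "(\<integral>\<^sup>+x. p (norm (x::'a)) \<partial>lborel) = (\<integral>\<^sup>+r. p r \<partial>distr lborel borel (norm :: 'a \<Rightarrow> real))"
    by (rule nn_integral_distr[symmetric]) auto
  then show ?thesis by (simp add: distr_norm_lborel nn_integral_density)
qed

lemma integral_radial:
  fixes p :: "real \<Rightarrow> real"
  assumes [measurable]: "p \<in> borel_measurable borel"
  shows "integrable lborel (\<lambda>x::'a::euclidean_space. p (norm x)) \<longleftrightarrow>
      integrable lborel (\<lambda>r. indicator {0..} r * (sphere_vol TYPE('a) * r ^ (DIM('a) - 1)) * p r)" (is ?A)
    and "(\<integral>x. p (norm (x::'a)) \<partial>lborel) =
      (\<integral>r. indicator {0..} r * (sphere_vol TYPE('a) * r ^ (DIM('a) - 1)) * p r \<partial>lborel)" (is ?B)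
proof -
  have nn: "AE r in lborel. 0 \<le> indicator {0..} r * (sphere_vol TYPE('a) * r ^ (DIM('a) - 1))"
    using sphere_vol_pos[where 'a='a] by (auto simp: indicator_def)
  have "integrable lborel (\<lambda>x::'a. p (norm x)) \<longleftrightarrow> integrable (distr lborel borel (norm :: 'a \<Rightarrow> real)) p"
    by (rule integrable_distr_eq[symmetric]) auto
  then show ?A unfolding distr_norm_lborel using nn by (simp add: integrable_density)
  have "(\<integral>x. p (norm (x::'a)) \<partial>lborel) = (\<integral>r. p r \<partial>distr lborel borel (norm :: 'a \<Rightarrow> real))"
    by (rule integral_distr[symmetric]) auto
  then show ?B unfolding distr_norm_lborel using nn by (simp add: integral_density)
qed

section \<open>Powers of the norm inside and outside balls\<close>

lemma nn_integral_norm_powr_outside: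
  assumes e: "e < - real DIM('a::euclidean_space)" and r: "r > 0"
  shows "(\<integral>\<^sup>+x. ennreal (indicator {r..} (norm (x::'a)) * norm x powr e) \<partial>lborel)
    = ennreal (sphere_vol TYPE('a) / - (e + real DIM('a)) * r powr (e + real DIM('a)))"
proof -
  have n: "real (DIM('a) - 1) = real DIM('a) - 1" by (simp add: of_nat_diff)
  have "(\<integral>\<^sup>+x. ennreal (indicator {r..} (norm (x::'a)) * norm x powr e) \<partial>lborel)
    = (\<integral>\<^sup>+s. ennreal (indicator {0..} s * (sphere_vol TYPE('a) * s ^ (DIM('a) - 1))) * ennreal (indicator {r..} s * s powr e) \<partial>lborel)"
    by (rule nn_integral_radial) auto
  also have "\<dots> = (\<integral>\<^sup>+s. ennreal (sphere_vol TYPE('a)) * ennreal (indicator {r..} s * s powr (e + real DIM('a) - 1)) \<partial>lborel)"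
  proof (intro nn_integral_cong)
    fix s
    have "s ^ (DIM('a) - 1) * s powr e = s powr (e + real DIM('a) - 1)" if "s \<ge> r"
    proof -
      have "s ^ (DIM('a) - 1) * s powr e = s powr (real (DIM('a) - 1)) * s powr e"
        using that r by (subst powr_realpow) auto
      then show ?thesis by (simp add: powr_add[symmetric] n algebra_simps)
    qed
    then show "ennreal (indicator {0..} s * (sphere_vol TYPE('a) * s ^ (DIM('a) - 1))) * ennreal (indicator {r..} s * s powr e)
      = ennreal (sphere_vol TYPE('a)) * ennreal (indicator {r..} s * s powr (e + real DIM('a) - 1))"
      using r sphere_vol_pos[where 'a='a]
      by (auto simp: indicator_def ennreal_mult[symmetric] mult.assoc)
  qed
  also have "\<dots> = ennreal (sphere_vol TYPE('a)) * (\<integral>\<^sup>+s. ennreal (indicator {r..} s * s powr (e + real DIM('a) - 1)) \<partial>lborel)"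
    by (rule nn_integral_cmult) auto
  also have "(\<integral>\<^sup>+s. ennreal (indicator {r..} s * s powr (e + real DIM('a) - 1)) \<partial>lborel)
      = ennreal (- (r powr (e + real DIM('a) - 1 + 1)) / (e + real DIM('a) - 1 + 1))"
    by (rule nn_integral_has_integral_lebesgue[OF _ has_integral_powr_to_inf]) (use e r in auto)
  also have "ennreal (sphere_vol TYPE('a)) * \<dots>
      = ennreal (sphere_vol TYPE('a) * (- (r powr (e + real DIM('a) - 1 + 1)) / (e + real DIM('a) - 1 + 1)))"
    using e sphere_vol_pos[where 'a='a] by (intro ennreal_mult[symmetric]) (auto intro!: divide_nonneg_neg divide_nonpos_neg)
  also have "sphere_vol TYPE('a) * (- (r powr (e + real DIM('a) - 1 + 1)) / (e + real DIM('a) - 1 + 1))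
      = sphere_vol TYPE('a) / - (e + real DIM('a)) * r powr (e + real DIM('a))"
  proof -
    have "c * (- p / d) = c / - d * p" for c d p :: real by simp
    then show ?thesis by (simp only: diff_add_cancel)
  qed
  finally show ?thesis .
qed

lemma nn_integral_norm_powr_inside:
  assumes e: "e > - real DIM('a::euclidean_space)" and r: "r \<ge> 0"
  shows "(\<integral>\<^sup>+x. ennreal (indicator {..r} (norm (x::'a)) * norm x powr e) \<partial>lborel)
    = ennreal (sphere_vol TYPE('a) / (e + real DIM('a)) * r powr (e + real DIM('a)))"
proof -
  have n: "real (DIM('a) - 1) = real DIM('a) - 1" by (simp add: of_nat_diff)
  have "(\<integral>\<^sup>+x. ennreal (indicator {..r} (norm (x::'a)) * norm x powr e) \<partial>lborel)
    = (\<integral>\<^sup>+s. ennreal (indicator {0..} s * (sphere_vol TYPE('a) * s ^ (DIM('a) - 1))) * ennreal (indicator {..r} s * s powr e) \<partial>lborel)"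
    by (rule nn_integral_radial) auto
  also have "\<dots> = (\<integral>\<^sup>+s. ennreal (sphere_vol TYPE('a)) * ennreal (indicator {0..r} s * s powr (e + real DIM('a) - 1)) \<partial>lborel)"
  proof (intro nn_integral_cong)
    fix s
    have "s ^ (DIM('a) - 1) * s powr e = s powr (e + real DIM('a) - 1)" if "s \<ge> 0"
    proof (cases "s = 0")
      case False
      have "s ^ (DIM('a) - 1) * s powr e = s powr (real (DIM('a) - 1)) * s powr e"
        using that False by (subst powr_realpow) auto
      then show ?thesis by (simp add: powr_add[symmetric] n algebra_simps)
    qed simp
    then show "ennreal (indicator {0..} s * (sphere_vol TYPE('a) * s ^ (DIM('a) - 1))) * ennreal (indicator {..r} s * s powr e)
      = ennreal (sphere_vol TYPE('a)) * ennreal (indicator {0..r} s * s powr (e + real DIM('a) - 1))"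
      using r sphere_vol_pos[where 'a='a]
      by (auto simp: indicator_def ennreal_mult[symmetric] mult.assoc)
  qed
  also have "\<dots> = ennreal (sphere_vol TYPE('a)) * (\<integral>\<^sup>+s. ennreal (indicator {0..r} s * s powr (e + real DIM('a) - 1)) \<partial>lborel)"
    by (rule nn_integral_cmult) auto
  also have "(\<integral>\<^sup>+s. ennreal (indicator {0..r} s * s powr (e + real DIM('a) - 1)) \<partial>lborel)
      = ennreal (r powr (e + real DIM('a) - 1 + 1) / (e + real DIM('a) - 1 + 1))"
    by (rule nn_integral_has_integral_lebesgue[OF _ has_integral_powr_from_0]) (use e r in auto)
  finally show ?thesis using e sphere_vol_pos[where 'a='a]
    by (subst (asm) ennreal_mult[symmetric]) (auto simp: divide_simps)
qed

lemma integrable_norm_powr_outside: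
  assumes e: "e < - real DIM('a::euclidean_space)" and r: "r > 0"
  shows "integrable lborel (\<lambda>x::'a. indicator {r..} (norm x) * norm x powr e)"
    and "(\<integral>x. indicator {r..} (norm (x::'a)) * norm x powr e \<partial>lborel)
      = sphere_vol TYPE('a) / - (e + real DIM('a)) * r powr (e + real DIM('a))"
proof -
  have "has_bochner_integral lborel (\<lambda>x::'a. indicator {r..} (norm x) * norm x powr e)
    (sphere_vol TYPE('a) / - (e + real DIM('a)) * r powr (e + real DIM('a)))"
    by (rule has_bochner_integral_nn_integral[OF _ _ _ nn_integral_norm_powr_outside[OF assms]])
      (use assms sphere_vol_pos[where 'a='a] in \<open>auto intro!: mult_nonneg_nonneg divide_nonneg_neg simp: divide_nonpos_pos divide_nonneg_nonneg\<close>)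
  then show "integrable lborel (\<lambda>x::'a. indicator {r..} (norm x) * norm x powr e)"
    and "(\<integral>x. indicator {r..} (norm (x::'a)) * norm x powr e \<partial>lborel)
      = sphere_vol TYPE('a) / - (e + real DIM('a)) * r powr (e + real DIM('a))"
    by (auto simp: has_bochner_integral_iff)
qed

lemma integrable_norm_powr_inside:
  assumes e: "e > - real DIM('a::euclidean_space)"
  shows "integrable lborel (\<lambda>x::'a. indicator {..r} (norm x) * norm x powr e)"
proof (cases "r \<ge> 0")
  case True
  show ?thesis
    by (rule integrableI_nonneg) (auto simp: nn_integral_norm_powr_inside[OF e True] )
next
  case False
  then have "indicator {..r} (norm x) = (0::real)" for x :: 'a
    using norm_ge_zero[of x] by (auto simp: indicator_def simp del: norm_ge_zero)
  then show ?thesis by simp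
qed

text \<open>\<open>radial\<close> supplies a profile \<open>v\<close> without any measurability. It
  is shown to be measurable for the completion of the image of Lebesgue measure under the norm, and
  a function measurable for a completion has a Borel version.\<close>

lemma radial_profile_borel:
  fixes u :: "'a::euclidean_space \<Rightarrow> real"
  assumes u: "u \<in> borel_measurable lebesgue" and v: "AE x in lebesgue. u x = v (norm x)"
  obtains w where "w \<in> borel_measurable borel" "AE x in lebesgue. u x = w (norm x)"
proof -
  define M where "M = distr lborel borel (norm :: 'a \<Rightarrow> real)"
  have sM: "sets M = sets borel" "space M = UNIV" by (auto simp: M_def)
  have nM: "A \<in> null_sets M" if "A \<in> sets borel" "negligible {x::'a. norm x \<in> A}" for A
  proof -
    have "emeasure M A = emeasure lborel (norm -` A \<inter> space lborel :: 'a set)"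
      unfolding M_def by (rule emeasure_distr) (use that in auto)
    also have "norm -` A \<inter> space lborel = {x::'a. norm x \<in> A}" by auto
    also have "emeasure lborel {x::'a. norm x \<in> A} = 0"
    proof -
      have "{x::'a. norm x \<in> A} \<in> sets lborel"
        using that(1) measurable_sets[of norm "borel :: 'a measure" borel A] by (auto simp: vimage_def)
      then show ?thesis using that(2) by (simp add: negligible_iff_null_sets null_sets_completion_iff null_setsD1)
    qed
    finally show ?thesis using that by (auto simp: sM)
  qed
  \<comment> \<open>The function agrees almost everywhere with the measurable \<open>u\<close>, and
    Lebesgue measure is complete.\<close>
  have vm: "(\<lambda>x. v (norm x)) \<in> borel_measurable (lebesgue :: 'a measure)"
  proof (rule borel_measurableI_greater)
    fix y
    obtain N where N: "negligible N" "{x. u x \<noteq> v (norm x)} \<subseteq> N"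
      using v by (auto simp: eventually_ae_filter negligible_iff_null_sets)
    let ?S = "{x::'a. y < v (norm x)}"
    have T: "{x. y < u x} \<in> sets lebesgue" using borel_measurable_less[OF borel_measurable_const u] by simp
    have "negligible (?S \<inter> N)" using N(1) by (rule negligible_subset) auto
    then have n: "?S \<inter> N \<in> sets lebesgue" "N \<in> sets lebesgue"
      using N(1) by (auto simp: negligible_iff_null_sets)
    have "x \<in> N \<or> u x = v (norm x)" for x using N(2) by blast
    then have "?S = ({x. y < u x} - N) \<union> (?S \<inter> N)" by auto metis+
    also have "\<dots> \<in> sets lebesgue" using T n by blast
    finally show "{x \<in> space lebesgue. y < v (norm (x::'a))} \<in> sets lebesgue" by simp
  qed
  \<comment> \<open>Measurability of the preimage under the norm is pushed down to the line because the norm maps closed sets to \<open>F\<^sub>\<sigma>\<close> sets.\<close>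
  have inner: "\<exists>B\<in>sets borel. B \<subseteq> A \<and> negligible {x::'a. norm x \<in> A - B}"
    if A: "{x::'a. norm x \<in> A} \<in> sets lebesgue" for A :: "real set"
  proof -
    obtain C T where CT: "fsigma C" "T \<in> null_sets lebesgue" "C \<union> T = {x::'a. norm x \<in> A}" "disjnt C T"
      by (rule lebesgue_set_almost_fsigma[OF A])
    obtain F :: "nat \<Rightarrow> 'a set" where F: "\<And>n. closed (F n)" "C = (\<Union>n. F n)"
      using CT(1) unfolding fsigma.simps by auto
    let ?B = "\<Union>n. \<Union>k. norm ` (F n \<inter> cball 0 (real k))"
    have "closed (norm ` (F n \<inter> cball 0 (real k)))" for n k
      by (intro compact_imp_closed compact_continuous_image continuous_intros closed_Int_compact F compact_cball)
    then have B: "?B \<in> sets borel" by (intro sets.countable_UN' borel_closed) auto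
    have BC: "?B = norm ` C"
    proof -
      have "F n = (\<Union>k. F n \<inter> cball 0 (real k))" for n by (auto intro: real_arch_simple)
      then show ?thesis using F(2) by (metis (no_types, lifting) SUP_cong image_UN)
    qed
    show ?thesis
    proof (intro bexI conjI)
      show "?B \<subseteq> A" unfolding BC using CT(3) by auto
      have "{x::'a. norm x \<in> A - ?B} \<subseteq> T" unfolding BC using CT(3) by auto
      then show "negligible {x::'a. norm x \<in> A - ?B}" 
        using CT(2) negligible_subset negligible_iff_null_sets by blast
    qed (rule B)
  qed
  \<comment> \<open>Inner approximation of both \<open>A\<close> and its complement sandwiches
    \<open>A\<close> between the Borel sets \<open>B\<close> and \<open>- B'\<close>, whose
    difference is null.\<close>
  have meas: "A \<in> sets (completion M)" if A: "{x::'a. norm x \<in> A} \<in> sets lebesgue" for A :: "real set"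
  proof -
    obtain B where B: "B \<in> sets borel" "B \<subseteq> A" "negligible {x::'a. norm x \<in> A - B}"
      using inner[OF A] by blast
    have "{x::'a. norm x \<in> - A} = UNIV - {x. norm x \<in> A}" by auto
    then have "{x::'a. norm x \<in> - A} \<in> sets lebesgue" using sets.compl_sets[OF A] by simp
    then obtain B' where B': "B' \<in> sets borel" "B' \<subseteq> - A" "negligible {x::'a. norm x \<in> - A - B'}"
      using inner by blast
    have "negligible ({x::'a. norm x \<in> A - B} \<union> {x::'a. norm x \<in> - A - B'})"
      using B(3) B'(3) by (rule negligible_Un)
    moreover have "{x::'a. norm x \<in> - B' - B} \<subseteq> {x::'a. norm x \<in> A - B} \<union> {x::'a. norm x \<in> - A - B'}"
      by auto
    ultimately have "negligible {x::'a. norm x \<in> - B' - B}" by (rule negligible_subset)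
    moreover have "- B' - B \<in> sets borel" using B(1) B'(1) by auto
    ultimately have "- B' - B \<in> null_sets M" using nM by blast
    moreover have "A = B \<union> (A - B)" "A - B \<subseteq> - B' - B" using B(2) B'(2) by auto
    ultimately show ?thesis
      using B(1) sM by (auto intro!: sets_completionI[of A B "A - B" "- B' - B" M])
  qed
  have "v \<in> borel_measurable (completion M)"
  proof (rule borel_measurableI_greater)
    fix y
    have "{x::'a. norm x \<in> {r. y < v r}} = {x \<in> space lebesgue. y < v (norm x)}" by simp
    also have "\<dots> \<in> sets lebesgue" using vm by measurable
    finally show "{r \<in> space (completion M). y < v r} \<in> sets (completion M)" using meas by (simp add: sM)
  qed
  then obtain w where w: "w \<in> borel_measurable M" "AE r in M. v r = w r"
    using completion_ex_borel_measurable_real by blast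
  have wb: "w \<in> borel_measurable borel" using w(1) by (simp add: measurable_cong_sets[OF sM(1)])
  obtain N where N: "N \<in> null_sets M" "{r. v r \<noteq> w r} \<subseteq> N" using w(2) by (auto simp: eventually_ae_filter sM)
  have "AE x::'a in lborel. norm x \<notin> N"
  proof -
    have "AE r in M. r \<notin> N" using N(1) by (rule AE_not_in)
    then show ?thesis unfolding M_def using N(1) by (subst (asm) AE_distr_iff) (auto simp: sM)
  qed
  then have "AE x::'a in lebesgue. norm x \<notin> N" by (rule AE_completion)
  with v have "AE x in lebesgue. u x = w (norm x)" by eventually_elim (use N(2) in auto)
  then show ?thesis using that wb by blast
qed

section \<open>Profiles of radial functions\<close>

lemma Cauchy_Schwarz_integral:
  fixes f g :: "'a \<Rightarrow> real"
  assumes [measurable]: "f \<in> borel_measurable M" "g \<in> borel_measurable M"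
    and i: "integrable M (\<lambda>x. (f x)\<^sup>2)" "integrable M (\<lambda>x. (g x)\<^sup>2)"
  shows "integrable M (\<lambda>x. f x * g x)"
    and "(\<integral>x. \<bar>f x * g x\<bar> \<partial>M) \<le> sqrt (\<integral>x. (f x)\<^sup>2 \<partial>M) * sqrt (\<integral>x. (g x)\<^sup>2 \<partial>M)"
proof -
  show 1: "integrable M (\<lambda>x. f x * g x)"
  proof (rule Bochner_Integration.integrable_bound[of _ "\<lambda>x. (f x)\<^sup>2 + (g x)\<^sup>2"])
    have "\<bar>a * b\<bar> \<le> \<bar>a\<^sup>2 + b\<^sup>2\<bar>" for a b :: real
    proof -
      have "\<bar>a * b\<bar> \<le> a\<^sup>2 + b\<^sup>2"
        using sum_squares_bound[of "\<bar>a\<bar>" "\<bar>b\<bar>"] mult_nonneg_nonneg[OF abs_ge_zero[of a] abs_ge_zero[of b]]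
        unfolding abs_mult power2_abs by linarith
      then show ?thesis by simp
    qed
    then show "AE x in M. norm (f x * g x) \<le> norm ((f x)\<^sup>2 + (g x)\<^sup>2)" by simp
  qed (use i in auto)
  have eq: "(\<integral>\<^sup>+x. ennreal \<bar>h x\<bar> ^ 2 \<partial>M) = ennreal (\<integral>x. (h x)\<^sup>2 \<partial>M)"
    if "integrable M (\<lambda>x. (h x)\<^sup>2)" for h :: "'a \<Rightarrow> real"
    using that by (simp add: ennreal_power nn_integral_eq_integral)
  have "(\<integral>\<^sup>+x. ennreal \<bar>f x\<bar> * ennreal \<bar>g x\<bar> \<partial>M) = ennreal (\<integral>x. \<bar>f x * g x\<bar> \<partial>M)"
    using integrable_abs[OF 1]
    by (subst nn_integral_eq_integral[symmetric]) (auto simp: ennreal_mult[symmetric] abs_mult)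
  then have "ennreal ((\<integral>x. \<bar>f x * g x\<bar> \<partial>M)\<^sup>2) \<le> ennreal (\<integral>x. (f x)\<^sup>2 \<partial>M) * ennreal (\<integral>x. (g x)\<^sup>2 \<partial>M)"
    using Cauchy_Schwarz_nn_integral[of "\<lambda>x. ennreal \<bar>f x\<bar>" M "\<lambda>x. ennreal \<bar>g x\<bar>"]
    by (simp only: eq[OF i(1)] eq[OF i(2)]) (simp add: ennreal_power)
  then have "(\<integral>x. \<bar>f x * g x\<bar> \<partial>M)\<^sup>2 \<le> (\<integral>x. (f x)\<^sup>2 \<partial>M) * (\<integral>x. (g x)\<^sup>2 \<partial>M)"
    by (simp add: ennreal_mult[symmetric])
  then show "(\<integral>x. \<bar>f x * g x\<bar> \<partial>M) \<le> sqrt (\<integral>x. (f x)\<^sup>2 \<partial>M) * sqrt (\<integral>x. (g x)\<^sup>2 \<partial>M)"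
    by (simp add: real_sqrt_mult[symmetric] real_le_rsqrt)
qed

text \<open>The profile of a radial function is recovered from its gradient by integrating the flux:
  the field \<open>x / |x| ^ n\<close> is divergence free away from the origin.\<close>

definition flux :: "(real^'n \<Rightarrow> real^'n) \<Rightarrow> real^'n \<Rightarrow> real" where
  "flux g x = (g x \<bullet> x) / norm x ^ CARD('n)"

text \<open>If u = v(|x|), then the flux is v'(|x|) |x|^(1-n), and its integral over |x| > r is the
  surface area times the integral of v' from r to infinity. The definition thus selects the profile
  that vanishes at infinity.\<close>

definition profile :: "(real^'n \<Rightarrow> real^'n) \<Rightarrow> real \<Rightarrow> real" where
  "profile g r = - (\<integral>x. indicator {r<..} (norm x) * flux g x \<partial>lebesgue) / sphere_vol TYPE(real^'n)"

text \<open>Cauchy-Schwarz leaves the square root of the integral of |x|^(2-2n) over |x| > r, which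
  is the square root of \<open>sphere_vol\<close> / (n-2) times r^((2-n)/2); the division by
  \<open>sphere_vol\<close> is the one in \<open>profile\<close>.\<close>

definition profile_const :: "'n::finite itself \<Rightarrow> real" where
  "profile_const _ = sqrt (sphere_vol TYPE(real^'n) / (real CARD('n) - 2)) / sphere_vol TYPE(real^'n)"

lemma flux_measurable:
  assumes "g \<in> borel_measurable lebesgue"
  shows "flux g \<in> borel_measurable lebesgue"
proof -
  have m: "(\<lambda>x::real^'n. x) \<in> borel_measurable lebesgue" "(\<lambda>x::real^'n. norm x) \<in> borel_measurable lebesgue"
    by (auto intro!: measurable_completion)
  show ?thesis unfolding flux_def[abs_def]
    using assms m by (intro borel_measurable_divide borel_measurable_inner borel_measurable_power) auto
qed

lemma indicator_norm_measurable:
  "A \<in> sets borel \<Longrightarrow> (\<lambda>x::'a::euclidean_space. indicator A (norm x) :: real) \<in> borel_measurable lebesgue"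
  by (intro measurable_completion) auto

text \<open>The exponent 2 - 2n comes from squaring the bound |x|^(1-n) of the flux kernel.
  Half-open shells are exact differences of exteriors of balls, so their integrals are obtained by
  subtraction.\<close>

lemma shell_integral:
  assumes n3: "CARD('n::finite) \<ge> 3" and r: "0 < r" "r \<le> s"
  shows "integrable lebesgue (\<lambda>x::real^'n. indicator {r<..s} (norm x) * norm x powr (2 - 2 * real CARD('n)))"
    and "(\<integral>x. indicator {r<..s} (norm x) * norm (x::real^'n) powr (2 - 2 * real CARD('n)) \<partial>lebesgue)
      \<le> sphere_vol TYPE(real^'n) / (real CARD('n) - 2) * (r powr (2 - real CARD('n)) - s powr (2 - real CARD('n)))"
    and "integrable lebesgue (\<lambda>x::real^'n. indicator {r<..} (norm x) * norm x powr (2 - 2 * real CARD('n)))"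
    and "(\<integral>x. indicator {r<..} (norm x) * norm (x::real^'n) powr (2 - 2 * real CARD('n)) \<partial>lebesgue)
      \<le> sphere_vol TYPE(real^'n) / (real CARD('n) - 2) * r powr (2 - real CARD('n))"
proof -
  let ?e = "2 - 2 * real CARD('n)"
  have e: "?e < - real DIM(real^'n)" using n3 by simp
  have z: "AE x::real^'n in lborel. norm x \<noteq> c" for c
    using AE_norm_neq[where 'a="real^'n", of c] by (simp add: AE_completion_iff)
  have I: "integrable lborel (\<lambda>x::real^'n. indicator {r<..} (norm x) * norm x powr ?e)"
      "(\<integral>x. indicator {r<..} (norm x) * norm (x::real^'n) powr ?e \<partial>lborel) =
        sphere_vol TYPE(real^'n) / (real CARD('n) - 2) * r powr (2 - real CARD('n))" if "r > 0" for r
  proof -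
    have ae: "AE x::real^'n in lborel. indicator {r<..} (norm x) * norm x powr ?e = indicator {r..} (norm x) * norm x powr ?e"
      using z[of r] by eventually_elim (auto simp: indicator_def)
    have "integrable lborel (\<lambda>x::real^'n. indicator {r<..} (norm x) * norm x powr ?e) \<longleftrightarrow>
      integrable lborel (\<lambda>x::real^'n. indicator {r..} (norm x) * norm x powr ?e)"
      by (rule integrable_cong_AE[OF _ _ ae]) auto
    then show "integrable lborel (\<lambda>x::real^'n. indicator {r<..} (norm x) * norm x powr ?e)"
      using integrable_norm_powr_outside(1)[OF e that] by simp
    have "(\<integral>x. indicator {r<..} (norm x) * norm (x::real^'n) powr ?e \<partial>lborel) = (\<integral>x. indicator {r..} (norm x) * norm (x::real^'n) powr ?e \<partial>lborel)"
      by (rule integral_cong_AE[OF _ _ ae]) auto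
    also have "\<dots> = sphere_vol TYPE(real^'n) / (real CARD('n) - 2) * r powr (2 - real CARD('n))"
      using integrable_norm_powr_outside(2)[OF e that] by simp
    finally show "(\<integral>x. indicator {r<..} (norm x) * norm (x::real^'n) powr ?e \<partial>lborel) =
        sphere_vol TYPE(real^'n) / (real CARD('n) - 2) * r powr (2 - real CARD('n))" .
  qed
  have d: "indicator {r<..s} t = indicator {r<..} t - (indicator {s<..} t :: real)" for t
    using r by (auto simp: indicator_def)
  have I2: "integrable lborel (\<lambda>x::real^'n. indicator {r<..s} (norm x) * norm x powr ?e)"
    unfolding d left_diff_distrib using I(1)[of r] I(1)[of s] r by auto
  have I3: "(\<integral>x. indicator {r<..s} (norm x) * norm (x::real^'n) powr ?e \<partial>lborel)
      = sphere_vol TYPE(real^'n) / (real CARD('n) - 2) * (r powr (2 - real CARD('n)) - s powr (2 - real CARD('n)))"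
    unfolding d left_diff_distrib using I[of r] I[of s] r by (simp add: right_diff_distrib)
  show "integrable lebesgue (\<lambda>x::real^'n. indicator {r<..s} (norm x) * norm x powr ?e)"
    using I2 by (subst integrable_completion) auto
  show "(\<integral>x. indicator {r<..s} (norm x) * norm (x::real^'n) powr ?e \<partial>lebesgue)
      \<le> sphere_vol TYPE(real^'n) / (real CARD('n) - 2) * (r powr (2 - real CARD('n)) - s powr (2 - real CARD('n)))"
    using I3 by (subst integral_completion) auto
  show "integrable lebesgue (\<lambda>x::real^'n. indicator {r<..} (norm x) * norm x powr ?e)"
    using I(1)[OF r(1)] by (subst integrable_completion) auto
  show "(\<integral>x. indicator {r<..} (norm x) * norm (x::real^'n) powr ?e \<partial>lebesgue)
      \<le> sphere_vol TYPE(real^'n) / (real CARD('n) - 2) * r powr (2 - real CARD('n))"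
    using I(2)[OF r(1)] by (subst integral_completion) auto
qed

context
  fixes g :: "real^'n \<Rightarrow> real^'n"
  assumes n3: "CARD('n) \<ge> 3" and gm: "g \<in> borel_measurable lebesgue"
    and g2: "integrable lebesgue (\<lambda>x. (norm (g x))\<^sup>2)"
begin

lemma flux_bound: "\<bar>flux g x\<bar> \<le> norm (g x) * norm x powr (1 - real CARD('n))"
proof (cases "x = 0")
  case False
  have "\<bar>g x \<bullet> x\<bar> \<le> norm (g x) * norm x" by (rule Cauchy_Schwarz_ineq2)
  then have "\<bar>flux g x\<bar> \<le> norm (g x) * norm x / norm x ^ CARD('n)"
    by (simp add: flux_def abs_divide divide_right_mono)
  also have "norm x / norm x ^ CARD('n) = norm x powr (1 - real CARD('n))"
    using False by (simp add: powr_diff powr_realpow)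
  then have "norm (g x) * norm x / norm x ^ CARD('n) = norm (g x) * norm x powr (1 - real CARD('n))"
    by (metis times_divide_eq_right)
  finally show ?thesis .
qed (simp add: flux_def)

lemma flux_integral_bound:
  assumes A: "A \<in> sets borel"
    and i: "integrable lebesgue (\<lambda>x::real^'n. indicator A (norm x) * norm x powr (2 - 2 * real CARD('n)))"
  shows "integrable lebesgue (\<lambda>x. indicator A (norm x) * flux g x)"
    and "\<bar>\<integral>x. indicator A (norm x) * flux g x \<partial>lebesgue\<bar> \<le> sqrt (\<integral>x. (norm (g x))\<^sup>2 \<partial>lebesgue) *
      sqrt (\<integral>x. indicator A (norm x) * norm (x::real^'n) powr (2 - 2 * real CARD('n)) \<partial>lebesgue)"
proof -
  let ?b = "\<lambda>x::real^'n. indicator A (norm x) * norm x powr (1 - real CARD('n))"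
  have b2: "(?b x)\<^sup>2 = indicator A (norm x) * norm x powr (2 - 2 * real CARD('n))" for x
    by (auto simp: indicator_def power2_eq_square powr_add[symmetric])
  have bm: "?b \<in> borel_measurable lebesgue"
    using A by (intro measurable_completion) auto
  have gn: "(\<lambda>x. norm (g x)) \<in> borel_measurable lebesgue" using gm by auto
  note cs = Cauchy_Schwarz_integral[OF gn bm g2, unfolded b2, OF i]
  have bd: "norm (indicator A (norm x) * flux g x) \<le> norm (norm (g x) * ?b x)" for x
    using flux_bound[of x] by (auto simp: indicator_def abs_mult)
  show 1: "integrable lebesgue (\<lambda>x. indicator A (norm x) * flux g x)"
  proof (rule Bochner_Integration.integrable_bound[OF cs(1)])
    show "(\<lambda>x. indicator A (norm x) * flux g x) \<in> borel_measurable lebesgue"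
      by (intro borel_measurable_times flux_measurable[OF gm] indicator_norm_measurable[OF A])
  qed (use bd in auto)
  have "\<bar>\<integral>x. indicator A (norm x) * flux g x \<partial>lebesgue\<bar> \<le> (\<integral>x. \<bar>norm (g x) * ?b x\<bar> \<partial>lebesgue)"
    using 1 cs(1) bd by (intro integral_abs_bound[THEN order_trans] integral_mono) auto
  then show "\<bar>\<integral>x. indicator A (norm x) * flux g x \<partial>lebesgue\<bar> \<le> sqrt (\<integral>x. (norm (g x))\<^sup>2 \<partial>lebesgue) *
      sqrt (\<integral>x. indicator A (norm x) * norm (x::real^'n) powr (2 - 2 * real CARD('n)) \<partial>lebesgue)"
    using cs(2) by linarith
qed

text \<open>Cauchy-Schwarz for the flux integral over |x| > r. This is the classical decay estimate
  for radial functions of finite Dirichlet integral: |v(r)| is at most a constant times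
  r^(-(n-2)/2).\<close>

lemma profile_bound:
  assumes r: "r > 0"
  shows "\<bar>profile g r\<bar> \<le> profile_const TYPE('n) * sqrt (\<integral>x. (norm (g x))\<^sup>2 \<partial>lebesgue) * sqrt (r powr (2 - real CARD('n)))"
proof -
  have "\<bar>\<integral>x. indicator {r<..} (norm x) * flux g x \<partial>lebesgue\<bar> \<le> sqrt (\<integral>x. (norm (g x))\<^sup>2 \<partial>lebesgue) *
      (sqrt (sphere_vol TYPE(real^'n) / (real CARD('n) - 2)) * sqrt (r powr (2 - real CARD('n))))"
    unfolding real_sqrt_mult[of "sphere_vol _ / _", symmetric]
    by (rule order_trans[OF flux_integral_bound(2)[of "{r<..}", OF _ shell_integral(3)[OF n3 r order_refl]]
          mult_left_mono[OF real_sqrt_le_mono[OF shell_integral(4)[OF n3 r order_refl]]]]) auto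
  from divide_right_mono[OF this, of "sphere_vol TYPE(real^'n)"] show ?thesis
    using sphere_vol_pos[where 'a="real^'n"]
    by (simp add: profile_def profile_const_def abs_divide mult_ac)
qed

text \<open>The same estimate on a shell. The profile is Hoelder continuous of order 1/2 in the
  variable r^(2-n), with a constant that depends on the gradient norm alone; this is the source of
  equicontinuity.\<close>

lemma profile_diff_bound:
  assumes r: "0 < r" "r \<le> s"
  shows "\<bar>profile g r - profile g s\<bar> \<le> profile_const TYPE('n) * sqrt (\<integral>x. (norm (g x))\<^sup>2 \<partial>lebesgue) *
    sqrt (r powr (2 - real CARD('n)) - s powr (2 - real CARD('n)))"
proof -
  have s: "0 < s" using r by simp
  have d: "indicator {r<..s} t = indicator {r<..} t - (indicator {s<..} t :: real)" for t
    using r by (auto simp: indicator_def)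
  have eq: "(\<integral>x. indicator {r<..} (norm x) * flux g x \<partial>lebesgue) - (\<integral>x. indicator {s<..} (norm x) * flux g x \<partial>lebesgue)
     = (\<integral>x. indicator {r<..s} (norm x) * flux g x \<partial>lebesgue)"
    using flux_integral_bound(1)[of "{r<..}", OF _ shell_integral(3)[OF n3 r(1) order_refl]]
      flux_integral_bound(1)[of "{s<..}", OF _ shell_integral(3)[OF n3 s order_refl]] r
    unfolding d left_diff_distrib by (intro Bochner_Integration.integral_diff[symmetric]) auto
  have "\<bar>\<integral>x. indicator {r<..s} (norm x) * flux g x \<partial>lebesgue\<bar> \<le> sqrt (\<integral>x. (norm (g x))\<^sup>2 \<partial>lebesgue) *
      (sqrt (sphere_vol TYPE(real^'n) / (real CARD('n) - 2)) * sqrt ((r powr (2 - real CARD('n)) - s powr (2 - real CARD('n)))))"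
    unfolding real_sqrt_mult[of "sphere_vol _ / _", symmetric]
    by (rule order_trans[OF flux_integral_bound(2)[of "{r<..s}", OF _ shell_integral(1)[OF n3 r]]
          mult_left_mono[OF real_sqrt_le_mono[OF shell_integral(2)[OF n3 r]]]]) auto
  moreover have "\<bar>profile g r - profile g s\<bar> = \<bar>\<integral>x. indicator {r<..s} (norm x) * flux g x \<partial>lebesgue\<bar> / sphere_vol TYPE(real^'n)"
    unfolding eq[symmetric] profile_def using sphere_vol_pos[where 'a="real^'n"]
    by (simp add: diff_divide_distrib[symmetric] abs_divide abs_minus_commute)
  ultimately have "\<bar>profile g r - profile g s\<bar> \<le> sqrt (\<integral>x. (norm (g x))\<^sup>2 \<partial>lebesgue) *
      (sqrt (sphere_vol TYPE(real^'n) / (real CARD('n) - 2)) * sqrt ((r powr (2 - real CARD('n)) - s powr (2 - real CARD('n)))))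
      / sphere_vol TYPE(real^'n)"
    using sphere_vol_pos[where 'a="real^'n"] by (simp add: divide_right_mono)
  then show ?thesis by (simp add: profile_const_def mult_ac)
qed

lemma profile_diff_bound_abs:
  assumes "r > 0" "s > 0"
  shows "\<bar>profile g s - profile g r\<bar> \<le> profile_const TYPE('n) * sqrt (\<integral>x. (norm (g x))\<^sup>2 \<partial>lebesgue) *
    sqrt \<bar>s powr (2 - real CARD('n)) - r powr (2 - real CARD('n))\<bar>"
proof (cases "r \<le> s")
  case True
  have "\<bar>s powr (2 - real CARD('n)) - r powr (2 - real CARD('n))\<bar> = r powr (2 - real CARD('n)) - s powr (2 - real CARD('n))"
    using True assms n3 powr_mono2'[of "2 - real CARD('n)" r s] by simp
  then show ?thesis using profile_diff_bound[OF assms(1) True] by (simp add: abs_minus_commute)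
next
  case False
  have "\<bar>s powr (2 - real CARD('n)) - r powr (2 - real CARD('n))\<bar> = s powr (2 - real CARD('n)) - r powr (2 - real CARD('n))"
    using False assms n3 powr_mono2'[of "2 - real CARD('n)" s r] by simp
  then show ?thesis using profile_diff_bound[OF assms(2), of r] False by simp
qed

lemma continuous_on_profile: "continuous_on {0<..} (profile g)"
proof -
  let ?C = "profile_const TYPE('n) * sqrt (\<integral>x. (norm (g x))\<^sup>2 \<partial>lebesgue)"
  let ?\<tau> = "\<lambda>r. r powr (2 - real CARD('n))"
  note bd = profile_diff_bound_abs
  show ?thesis
    unfolding continuous_on
  proof
    fix r :: real assume r: "r \<in> {0<..}"
    have "((\<lambda>s. profile g s - profile g r) \<longlongrightarrow> 0) (at r within {0<..})"
    proof (rule Lim_null_comparison)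
      show "\<forall>\<^sub>F s in at r within {0<..}. norm (profile g s - profile g r) \<le> ?C * sqrt \<bar>?\<tau> s - ?\<tau> r\<bar>"
        using bd r by (auto simp: eventually_at_filter)
      have "((\<lambda>s. ?C * sqrt \<bar>?\<tau> s - ?\<tau> r\<bar>) \<longlongrightarrow> ?C * sqrt \<bar>?\<tau> r - ?\<tau> r\<bar>) (at r within {0<..})"
        using r by (intro tendsto_intros) auto
      then show "((\<lambda>s. ?C * sqrt \<bar>?\<tau> s - ?\<tau> r\<bar>) \<longlongrightarrow> 0) (at r within {0<..})" by simp
    qed
    then show "(profile g \<longlongrightarrow> profile g r) (at r within {0<..})" by (simp add: LIM_zero_iff)
  qed
qed

end

section \<open>A radial function is the profile of its gradient\<close>

lemma AE_radial:
  assumes "AE s in lborel. s > 0 \<longrightarrow> P s"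
  shows "AE x::'a::euclidean_space in lebesgue. x \<noteq> 0 \<longrightarrow> P (norm x)"
proof -
  obtain N where N: "N \<in> null_sets lborel" "{s. \<not> (s > 0 \<longrightarrow> P s)} \<subseteq> N"
    using assms by (auto simp: eventually_ae_filter)
  have "AE s in distr lborel borel (norm :: 'a \<Rightarrow> real). s \<notin> N"
    unfolding distr_norm_lborel using AE_not_in[OF N(1)] by (subst AE_density) auto
  then have "AE x::'a in lborel. norm x \<notin> N"
    using N(1) by (subst (asm) AE_distr_iff) auto
  then have "AE x::'a in lebesgue. norm x \<notin> N" by (rule AE_completion)
  then show ?thesis
  proof eventually_elim
    case (elim x)
    then show ?case using N(2) by (cases "x = 0") (auto dest!: subsetD[of _ _ "norm x"])
  qed
qed

text \<open>The du Bois-Reymond lemma on the half-line: subtracting from a test function its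
  integral times a fixed bump of integral 1 leaves one of mean zero, so \<open>E\<close> integrates
  like the constant c, its integral against the bump.\<close>

lemma constant_if_orthogonal:
  fixes E :: "real \<Rightarrow> real"
  assumes int: "\<And>\<eta> \<alpha> \<beta>. 0 < \<alpha> \<Longrightarrow> \<alpha> < \<beta> \<Longrightarrow> continuous_on UNIV \<eta> \<Longrightarrow> (\<And>s. s \<notin> {\<alpha>..\<beta>} \<Longrightarrow> \<eta> s = 0) \<Longrightarrow>
      integrable lborel (\<lambda>s. E s * \<eta> s)"
    and zero: "\<And>\<eta> \<alpha> \<beta>. 0 < \<alpha> \<Longrightarrow> \<alpha> < \<beta> \<Longrightarrow> continuous_on UNIV \<eta> \<Longrightarrow> (\<And>s. s \<notin> {\<alpha>..\<beta>} \<Longrightarrow> \<eta> s = 0) \<Longrightarrow>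
      (\<integral>s. \<eta> s \<partial>lborel) = 0 \<Longrightarrow> (\<integral>s. E s * \<eta> s \<partial>lborel) = 0"
  shows "\<exists>c. AE s in lborel. s > 0 \<longrightarrow> E s = c"
proof -
  \<comment> \<open>The hat moved to [1,2]. Its integral is \<open>sstep 1 - sstep 0\<close>, and
    its support is contained in every interval used for localization below.\<close>
  define \<eta>0 where "\<eta>0 t = sstep' (t - 1)" for t
  have c0: "continuous_on UNIV \<eta>0" unfolding \<eta>0_def by (intro continuous_intros)
  have s0: "\<eta>0 t = 0" if "t \<notin> {1..2}" for t
    using that by (auto simp: \<eta>0_def not_le sstep_eq_0 sstep_eq_1)
  have i0: "(\<integral>t. \<eta>0 t \<partial>lborel) = 1"
  proof -
    have "(\<integral>t. \<eta>0 t * indicator {1..2} t \<partial>lborel) = sstep (2 - 1) - sstep (1 - 1)"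
    proof (rule integral_FTC_Icc_nonneg)
      show "\<eta>0 \<in> borel_measurable borel" using c0 by (rule borel_measurable_continuous_onI)
      show "((\<lambda>t. sstep (t - 1)) has_real_derivative \<eta>0 t) (at t)" for t
        unfolding \<eta>0_def
        by (rule DERIV_cong[OF DERIV_chain2[OF sstep_has_real_derivative, where Db=1]])
          (auto intro!: derivative_eq_intros)
    qed (auto simp: \<eta>0_def sstep'_bounds)
    moreover have "(\<lambda>t. \<eta>0 t * indicator {1..2} t) = \<eta>0" using s0 by (auto simp: fun_eq_iff indicator_def)
    ultimately show ?thesis by (simp add: sstep_eq_0 sstep_eq_1)
  qed
  define c where "c = (\<integral>s. E s * \<eta>0 s \<partial>lborel)"
  have loc: "AE s in lborel. s \<in> {\<alpha><..<\<beta>} \<longrightarrow> E s = c" if ab: "0 < \<alpha>" "\<alpha> \<le> 1" "2 \<le> \<beta>" for \<alpha> \<beta>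
  proof -
    have ab': "\<alpha> < \<beta>" using ab by simp
    \<comment> \<open>A continuous localizing factor that is positive throughout the open interval,
      so it can be divided out at the end.\<close>
    define \<xi> where "\<xi> t = max 0 ((t - \<alpha>) * (\<beta> - t))" for t
    have c\<xi>: "continuous_on UNIV \<xi>" unfolding \<xi>_def by (intro continuous_intros)
    have s\<xi>: "\<xi> t = 0" if "t \<notin> {\<alpha>..\<beta>}" for t
      using that ab by (auto simp: \<xi>_def not_le max_def mult_less_0_iff zero_le_mult_iff)
    have s0': "\<eta>0 t = 0" if "t \<notin> {\<alpha>..\<beta>}" for t using s0[of t] that ab by auto
    have fin: "integrable lborel h" if "continuous_on UNIV h" "\<And>t. t \<notin> {\<alpha>..\<beta>} \<Longrightarrow> h t = 0" for h :: "real \<Rightarrow> real"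
    proof (rule integrable_continuous_bounded_support(1)[OF that(1), of \<beta>])
      fix x :: real assume "norm x > \<beta>"
      then show "h x = 0" using ab by (intro that(2)) auto
    qed
    define Z where "Z t = (E t - c) * \<xi> t" for t
    have E\<xi>: "integrable lborel (\<lambda>s. E s * \<xi> s)" by (rule int[OF ab(1) ab' c\<xi> s\<xi>])
    have Zi: "integrable lborel Z"
      unfolding Z_def left_diff_distrib using E\<xi> fin[OF c\<xi> s\<xi>] by auto
    have "AE t in lborel. Z t = 0"
    proof (rule AE_zero_if_orthants[OF Zi])
      fix a :: real
      define h where "h k t = sstep (real k * (t - a))" for k t
      have ch: "continuous_on UNIV (h k)" for k unfolding h_def by (intro continuous_intros)
      have z: "(\<integral>t. h k t * Z t \<partial>lborel) = 0" for k
      proof -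
        let ?p = "\<lambda>t. h k t * \<xi> t"
        let ?I = "\<integral>t. ?p t \<partial>lborel"
        have cp: "continuous_on UNIV ?p" by (intro continuous_intros ch c\<xi>)
        have ip: "integrable lborel ?p" by (rule fin[OF cp]) (use s\<xi> in auto)
        have i00: "integrable lborel \<eta>0" by (rule fin[OF c0]) (use s0' in auto)
        have Ep: "integrable lborel (\<lambda>t. E t * ?p t)" by (rule int[OF ab(1) ab' cp]) (use s\<xi> in auto)
        have E0: "integrable lborel (\<lambda>t. E t * \<eta>0 t)" by (rule int[OF ab(1) ab' c0]) (use s0' in auto)
        have "(\<integral>t. E t * (?p t - ?I * \<eta>0 t) \<partial>lborel) = 0"
        proof (rule zero[OF ab(1) ab'])
          show "continuous_on UNIV (\<lambda>t. ?p t - ?I * \<eta>0 t)" by (intro continuous_intros cp c0)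
          show "(\<integral>t. ?p t - ?I * \<eta>0 t \<partial>lborel) = 0" using ip i00 i0 by simp
        qed (use s\<xi> s0' in auto)
        moreover have "(\<integral>t. E t * (?p t - ?I * \<eta>0 t) \<partial>lborel) = (\<integral>t. E t * ?p t - ?I * (E t * \<eta>0 t) \<partial>lborel)"
          by (intro Bochner_Integration.integral_cong) (auto simp: algebra_simps)
        ultimately have "(\<integral>t. E t * ?p t \<partial>lborel) = ?I * c"
          using Ep E0 by (simp add: c_def)
        moreover have "(\<integral>t. h k t * Z t \<partial>lborel) = (\<integral>t. E t * ?p t - c * ?p t \<partial>lborel)"
          by (intro Bochner_Integration.integral_cong) (auto simp: algebra_simps Z_def)
        ultimately show ?thesis using Ep ip by simp
      qed
      have "(\<lambda>k. (\<integral>t. h k t * Z t \<partial>lborel)) \<longlonglongrightarrow> (\<integral>t. indicator {a<..} t * Z t \<partial>lborel)"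
      proof (rule integral_dominated_convergence)
        show "(\<lambda>t. indicator {a<..} t * Z t) \<in> borel_measurable lborel" using Zi by auto
        show "(\<lambda>t. h k t * Z t) \<in> borel_measurable lborel" for k
          using Zi borel_measurable_continuous_onI[OF ch[of k]] by auto
        show "integrable lborel (\<lambda>x. norm (Z x))" using Zi by auto
        have "(\<lambda>k. h k t) \<longlonglongrightarrow> indicator {a<..} t" for t
          using sstep_scaled_tendsto[of "t - a"] by (simp add: h_def indicator_def)
        then show "AE t in lborel. (\<lambda>k. h k t * Z t) \<longlonglongrightarrow> indicator {a<..} t * Z t"
          by (auto intro!: tendsto_mult)
        show "AE t in lborel. norm (h k t * Z t) \<le> norm (Z t)" for k
          using sstep_bounds by (auto simp: abs_mult h_def intro!: mult_left_le_one_le)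
      qed
      then have "(\<integral>t. indicator {a<..} t * Z t \<partial>lborel) = 0" by (simp only: z LIMSEQ_const_iff)
      moreover have "{x. eucl_less a x} = {a<..}" by (auto simp: eucl_less_def)
      ultimately show "(\<integral>t\<in>{x. eucl_less a x}. Z t \<partial>lborel) = 0" by (simp add: set_lebesgue_integral_def)
    qed
    then show ?thesis
    proof eventually_elim
      case (elim t)
      have "\<xi> t > 0" if "t \<in> {\<alpha><..<\<beta>}" using that by (auto simp: \<xi>_def less_max_iff_disj)
      then show ?case using elim by (auto simp: Z_def)
    qed
  qed
  have "AE s in lborel. \<forall>k::nat. s \<in> {1 / (real k + 1)<..<real k + 2} \<longrightarrow> E s = c"
    unfolding AE_all_countable by (intro allI loc) auto
  then have "AE s in lborel. s > 0 \<longrightarrow> E s = c"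
  proof eventually_elim
    case (elim s)
    show ?case
    proof
      assume s: "s > 0"
      obtain k :: nat where k: "max s (1 / s) < real k" using reals_Archimedean2 by blast
      then have "1 / s < real k + 1" "s < real k + 2" by auto
      then have "1 / (real k + 1) < s" "s < real k + 2" using s by (auto simp: field_simps)
      then show "E s = c" using elim by auto
    qed
  qed
  then show ?thesis by blast
qed

text \<open>Let \<psi> be the primitive of \<eta> from 0. Testing component i with \<psi>(|x|) x_i /
  |x|^n and summing over i produces the divergence of \<psi>(|x|) x / |x|^n, which is \<eta>(|x|) /
  |x|^(n-1) because x / |x|^n is divergence free. The vanishing mean of \<eta> makes \<psi> vanish
  beyond \<beta>, so the test functions have bounded support.\<close>

lemma weak_grad_flux_identity:
  fixes u :: "real^'n \<Rightarrow> real"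
  assumes wg: "weak_grad u g" and ab: "0 < \<alpha>" "\<alpha> < \<beta>" and c: "continuous_on UNIV \<eta>"
    and supp: "\<And>s. s \<notin> {\<alpha>..\<beta>} \<Longrightarrow> \<eta> s = 0" and zero: "integral {0..\<beta>} \<eta> = 0"
  shows "(\<integral>x. u x * (\<eta> (norm x) / norm x ^ (CARD('n) - 1)) \<partial>lebesgue)
      = - (\<integral>x. flux g x * integral {0..norm x} \<eta> \<partial>lebesgue)"
proof -
  define \<psi> where "\<psi> r = integral {0..r} \<eta>" for r
  have \<psi>0: "\<psi> r = 0" if "r < \<alpha>" for r
  proof -
    have "\<psi> r = integral {0..r} (\<lambda>_. 0)" unfolding \<psi>_def using that supp by (intro integral_cong) auto
    then show ?thesis by simp
  qed
  have io: "\<eta> integrable_on {a..b}" for a b by (rule integrable_continuous_real[OF continuous_on_subset[OF c]]) auto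
  have \<psi>1: "\<psi> r = 0" if "r > \<beta>" for r
  proof -
    have "integral {0..\<beta>} \<eta> + integral {\<beta>..r} \<eta> = integral {0..r} \<eta>"
      using that ab by (intro Henstock_Kurzweil_Integration.integral_combine io) auto
    moreover have "integral {\<beta>..r} \<eta> = integral {\<beta>..r} (\<lambda>_. 0)"
    proof (rule integral_spike[of "{\<beta>}"])
    qed (use supp in auto)
    ultimately show ?thesis using zero by (simp add: \<psi>_def)
  qed
  have d\<psi>: "(\<psi> has_real_derivative \<eta> r) (at r)" if "r > 0" for r
  proof -
    have "(\<psi> has_real_derivative \<eta> r) (at r within {0..r+1})"
      unfolding \<psi>_def by (rule integral_has_real_derivative) (use that continuous_on_subset[OF c] in auto)
    moreover have "at r within {0..r+1} = at r" by (rule at_within_interior) (use that in auto)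
    ultimately show ?thesis by simp
  qed
  let ?n = "CARD('n)"
  define m where "m r = \<psi> r / r ^ ?n" for r
  define m' where "m' r = \<eta> r / r ^ ?n - real ?n * \<psi> r / r ^ (?n + 1)" for r
  have n0: "?n > 0" by simp
  have dm: "(m has_real_derivative m' r) (at r)" if "r > 0" for r
  proof -
    have pn: "r ^ ?n = r * r ^ (?n - 1)" using n0 by (metis power_eq_if not_gr_zero)
    have "(m has_real_derivative ((\<eta> r * r ^ ?n - \<psi> r * (real ?n * r ^ (?n - 1))) / (r ^ ?n * r ^ ?n))) (at r)"
      unfolding m_def[abs_def] using that
      by (intro DERIV_divide d\<psi>) (auto intro!: derivative_eq_intros)
    also have "(\<eta> r * r ^ ?n - \<psi> r * (real ?n * r ^ (?n - 1))) / (r ^ ?n * r ^ ?n) = m' r"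
      unfolding m'_def using that by (simp add: divide_simps) (simp add: pn algebra_simps)
    finally show ?thesis .
  qed
  have cont\<psi>: "continuous_on {0<..} \<psi>"
    using d\<psi> by (intro continuous_at_imp_continuous_on) (auto intro: DERIV_isCont)
  have C: "C1grad (\<lambda>x::real^'n. m (norm x)) (\<lambda>x. (m' (norm x) / norm x) *\<^sub>R x)"
  proof (rule C1grad_radial[OF ab(1), where c=0])
    show "continuous_on {0<..} m'" unfolding m'_def
      by (intro continuous_intros cont\<psi> continuous_on_subset[OF c]) auto
    show "m r = 0" if "r < \<alpha>" for r using \<psi>0[OF that] by (simp add: m_def)
    show "m' r = 0" if "r < \<alpha>" for r using \<psi>0[OF that] supp[of r] that by (simp add: m'_def)
  qed (rule dm)
  have m0: "m (norm x) = 0" if "norm x > \<beta>" for x :: "real^'n" using \<psi>1[OF that] by (simp add: m_def)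
  define G where "G i x = m (norm x) *\<^sub>R axis i 1 + x $ i *\<^sub>R ((m' (norm x) / norm x) *\<^sub>R x)" for i and x :: "real^'n"
  have C': "C1grad (\<lambda>x. x $ i * m (norm x)) (G i)" for i :: 'n
    unfolding G_def by (rule C1grad_mult[OF C1grad_component C])
  have s': "x $ i * m (norm x) = 0" if "norm x > \<beta>" for x :: "real^'n" and i using m0[OF that] by simp
  note W = weak_gradD[OF wg C' s', where i=i for i]
  \<comment> \<open>The divergence of m(|x|) x is n m(r) + r m'(r); for m = \<psi> / r^n the terms
    containing \<psi> cancel.\<close>
  have sumG: "(\<Sum>i\<in>UNIV. G i x $ i) = \<eta> (norm x) / norm x ^ (?n - 1)" for x
  proof (cases "x = 0")
    case True
    then show ?thesis using \<psi>0[OF ab(1)] supp[of 0] ab by (simp add: G_def m_def)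
  next
    case False
    let ?r = "norm x"
    have r: "?r > 0" using False by simp
    have pn: "?r ^ ?n = ?r * ?r ^ (?n - 1)" using n0 by (metis power_eq_if not_gr_zero)
    have "(\<Sum>i\<in>UNIV. G i x $ i) = (\<Sum>i\<in>UNIV. m ?r + (m' ?r / ?r) * (x $ i * x $ i))"
      by (simp add: G_def algebra_simps)
    also have "\<dots> = real ?n * m ?r + (m' ?r / ?r) * (x \<bullet> x)"
      by (simp add: sum.distrib sum_distrib_left inner_vec_def)
    also have "x \<bullet> x = ?r * ?r" by (metis power2_eq_square power2_norm_eq_inner)
    also have "real ?n * m ?r + (m' ?r / ?r) * (?r * ?r) = \<eta> ?r / ?r ^ (?n - 1)"
      unfolding m_def m'_def using r by (simp add: divide_simps) (simp add: pn algebra_simps)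
    finally show ?thesis .
  qed
  have "(\<integral>x. u x * (\<eta> (norm x) / norm x ^ (?n - 1)) \<partial>lebesgue) = (\<integral>x. (\<Sum>i\<in>UNIV. u x * G i x $ i) \<partial>lebesgue)"
    by (simp only: sumG[symmetric] sum_distrib_left)
  also have "\<dots> = (\<Sum>i\<in>UNIV. \<integral>x. u x * G i x $ i \<partial>lebesgue)"
    by (rule Bochner_Integration.integral_sum) (rule W(1))
  also have "\<dots> = - (\<Sum>i\<in>UNIV. \<integral>x. g x $ i * (x $ i * m (norm x)) \<partial>lebesgue)"
    by (simp only: W(3) sum_negf)
  also have "(\<Sum>i\<in>UNIV. \<integral>x. g x $ i * (x $ i * m (norm x)) \<partial>lebesgue) = (\<integral>x. (\<Sum>i\<in>UNIV. g x $ i * (x $ i * m (norm x))) \<partial>lebesgue)"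
    by (rule Bochner_Integration.integral_sum[symmetric]) (rule W(2))
  also have "\<dots> = (\<integral>x. flux g x * integral {0..norm x} \<eta> \<partial>lebesgue)"
    by (simp add: flux_def m_def \<psi>_def inner_vec_def sum_distrib_right sum_divide_distrib mult.assoc)
  finally show ?thesis .
qed

text \<open>Both sides are iterated integrals of flux times \<eta>(s) over the region s < |x|:
  integrating s first gives the primitive of \<eta>, integrating x first gives the profile.\<close>

lemma flux_Fubini:
  fixes g :: "real^'n \<Rightarrow> real^'n"
  assumes n3: "CARD('n) \<ge> 3" and gm: "g \<in> borel_measurable lebesgue"
    and g2: "integrable lebesgue (\<lambda>x. (norm (g x))\<^sup>2)"
    and ab: "0 < \<alpha>" "\<alpha> < \<beta>" and c: "continuous_on UNIV \<eta>"
    and supp: "\<And>s. s \<notin> {\<alpha>..\<beta>} \<Longrightarrow> \<eta> s = 0"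
  shows "integrable lborel (\<lambda>s. profile g s * \<eta> s)"
    and "(\<integral>x. flux g x * integral {0..norm x} \<eta> \<partial>lebesgue) = - sphere_vol TYPE(real^'n) * (\<integral>s. profile g s * \<eta> s \<partial>lborel)"
proof -
  \<comment> \<open>Joint measurability on the product space is checked with a Borel version of the
    flux.\<close>
  obtain \<gamma> where [measurable]: "\<gamma> \<in> borel_measurable borel" and ae: "AE x in lborel. flux g x = \<gamma> x"
    using completion_ex_borel_measurable_real[OF flux_measurable[OF gm]] by auto
  have ae': "AE x in lebesgue. flux g x = \<gamma> x" using ae by (rule AE_completion)
  have \<eta>m [measurable]: "\<eta> \<in> borel_measurable borel" using c by (rule borel_measurable_continuous_onI)
  have \<eta>i: "integrable lborel \<eta>"
  proof (rule integrable_continuous_bounded_support(1)[OF c, of \<beta>])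
    fix x :: real assume "norm x > \<beta>"
    then show "\<eta> x = 0" using ab by (intro supp) auto
  qed
  define f where "f x s = indicator {s..} (norm x) * \<gamma> x * \<eta> s" for x and s :: real
  have pm: "{p::(real^'n) \<times> real. snd p \<le> norm (fst p)} \<in> sets (borel \<Otimes>\<^sub>M borel)"
    by (subst borel_prod) (intro borel_closed closed_Collect_le continuous_intros)
  have inner_int: "(\<integral>s. indicator {0..r} s *\<^sub>R \<eta> s \<partial>lborel) = integral {0..r} \<eta>" for r
    using set_borel_integral_eq_integral(2)[of "{0..r}" \<eta>] borel_integrable_compact[of "{0..r}" \<eta>] continuous_on_subset[OF c]
    by (simp add: set_lebesgue_integral_def set_integrable_def)
  have fm [measurable]: "case_prod f \<in> borel_measurable (lborel \<Otimes>\<^sub>M lborel)"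
  proof -
    have "(\<lambda>p::(real^'n) \<times> real. indicator {p. snd p \<le> norm (fst p)} p * \<gamma> (fst p) * \<eta> (snd p)) \<in> borel_measurable (lborel \<Otimes>\<^sub>M lborel)"
      using pm by measurable
    moreover have "case_prod f = (\<lambda>p. indicator {p. snd p \<le> norm (fst p)} p * \<gamma> (fst p) * \<eta> (snd p))"
      by (auto simp: f_def fun_eq_iff indicator_def)
    ultimately show ?thesis by simp
  qed
  have fl: "integrable lborel (\<lambda>x. indicator {r<..} (norm x) * \<gamma> x)"
      "(\<integral>x. indicator {r<..} (norm x) * \<gamma> x \<partial>lborel) = - sphere_vol TYPE(real^'n) * profile g r" if r: "r > 0" for r
  proof -
    have m: "(\<lambda>x. indicator {r<..} (norm x) * flux g x) \<in> borel_measurable lebesgue"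
      by (intro borel_measurable_times flux_measurable[OF gm] indicator_norm_measurable) auto
    have m2: "(\<lambda>x. indicator {r<..} (norm x) * \<gamma> x) \<in> borel_measurable lborel" by measurable
    have a: "AE x in lebesgue. indicator {r<..} (norm x) * flux g x = indicator {r<..} (norm x) * \<gamma> x"
      using ae' by eventually_elim simp
    have i: "integrable lebesgue (\<lambda>x. indicator {r<..} (norm x) * flux g x)"
      by (rule flux_integral_bound(1)[OF n3 gm g2 _ shell_integral(3)[OF n3 r order_refl]]) auto
    have "integrable lebesgue (\<lambda>x. indicator {r<..} (norm x) * \<gamma> x)"
      using i integrable_cong_AE[OF m measurable_completion[OF m2] a] by simp
    then show "integrable lborel (\<lambda>x. indicator {r<..} (norm x) * \<gamma> x)"
      using m2 by (simp add: integrable_completion)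
    have "(\<integral>x. indicator {r<..} (norm x) * \<gamma> x \<partial>lborel) = (\<integral>x. indicator {r<..} (norm x) * \<gamma> x \<partial>lebesgue)"
      by (rule integral_completion[symmetric, OF m2])
    also have "\<dots> = (\<integral>x. indicator {r<..} (norm x) * flux g x \<partial>lebesgue)"
      by (rule integral_cong_AE[symmetric, OF m measurable_completion[OF m2] a])
    finally show "(\<integral>x. indicator {r<..} (norm x) * \<gamma> x \<partial>lborel) = - sphere_vol TYPE(real^'n) * profile g r"
      using sphere_vol_pos[where 'a="real^'n"] by (simp add: profile_def)
  qed
  have inner_i: "integrable lborel (\<lambda>s. f x s)" for x
  proof (rule Bochner_Integration.integrable_bound[of _ "\<lambda>s. \<bar>\<gamma> x\<bar> * \<bar>\<eta> s\<bar>"])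
    show "(\<lambda>s. f x s) \<in> borel_measurable lborel"
      using measurable_compose[OF measurable_Pair1'[of x lborel lborel] fm] by simp
  qed (use \<eta>i in \<open>auto simp: f_def abs_mult indicator_def\<close>)
  have fi: "integrable (lborel \<Otimes>\<^sub>M lborel) (case_prod f)"
  proof (rule lborel_pair.Fubini_integrable[OF fm])
    show "AE x in lborel. integrable lborel (\<lambda>s. case_prod f (x, s))" using inner_i by simp
    show "integrable lborel (\<lambda>x. \<integral>s. norm (case_prod f (x, s)) \<partial>lborel)"
    proof (rule Bochner_Integration.integrable_bound)
      \<comment> \<open>On the support of \<eta> one has |x| \<ge> s \<ge> \<alpha>, so the exterior
        of the ball of radius \<alpha>/2 contains the whole region; halving turns the closed
        condition into the open one for which integrability of the flux is known.\<close>
      show "integrable lborel (\<lambda>x. (indicator {\<alpha>/2<..} (norm x) * \<gamma> x) * (\<integral>s. \<bar>\<eta> s\<bar> \<partial>lborel))"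
        using fl(1)[of "\<alpha>/2"] ab by (intro integrable_mult_left) auto
      show "(\<lambda>x. \<integral>s. norm (case_prod f (x, s)) \<partial>lborel) \<in> borel_measurable lborel"
        by measurable
      show "AE x in lborel. norm (\<integral>s. norm (case_prod f (x, s)) \<partial>lborel)
          \<le> norm (indicator {\<alpha>/2<..} (norm x) * \<gamma> x * (\<integral>s. \<bar>\<eta> s\<bar> \<partial>lborel))"
      proof (rule AE_I2)
        fix x :: "real^'n"
        have "(\<integral>s. \<bar>f x s\<bar> \<partial>lborel) \<le> (\<integral>s. \<bar>indicator {\<alpha>/2<..} (norm x) * \<gamma> x\<bar> * \<bar>\<eta> s\<bar> \<partial>lborel)"
        proof (rule integral_mono)
          show "\<bar>f x s\<bar> \<le> \<bar>indicator {\<alpha>/2<..} (norm x) * \<gamma> x\<bar> * \<bar>\<eta> s\<bar>" for s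
            using supp[of s] ab by (auto simp: f_def abs_mult indicator_def)
        qed (use inner_i \<eta>i in auto)
        then show "norm (\<integral>s. norm (case_prod f (x, s)) \<partial>lborel)
          \<le> norm (indicator {\<alpha>/2<..} (norm x) * \<gamma> x * (\<integral>s. \<bar>\<eta> s\<bar> \<partial>lborel))"
          by (simp add: abs_mult)
      qed
    qed
  qed
  have inner_s: "(\<integral>s. f x s \<partial>lborel) = \<gamma> x * integral {0..norm x} \<eta>" for x
  proof -
    have "f x s = \<gamma> x * (indicator {0..norm x} s *\<^sub>R \<eta> s)" for s
      using supp[of s] ab by (auto simp: f_def indicator_def)
    then show ?thesis using inner_int[of "norm x"] by simp
  qed
  have z: "AE x::real^'n in lborel. norm x \<noteq> r" for r
    using AE_norm_neq[where 'a="real^'n", of r] by (simp add: AE_completion_iff)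
  have inner_x: "(\<integral>x. f x s \<partial>lborel) = - sphere_vol TYPE(real^'n) * (profile g s * \<eta> s)" for s
  proof (cases "s > 0")
    case True
    have "(\<integral>x. f x s \<partial>lborel) = (\<integral>x. (indicator {s<..} (norm x) * \<gamma> x) * \<eta> s \<partial>lborel)"
    proof (rule integral_cong_AE)
      show "(\<lambda>x. f x s) \<in> borel_measurable lborel" unfolding f_def by measurable
      show "AE x in lborel. f x s = indicator {s<..} (norm x) * \<gamma> x * \<eta> s"
        using z[of s] by eventually_elim (auto simp: f_def indicator_def)
    qed measurable
    then show ?thesis using fl[OF True] by simp
  next
    case False
    then show ?thesis using supp[of s] ab by (simp add: f_def)
  qed
  have "integrable lborel (\<lambda>s. \<integral>x. f x s \<partial>lborel)"
    using lborel_pair.integrable_snd[OF fi] by simp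
  then have "integrable lborel (\<lambda>s. - sphere_vol TYPE(real^'n) * (profile g s * \<eta> s))" by (simp only: inner_x)
  then show "integrable lborel (\<lambda>s. profile g s * \<eta> s)"
    using sphere_vol_pos[where 'a="real^'n"] by simp
  have mI: "(\<lambda>x. \<gamma> x * integral {0..norm x} \<eta>) \<in> borel_measurable lborel"
    using lborel_pair.integrable_fst[OF fi] by (simp only: inner_s) auto
  have "(\<integral>s. (\<integral>x. f x s \<partial>lborel) \<partial>lborel) = (\<integral>x. (\<integral>s. f x s \<partial>lborel) \<partial>lborel)"
    by (rule lborel_pair.Fubini_integral[OF fi])
  then have "(\<integral>x. \<gamma> x * integral {0..norm x} \<eta> \<partial>lborel) = - sphere_vol TYPE(real^'n) * (\<integral>s. profile g s * \<eta> s \<partial>lborel)"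
    by (simp add: inner_s inner_x)
  moreover have "(\<integral>x. flux g x * integral {0..norm x} \<eta> \<partial>lebesgue) = (\<integral>x. \<gamma> x * integral {0..norm x} \<eta> \<partial>lebesgue)"
  proof (rule integral_cong_AE)
    have "(\<lambda>x::real^'n. \<integral>s. indicator {p. snd p \<le> norm (fst p)} (x, s) * \<eta> s \<partial>lborel) \<in> borel_measurable lborel"
      using pm by measurable
    moreover have "(\<integral>s. indicator {p. snd p \<le> norm (fst p)} (x, s) * \<eta> s \<partial>lborel) = integral {0..norm x} \<eta>" for x :: "real^'n"
      unfolding inner_int[symmetric] using supp ab
      by (intro Bochner_Integration.integral_cong refl) (force simp: indicator_def)
    ultimately have "(\<lambda>x::real^'n. integral {0..norm x} \<eta>) \<in> borel_measurable lborel" by simp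
    then show "(\<lambda>x. flux g x * integral {0..norm x} \<eta>) \<in> borel_measurable lebesgue"
      by (intro borel_measurable_times flux_measurable[OF gm] measurable_completion)
  qed (use ae' measurable_completion[OF mI] in auto)
  moreover have "(\<integral>x. \<gamma> x * integral {0..norm x} \<eta> \<partial>lebesgue) = (\<integral>x. \<gamma> x * integral {0..norm x} \<eta> \<partial>lborel)"
    by (rule integral_completion[OF mI])
  ultimately show "(\<integral>x. flux g x * integral {0..norm x} \<eta> \<partial>lebesgue) = - sphere_vol TYPE(real^'n) * (\<integral>s. profile g s * \<eta> s \<partial>lborel)"
    by simp
qed

lemma D12_integrable_mult:
  fixes u :: "real^'n \<Rightarrow> real"
  assumes n3: "CARD('n) \<ge> 3" and D: "D12 u" and hm: "h \<in> borel_measurable lebesgue"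
    and hB: "\<And>x. \<bar>h x\<bar> \<le> B" and supp: "\<And>x. norm x > R \<Longrightarrow> h x = 0"
  shows "integrable lebesgue (\<lambda>x. u x * h x)"
proof -
  let ?p = "2 * real CARD('n) / (real CARD('n) - 2)"
  have p: "?p \<ge> 1" using n3 by (simp add: field_simps)
  have le: "\<bar>t\<bar> \<le> 1 + \<bar>t\<bar> powr ?p" for t :: real
  proof (cases "\<bar>t\<bar> \<le> 1")
    case False
    then have "\<bar>t\<bar> powr 1 \<le> \<bar>t\<bar> powr ?p" using p by (intro powr_mono) auto
    then show ?thesis using False by simp
  qed (simp add: add_increasing2)
  have B0: "B \<ge> 0" using hB[of 0] by linarith
  show ?thesis
  proof (rule Bochner_Integration.integrable_bound)
    have "integrable lebesgue (\<lambda>x::real^'n. indicator (cball 0 R) x :: real)"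
      using emeasure_lborel_cball_finite[of "0::real^'n" R] by (intro integrable_real_indicator) auto
    then show "integrable lebesgue (\<lambda>x. B * (indicator (cball 0 R) x + \<bar>u x\<bar> powr ?p))"
      using D by (auto simp: D12_def)
    show "(\<lambda>x. u x * h x) \<in> borel_measurable lebesgue" using D hm by (auto simp: D12_def)
    show "AE x in lebesgue. norm (u x * h x) \<le> norm (B * (indicator (cball 0 R) x + \<bar>u x\<bar> powr ?p))"
    proof (rule AE_I2)
      fix x :: "real^'n"
      show "norm (u x * h x) \<le> norm (B * (indicator (cball 0 R) x + \<bar>u x\<bar> powr ?p))"
      proof (cases "norm x \<le> R")
        case True
        have "\<bar>u x\<bar> * \<bar>h x\<bar> \<le> (1 + \<bar>u x\<bar> powr ?p) * B"
          using le[of "u x"] hB[of x] by (intro mult_mono) auto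
        then show ?thesis using True B0 by (simp add: abs_mult mult.commute)
      next
        case False
        then show ?thesis using supp[of x] by simp
      qed
    qed
  qed
qed

text \<open>Against mean-zero test functions the Borel profile of \<open>u\<close> and the profile
  of \<open>g\<close> have the same integrals, so they differ by a constant. The integrability of
  |u|^(2n/(n-2)) then rules out a nonzero constant, since \<open>profile g\<close> tends to 0 at
  infinity.\<close>

theorem radial_representation:
  fixes u :: "real^'n \<Rightarrow> real"
  assumes n3: "CARD('n) \<ge> 3" and D: "D12 u" and rad: "radial u" and wg: "weak_grad u g"
    and g2: "integrable lebesgue (\<lambda>x. (norm (g x))\<^sup>2)"
  shows "AE x in lebesgue. u x = profile g (norm x)"
proof -
  have gm: "g \<in> borel_measurable lebesgue" using wg by (simp add: weak_grad_def)
  have um: "u \<in> borel_measurable lebesgue" using D by (simp add: D12_def)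
  obtain v where "AE x in lebesgue. u x = v (norm x)" using rad by (auto simp: radial_def)
  then obtain w where [measurable]: "w \<in> borel_measurable borel" and w: "AE x in lebesgue. u x = w (norm x)"
    using radial_profile_borel[OF um] by metis
  let ?n = "CARD('n)"
  let ?\<sigma> = "sphere_vol TYPE(real^'n)"
  have test: "integrable lborel (\<lambda>s. w s * \<eta> s) \<and> (integral {0..\<beta>} \<eta> = 0 \<longrightarrow> (\<integral>s. w s * \<eta> s \<partial>lborel) = (\<integral>s. profile g s * \<eta> s \<partial>lborel))"
    if ab: "0 < \<alpha>" "\<alpha> < \<beta>" and c: "continuous_on UNIV \<eta>" and supp: "\<And>s. s \<notin> {\<alpha>..\<beta>} \<Longrightarrow> \<eta> s = 0" for \<eta> \<alpha> \<beta>
  proof -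
    have \<eta>m [measurable]: "\<eta> \<in> borel_measurable borel" using c by (rule borel_measurable_continuous_onI)
    \<comment> \<open>The denominator cancels the density of polar coordinates, so the n-dimensional
      integral of u q(|x|) is a multiple of the one-dimensional integral of w \<eta>.\<close>
    define q where "q s = \<eta> s / s ^ (?n - 1)" for s
    have qm [measurable]: "q \<in> borel_measurable borel" unfolding q_def by measurable
    have ui: "integrable lebesgue (\<lambda>x. u x * q (norm x))"
    proof -
      obtain B where B: "B > 0" "\<And>s. norm (\<eta> s) \<le> B"
      proof (rule bounded_continuous_bounded_support[OF c, of \<beta>])
        fix x :: real assume "norm x > \<beta>"
        then show "\<eta> x = 0" using ab by (intro supp) auto
      qed blast
      show ?thesis
      proof (rule D12_integrable_mult[OF n3 D])
        show "(\<lambda>x::real^'n. q (norm x)) \<in> borel_measurable lebesgue" by (intro measurable_completion) measurable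
        show "\<bar>q (norm x)\<bar> \<le> B / \<alpha> ^ (?n - 1)" for x :: "real^'n"
        proof (cases "norm x < \<alpha>")
          case True
          then show ?thesis using supp[of "norm x"] B(1) ab by (simp add: q_def)
        next
          case False
          then have "\<alpha> ^ (?n - 1) \<le> norm x ^ (?n - 1)" using ab by (intro power_mono) auto
          then show ?thesis unfolding q_def abs_divide using B(2)[of "norm x"] B(1) ab by (intro frac_le) auto
        qed
        show "q (norm x) = 0" if "norm x > \<beta>" for x :: "real^'n" using supp[of "norm x"] that by (simp add: q_def)
      qed
    qed
    let ?W = "\<lambda>s. indicator {0..} s * (?\<sigma> * s ^ (DIM(real^'n) - 1)) * (w s * q s)"
    have W: "?W = (\<lambda>s. ?\<sigma> * (w s * \<eta> s))"
    proof
      fix s show "?W s = ?\<sigma> * (w s * \<eta> s)"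
        using supp[of s] ab by (cases "s > 0") (auto simp: q_def)
    qed
    have ae: "AE x in lebesgue. u x * q (norm x) = w (norm x) * q (norm x)" using w by eventually_elim simp
    have m1: "(\<lambda>x. u x * q (norm x)) \<in> borel_measurable lebesgue" using ui by auto
    have m2: "(\<lambda>x::real^'n. w (norm x) * q (norm x)) \<in> borel_measurable lborel" by measurable
    have "integrable lebesgue (\<lambda>x::real^'n. w (norm x) * q (norm x))"
      using ui integrable_cong_AE[OF m1 measurable_completion[OF m2] ae] by simp
    then have "integrable lborel (\<lambda>x::real^'n. w (norm x) * q (norm x))" using m2 by (simp add: integrable_completion)
    then have "integrable lborel ?W" by (subst (asm) integral_radial(1)[of "\<lambda>s. w s * q s"]) auto
    then have i: "integrable lborel (\<lambda>s. w s * \<eta> s)" unfolding W using sphere_vol_pos[where 'a="real^'n"] by simp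
    have "(\<integral>x. u x * q (norm x) \<partial>lebesgue) = (\<integral>x. w (norm (x::real^'n)) * q (norm x) \<partial>lebesgue)"
      by (rule integral_cong_AE[OF m1 measurable_completion[OF m2] ae])
    also have "\<dots> = (\<integral>x. w (norm (x::real^'n)) * q (norm x) \<partial>lborel)" by (rule integral_completion[OF m2])
    also have "\<dots> = (\<integral>s. ?W s \<partial>lborel)" by (rule integral_radial(2)[of "\<lambda>s. w s * q s"]) auto
    finally have e1: "(\<integral>x. u x * q (norm x) \<partial>lebesgue) = ?\<sigma> * (\<integral>s. w s * \<eta> s \<partial>lborel)" unfolding W by simp
    have "(\<integral>s. w s * \<eta> s \<partial>lborel) = (\<integral>s. profile g s * \<eta> s \<partial>lborel)" if z: "integral {0..\<beta>} \<eta> = 0"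
    proof -
      have "(\<integral>x. u x * q (norm x) \<partial>lebesgue) = - (\<integral>x. flux g x * integral {0..norm x} \<eta> \<partial>lebesgue)"
        unfolding q_def by (rule weak_grad_flux_identity[OF wg ab c supp z])
      also have "\<dots> = ?\<sigma> * (\<integral>s. profile g s * \<eta> s \<partial>lborel)"
        using flux_Fubini(2)[OF n3 gm g2 ab c supp] by simp
      finally show ?thesis using e1 sphere_vol_pos[where 'a="real^'n"] by simp
    qed
    with i show ?thesis by blast
  qed
  have "\<exists>c. AE s in lborel. s > 0 \<longrightarrow> w s - profile g s = c"
  proof (rule constant_if_orthogonal)
    fix \<eta> :: "real \<Rightarrow> real" and \<alpha> \<beta> assume h: "0 < \<alpha>" "\<alpha> < \<beta>" "continuous_on UNIV \<eta>" "\<And>s. s \<notin> {\<alpha>..\<beta>} \<Longrightarrow> \<eta> s = (0::real)"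
    note t = test[OF h] and p = flux_Fubini(1)[OF n3 gm g2 h]
    show "integrable lborel (\<lambda>s. (w s - profile g s) * \<eta> s)"
      using t p by (simp add: left_diff_distrib)
    assume z: "(\<integral>s. \<eta> s \<partial>lborel) = 0"
    have "\<eta> = (\<lambda>s. indicator {0..\<beta>} s *\<^sub>R \<eta> s)"
    proof
      fix s show "\<eta> s = indicator {0..\<beta>} s *\<^sub>R \<eta> s" using h(1) h(4)[of s] by (cases "s \<in> {\<alpha>..\<beta>}") auto
    qed
    then have "(\<integral>s. indicator {0..\<beta>} s *\<^sub>R \<eta> s \<partial>lborel) = 0" using z by simp
    then have "integral {0..\<beta>} \<eta> = 0"
      using set_borel_integral_eq_integral(2)[of "{0..\<beta>}" \<eta>] borel_integrable_compact[of "{0..\<beta>}" \<eta>] continuous_on_subset[OF h(3)]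
      by (simp add: set_lebesgue_integral_def set_integrable_def)
    then show "(\<integral>s. (w s - profile g s) * \<eta> s \<partial>lborel) = 0" using t p by (simp add: left_diff_distrib)
  qed
  then obtain c where "AE s in lborel. s > 0 \<longrightarrow> w s - profile g s = c" by blast
  then have "AE x::real^'n in lebesgue. x \<noteq> 0 \<longrightarrow> w (norm x) - profile g (norm x) = c" by (rule AE_radial)
  moreover have "AE x::real^'n in lebesgue. x \<noteq> 0"
    using AE_completion[OF AE_lborel_singleton[of "0::real^'n"]] by simp
  ultimately have uc: "AE x in lebesgue. u x = profile g (norm x) + c"
    using w by eventually_elim auto
  \<comment> \<open>Otherwise |u| would be at least |c|/2 outside a large ball, and integrability
    would make the whole space have finite measure.\<close>
  have "c = 0"
  proof (rule ccontr)
    assume c: "c \<noteq> 0"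
    let ?C = "profile_const TYPE('n) * sqrt (\<integral>x. (norm (g x))\<^sup>2 \<partial>lebesgue)"
    let ?p = "2 * real ?n / (real ?n - 2)"
    have "((\<lambda>r. r powr (2 - real ?n)) \<longlongrightarrow> 0) at_top"
      using n3 by (intro tendsto_neg_powr filterlim_ident) auto
    then have "((\<lambda>r. ?C * sqrt (r powr (2 - real ?n))) \<longlongrightarrow> ?C * sqrt 0) at_top" by (intro tendsto_intros)
    then have "\<forall>\<^sub>F r in at_top. ?C * sqrt (r powr (2 - real ?n)) < \<bar>c\<bar> / 2"
      using c by (auto dest!: order_tendstoD(2)[of _ _ _ "\<bar>c\<bar> / 2"])
    then obtain R0 where R0: "\<And>r. r \<ge> R0 \<Longrightarrow> ?C * sqrt (r powr (2 - real ?n)) < \<bar>c\<bar> / 2"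
      by (auto simp: eventually_at_top_linorder)
    define R where "R = max 1 R0"
    have le: "AE x in lebesgue. (\<bar>c\<bar> / 2) powr ?p * indicator (- cball 0 R) x \<le> \<bar>u x\<bar> powr ?p"
      using uc
    proof eventually_elim
      case (elim x)
      show ?case
      proof (cases "norm x > R")
        case True
        then have x: "norm x > 0" "norm x \<ge> R0" by (auto simp: R_def)
        have "\<bar>profile g (norm x)\<bar> \<le> \<bar>c\<bar> / 2"
          using profile_bound[OF n3 gm g2 x(1)] R0[OF x(2)] by linarith
        then have "\<bar>c\<bar> / 2 \<le> \<bar>u x\<bar>" using elim by linarith
        then have "(\<bar>c\<bar> / 2) powr ?p \<le> \<bar>u x\<bar> powr ?p" using n3 by (intro powr_mono2) auto
        then show ?thesis using True by simp
      qed simp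
    qed
    have up: "integrable lebesgue (\<lambda>x. \<bar>u x\<bar> powr ?p)" using D by (simp add: D12_def)
    have "integrable lebesgue (\<lambda>x::real^'n. (\<bar>c\<bar> / 2) powr ?p * indicator (- cball 0 R) x)"
    proof (rule Bochner_Integration.integrable_bound[OF up])
      show "AE x in lebesgue. norm ((\<bar>c\<bar> / 2) powr ?p * indicator (- cball 0 R) x) \<le> norm (\<bar>u x\<bar> powr ?p)"
        using le by eventually_elim simp
    qed (intro measurable_completion, measurable)
    then have "integrable lebesgue (\<lambda>x::real^'n. indicator (- cball 0 R) x :: real)" using c by simp
    then have "emeasure lebesgue (- cball (0::real^'n) R) < \<infinity>" by (simp add: integrable_indicator_iff)
    moreover have "emeasure lebesgue (cball (0::real^'n) R) < \<infinity>"
      using emeasure_lborel_cball_finite[of "0::real^'n" R] by simp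
    ultimately have "emeasure lebesgue (- cball (0::real^'n) R) + emeasure lebesgue (cball (0::real^'n) R) < \<infinity>" by simp
    moreover have "emeasure lebesgue (UNIV::(real^'n) set) = emeasure lebesgue (- cball (0::real^'n) R) + emeasure lebesgue (cball (0::real^'n) R)"
      by (subst plus_emeasure) (auto intro!: arg_cong2[where f=emeasure])
    ultimately have "emeasure lebesgue (UNIV::(real^'n) set) < \<infinity>" by (simp only:)
    then show False by simp
  qed
  then show ?thesis using uc by simp
qed

section \<open>Hardy's inequality\<close>

lemma radial_weight_measurable:
  fixes V :: "real \<Rightarrow> real"
  assumes "continuous_on {0<..} V"
  shows "(\<lambda>x::real^'n. V (norm x)) \<in> borel_measurable borel"
proof (rule borel_measurable_continuous_countable_exceptions[of "{0}"])
  show "continuous_on (- {0::real^'n}) (\<lambda>x. V (norm x))"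
    by (rule continuous_on_compose2[OF assms]) (auto intro!: continuous_intros)
qed auto

lemma profile_norm_measurable:
  fixes g :: "real^'n \<Rightarrow> real^'n"
  assumes "CARD('n) \<ge> 3" "g \<in> borel_measurable lebesgue" "integrable lebesgue (\<lambda>x. (norm (g x))\<^sup>2)"
  shows "(\<lambda>x::real^'n. profile g (norm x)) \<in> borel_measurable borel"
  by (rule radial_weight_measurable[OF continuous_on_profile[OF assms]])

text \<open>Hardy's inequality follows from the flux formula by the Cauchy--Schwarz inequality with the
  weight \<open>|y| powr (-(n-2)/4)\<close>, which makes both the inner and the outer integral of the
  subsequent application of Tonelli's theorem converge.\<close>

lemma Hardy_profile:
  fixes g :: "real^'n \<Rightarrow> real^'n"
  assumes n3: "CARD('n) \<ge> 3" and gm: "g \<in> borel_measurable lebesgue"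
    and g2: "integrable lebesgue (\<lambda>x. (norm (g x))\<^sup>2)"
  shows "integrable lebesgue (\<lambda>x::real^'n. (profile g (norm x))\<^sup>2 / (norm x)\<^sup>2)"
    and "(\<integral>x. (profile g (norm x))\<^sup>2 / (norm (x::real^'n))\<^sup>2 \<partial>lebesgue) \<le> 4 / (real CARD('n) - 2)\<^sup>2 * (\<integral>x. (norm (g x))\<^sup>2 \<partial>lebesgue)"
proof -
  let ?n = "real CARD('n)"
  define m where "m = ?n - 2"
  have m: "m > 0" "?n = m + 2" using n3 by (auto simp: m_def)
  let ?\<sigma> = "sphere_vol TYPE(real^'n)"
  have \<sigma>: "?\<sigma> > 0" by (rule sphere_vol_pos)
  let ?Q = "\<integral>x. (norm (g x))\<^sup>2 \<partial>lebesgue"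
  have Q0: "?Q \<ge> 0" by simp
  \<comment> \<open>Tonelli's theorem is applied to a Borel version of |g|^2. It may be negative on
    a null set, which explains the case distinctions on the sign of \<open>H y\<close>
    below.\<close>
  obtain H where [measurable]: "H \<in> borel_measurable borel" and ae: "AE y in lborel. (norm (g y))\<^sup>2 = H y"
    using completion_ex_borel_measurable_real[of "\<lambda>y. (norm (g y))\<^sup>2" lborel] g2 by auto
  have ae': "AE y in lebesgue. (norm (g y))\<^sup>2 = H y" using ae by (rule AE_completion)
  have Hint: "(\<integral>\<^sup>+y. ennreal (H y) \<partial>lborel) = ennreal ?Q"
  proof -
    have "(\<integral>\<^sup>+y. ennreal (H y) \<partial>lborel) = (\<integral>\<^sup>+y. ennreal (H y) \<partial>lebesgue)" by (simp add: nn_integral_completion)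
    also have "\<dots> = (\<integral>\<^sup>+y. ennreal ((norm (g y))\<^sup>2) \<partial>lebesgue)"
      by (rule nn_integral_cong_AE) (use ae' in eventually_elim, simp)
    also have "\<dots> = ennreal ?Q" by (rule nn_integral_eq_integral[OF g2]) auto
    finally show ?thesis .
  qed
  define A where "A r = (\<integral>\<^sup>+y. indicator {r<..} (norm y) * ennreal (H y * norm y powr (- m/2)) \<partial>lborel)" for r
  have step: "ennreal ((?\<sigma> * profile g r)\<^sup>2) \<le> A r * ennreal (2 * ?\<sigma> / m * r powr (- m/2))" if r: "r > 0" for r
  proof -
    let ?a = "\<lambda>y. ennreal (indicator {r<..} (norm y) * (norm (g y) * norm y powr (- m/4)))"
    let ?b = "\<lambda>y::real^'n. ennreal (indicator {r<..} (norm y) * norm y powr (1 - ?n + m/4))"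
    have [measurable]: "g \<in> borel_measurable lebesgue" by (rule gm)
    have nm [measurable]: "(\<lambda>y::real^'n. norm y) \<in> borel_measurable lebesgue" by (intro measurable_completion) auto
    have am: "?a \<in> borel_measurable lebesgue" by measurable
    have bm: "?b \<in> borel_measurable lebesgue" by measurable
    have i: "integrable lebesgue (\<lambda>x. indicator {r<..} (norm x) * flux g x)"
      by (rule flux_integral_bound(1)[OF n3 gm g2 _ shell_integral(3)[OF n3 r order_refl]]) auto
    have "?\<sigma> * profile g r = - (\<integral>x. indicator {r<..} (norm x) * flux g x \<partial>lebesgue)"
      using \<sigma> by (simp add: profile_def)
    then have "ennreal \<bar>?\<sigma> * profile g r\<bar> \<le> ennreal (\<integral>x. \<bar>indicator {r<..} (norm x) * flux g x\<bar> \<partial>lebesgue)"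
      by (simp add: ennreal_leI)
    also have "\<dots> = (\<integral>\<^sup>+x. ennreal \<bar>indicator {r<..} (norm x) * flux g x\<bar> \<partial>lebesgue)"
      by (rule nn_integral_eq_integral[symmetric]) (use i in auto)
    also have "\<dots> \<le> (\<integral>\<^sup>+y. ?a y * ?b y \<partial>lebesgue)"
    proof (rule nn_integral_mono)
      fix y :: "real^'n"
      have "norm y powr (1 - ?n) = norm y powr (- m/4) * norm y powr (1 - ?n + m/4)" by (simp add: powr_add[symmetric])
      then show "ennreal \<bar>indicator {r<..} (norm y) * flux g y\<bar> \<le> ?a y * ?b y"
        using flux_bound[OF n3 gm g2, of y]
        by (auto simp: indicator_def ennreal_mult[symmetric] mult.assoc intro!: ennreal_leI)
    qed
    finally have "(ennreal \<bar>?\<sigma> * profile g r\<bar>)\<^sup>2 \<le> (\<integral>\<^sup>+y. ?a y * ?b y \<partial>lebesgue)\<^sup>2" by (rule power_mono) simp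
    also have "\<dots> \<le> (\<integral>\<^sup>+y. (?a y)\<^sup>2 \<partial>lebesgue) * (\<integral>\<^sup>+y. (?b y)\<^sup>2 \<partial>lebesgue)"
      by (rule Cauchy_Schwarz_nn_integral[OF am bm])
    also have "(\<integral>\<^sup>+y. (?a y)\<^sup>2 \<partial>lebesgue) = A r"
    proof -
      have "(\<integral>\<^sup>+y. (?a y)\<^sup>2 \<partial>lebesgue) = (\<integral>\<^sup>+y. indicator {r<..} (norm y) * ennreal (H y * norm y powr (- m/2)) \<partial>lebesgue)"
      proof (rule nn_integral_cong_AE)
        show "AE y in lebesgue. (?a y)\<^sup>2 = indicator {r<..} (norm y) * ennreal (H y * norm y powr (- m/2))"
          using ae'
        proof eventually_elim
          case (elim y)
          have "norm y powr (- m/2) = norm y powr (- m/4) * norm y powr (- m/4)" by (simp add: powr_add[symmetric])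
          then show ?case using elim[symmetric]
            by (auto simp: indicator_def power2_eq_square ennreal_mult[symmetric] mult_ac)
        qed
      qed
      also have "\<dots> = A r" unfolding A_def by (rule nn_integral_completion)
      finally show ?thesis .
    qed
    also have "(\<integral>\<^sup>+y. (?b y)\<^sup>2 \<partial>lebesgue) \<le> ennreal (2 * ?\<sigma> / m * r powr (- m/2))"
    proof -
      have "(\<integral>\<^sup>+y. (?b y)\<^sup>2 \<partial>lebesgue) = (\<integral>\<^sup>+y. (?b y)\<^sup>2 \<partial>lborel)" by (rule nn_integral_completion)
      also have "\<dots> \<le> (\<integral>\<^sup>+y. ennreal (indicator {r..} (norm (y::real^'n)) * norm y powr (- ?n - m/2)) \<partial>lborel)"
      proof (rule nn_integral_mono)
        fix y :: "real^'n"
        have "norm y powr (- ?n - m/2) = norm y powr (1 - ?n + m/4) * norm y powr (1 - ?n + m/4)"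
          using m by (simp add: powr_add[symmetric])
        then show "(?b y)\<^sup>2 \<le> ennreal (indicator {r..} (norm y) * norm y powr (- ?n - m/2))"
          by (auto simp: indicator_def power2_eq_square ennreal_mult[symmetric])
      qed
      also have "\<dots> = ennreal (2 * ?\<sigma> / m * r powr (- m/2))"
        by (subst nn_integral_norm_powr_outside) (use m r in \<open>auto simp: field_simps\<close>)
      finally show ?thesis .
    qed
    finally show ?thesis by (simp add: ennreal_power mult_left_mono)
  qed
  \<comment> \<open>This is 2 \<sigma> / m from the Cauchy-Schwarz step divided by \<sigma>^2 from
    the normalization of the profile. The inner integral over x contributes another 2 \<sigma> / m,
    and the product is 4 / m^2.\<close>
  define c where "c = 2 / (?\<sigma> * m)"
  have c0: "c > 0" using \<sigma> m by (simp add: c_def)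
  have pt: "ennreal ((profile g (norm x))\<^sup>2 / (norm x)\<^sup>2) \<le> ennreal (c * norm x powr (- m/2 - 2)) * A (norm x)" if x: "x \<noteq> 0" for x :: "real^'n"
  proof -
    let ?r = "norm x"
    have r: "?r > 0" using x by simp
    have "ennreal ((profile g ?r)\<^sup>2 / ?r\<^sup>2) = ennreal (1 / (?\<sigma>\<^sup>2 * ?r\<^sup>2)) * ennreal ((?\<sigma> * profile g ?r)\<^sup>2)"
      using \<sigma> r by (subst ennreal_mult[symmetric]) (auto simp: field_simps)
    also have "\<dots> \<le> ennreal (1 / (?\<sigma>\<^sup>2 * ?r\<^sup>2)) * (A ?r * ennreal (2 * ?\<sigma> / m * ?r powr (- m/2)))"
      by (intro mult_left_mono step r) simp
    also have "\<dots> = (ennreal (1 / (?\<sigma>\<^sup>2 * ?r\<^sup>2)) * ennreal (2 * ?\<sigma> / m * ?r powr (- m/2))) * A ?r" by (simp only: mult_ac)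
    also have "ennreal (1 / (?\<sigma>\<^sup>2 * ?r\<^sup>2)) * ennreal (2 * ?\<sigma> / m * ?r powr (- m/2)) = ennreal (c * ?r powr (- m/2 - 2))"
    proof -
      have "?r powr (- m/2 - 2) = ?r powr (- m/2) / ?r\<^sup>2" using r by (simp add: powr_diff)
      then show ?thesis using \<sigma> m r
        by (subst ennreal_mult[symmetric]) (auto simp: c_def field_simps power2_eq_square)
    qed
    finally show ?thesis .
  qed
  define F where "F x y = ennreal (c * norm x powr (- m/2 - 2)) * (indicator {norm x<..} (norm y) * ennreal (H y * norm y powr (- m/2)))"
    for x y :: "real^'n"
  have Fm: "case_prod F \<in> borel_measurable (lborel \<Otimes>\<^sub>M lborel)"
  proof -
    have pm: "{p::(real^'n) \<times> (real^'n). norm (fst p) < norm (snd p)} \<in> sets (borel \<Otimes>\<^sub>M borel)"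
      by (subst borel_prod) (intro borel_open open_Collect_less continuous_intros)
    have "(\<lambda>p. ennreal (c * norm (fst p) powr (- m/2 - 2)) * (indicator {p::(real^'n) \<times> (real^'n). norm (fst p) < norm (snd p)} p * ennreal (H (snd p) * norm (snd p) powr (- m/2)))) \<in> borel_measurable (lborel \<Otimes>\<^sub>M lborel)"
      using pm by measurable
    moreover have "case_prod F = (\<lambda>p. ennreal (c * norm (fst p) powr (- m/2 - 2)) * (indicator {p::(real^'n) \<times> (real^'n). norm (fst p) < norm (snd p)} p * ennreal (H (snd p) * norm (snd p) powr (- m/2))))"
      by (auto simp: F_def fun_eq_iff indicator_def)
    ultimately show ?thesis by simp
  qed
  have x0: "AE x::real^'n in lborel. x \<noteq> 0" using AE_lborel_singleton by auto
  have "(\<integral>\<^sup>+x. ennreal ((profile g (norm x))\<^sup>2 / (norm (x::real^'n))\<^sup>2) \<partial>lborel) \<le> (\<integral>\<^sup>+x. ennreal (c * norm x powr (- m/2 - 2)) * A (norm (x::real^'n)) \<partial>lborel)"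
    by (rule nn_integral_mono_AE) (use x0 in eventually_elim, use pt in auto)
  also have "\<dots> = (\<integral>\<^sup>+x. (\<integral>\<^sup>+y. F x y \<partial>lborel) \<partial>lborel)"
    unfolding A_def F_def by (intro nn_integral_cong nn_integral_cmult[symmetric]) measurable
  also have "\<dots> = (\<integral>\<^sup>+y. (\<integral>\<^sup>+x. F x y \<partial>lborel) \<partial>lborel)"
    by (rule lborel_pair.Fubini'[symmetric, OF Fm])
  also have "\<dots> \<le> (\<integral>\<^sup>+y. ennreal (4 / m\<^sup>2) * ennreal (H y) \<partial>lborel)"
  proof (rule nn_integral_mono)
    fix y :: "real^'n"
    have "(\<integral>\<^sup>+x. F x y \<partial>lborel) \<le> (\<integral>\<^sup>+x. ennreal (indicator {..norm y} (norm (x::real^'n)) * norm x powr (- m/2 - 2)) * ennreal (c * (H y * norm y powr (- m/2))) \<partial>lborel)"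
    proof (rule nn_integral_mono)
      fix x :: "real^'n"
      show "F x y \<le> ennreal (indicator {..norm y} (norm x) * norm x powr (- m/2 - 2)) * ennreal (c * (H y * norm y powr (- m/2)))"
      proof (cases "H y \<ge> 0")
        case True
        then show ?thesis using c0 by (auto simp: F_def indicator_def ennreal_mult[symmetric] mult_ac)
      next
        case False
        then have "H y * norm y powr (- m/2) \<le> 0" by (intro mult_nonpos_nonneg) auto
        then show ?thesis by (simp add: F_def ennreal_neg)
      qed
    qed
    also have "\<dots> = (\<integral>\<^sup>+x. ennreal (indicator {..norm y} (norm (x::real^'n)) * norm x powr (- m/2 - 2)) \<partial>lborel) * ennreal (c * (H y * norm y powr (- m/2)))"
      by (rule nn_integral_multc) measurable
    also have "(\<integral>\<^sup>+x. ennreal (indicator {..norm y} (norm (x::real^'n)) * norm x powr (- m/2 - 2)) \<partial>lborel) = ennreal (2 * ?\<sigma> / m * norm y powr (m/2))"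
      by (subst nn_integral_norm_powr_inside) (use m in \<open>auto simp: field_simps\<close>)
    also have "\<dots> * ennreal (c * (H y * norm y powr (- m/2))) \<le> ennreal (4 / m\<^sup>2) * ennreal (H y)"
    proof (cases "H y \<ge> 0")
      case True
      have "norm y powr (m/2) * norm y powr (- m/2) \<le> 1" by (cases "y = 0") (auto simp: powr_add[symmetric])
      then have "(4 / m\<^sup>2 * H y) * (norm y powr (m/2) * norm y powr (- m/2)) \<le> (4 / m\<^sup>2 * H y) * 1"
        using True by (intro mult_left_mono) auto
      then have "2 * ?\<sigma> / m * norm y powr (m/2) * (c * (H y * norm y powr (- m/2))) \<le> 4 / m\<^sup>2 * H y"
        using \<sigma> m by (simp add: c_def power2_eq_square mult_ac)
      then show ?thesis using True \<sigma> m c0 by (auto simp: ennreal_mult[symmetric] intro!: ennreal_leI)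
    next
      case False
      then have "c * (H y * norm y powr (- m/2)) \<le> 0" using c0 by (intro mult_nonneg_nonpos mult_nonpos_nonneg) auto
      then show ?thesis by (simp add: ennreal_neg)
    qed
    finally show "(\<integral>\<^sup>+x. F x y \<partial>lborel) \<le> ennreal (4 / m\<^sup>2) * ennreal (H y)" .
  qed
  also have "\<dots> = ennreal (4 / m\<^sup>2 * ?Q)"
    using Q0 by (subst nn_integral_cmult) (auto simp: Hint ennreal_mult[symmetric])
  finally have fin: "(\<integral>\<^sup>+x. ennreal ((profile g (norm x))\<^sup>2 / (norm (x::real^'n))\<^sup>2) \<partial>lborel) \<le> ennreal (4 / m\<^sup>2 * ?Q)" .
  have pm [measurable]: "(\<lambda>x::real^'n. profile g (norm x)) \<in> borel_measurable borel"
    by (rule profile_norm_measurable[OF n3 gm g2])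
  have meas: "(\<lambda>x::real^'n. (profile g (norm x))\<^sup>2 / (norm x)\<^sup>2) \<in> borel_measurable lborel" by measurable
  have i: "integrable lborel (\<lambda>x::real^'n. (profile g (norm x))\<^sup>2 / (norm x)\<^sup>2)"
    by (rule integrableI_nonneg[OF meas]) (use fin in \<open>auto intro: le_less_trans\<close>)
  then show "integrable lebesgue (\<lambda>x::real^'n. (profile g (norm x))\<^sup>2 / (norm x)\<^sup>2)" 
    by (simp only: integrable_completion[OF meas])
  have "(\<integral>x. (profile g (norm x))\<^sup>2 / (norm (x::real^'n))\<^sup>2 \<partial>lborel) \<le> 4 / m\<^sup>2 * ?Q"
    using fin i Q0 by (simp add: nn_integral_eq_integral)
  then show "(\<integral>x. (profile g (norm x))\<^sup>2 / (norm (x::real^'n))\<^sup>2 \<partial>lebesgue) \<le> 4 / (real CARD('n) - 2)\<^sup>2 * ?Q"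
    unfolding m_def integral_completion[OF meas] .
qed

text \<open>With n = m + 2 the critical exponent 2n/(n-2) equals 2 + 4/m. Spending the decay
  estimate on the surplus power 4/m produces exactly r^(-2), so for radial functions critical
  integrability follows from Hardy's inequality.\<close>

lemma critical_powr_bound:
  assumes m: "(m::real) > 0" and r: "r > 0" and B: "B \<ge> 0" and t: "\<bar>t\<bar> \<le> B * sqrt (r powr (- m))"
  shows "\<bar>t\<bar> powr (2 * (m + 2) / m) \<le> B powr (4 / m) * (t\<^sup>2 / r\<^sup>2)"
proof (cases "t = 0")
  case False
  have "\<bar>t\<bar> powr (2 * (m + 2) / m) = \<bar>t\<bar> powr (4 / m + 2)" using m by (simp add: field_simps)
  also have "\<dots> = \<bar>t\<bar> powr (4 / m) * t\<^sup>2" using False by (simp add: powr_add)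
  also have "\<dots> \<le> (B * sqrt (r powr (- m))) powr (4 / m) * t\<^sup>2"
    using m t by (intro mult_right_mono powr_mono2) auto
  also have "(B * sqrt (r powr (- m))) powr (4 / m) = B powr (4 / m) * (r powr (- m / 2)) powr (4 / m)"
  proof -
    have "sqrt (r powr (- m)) = r powr (- m / 2)" by (simp add: powr_half_sqrt[symmetric] powr_powr)
    then show ?thesis using B by (simp add: powr_mult)
  qed
  also have "(r powr (- m / 2)) powr (4 / m) = 1 / r\<^sup>2"
  proof -
    have "(r powr (- m / 2)) powr (4 / m) = r powr (- 2)" unfolding powr_powr using m by simp
    also have "\<dots> = 1 / r\<^sup>2" using r by (simp add: powr_minus_divide)
    finally show ?thesis .
  qed
  finally show ?thesis by simp
qed simp

section \<open>Truncation\<close>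

lemma C1grad_inner_cutoff:
  assumes "\<alpha> > 0" "k > 0"
  shows "C1grad (\<lambda>x::real^'n. sstep (k * (norm x - \<alpha>))) (\<lambda>x. (k * sstep' (k * (norm x - \<alpha>)) / norm x) *\<^sub>R x)"
proof (rule C1grad_radial[OF assms(1), where c=0])
  show "((\<lambda>r. sstep (k * (r - \<alpha>))) has_real_derivative k * sstep' (k * (r - \<alpha>))) (at r)" for r
    by (rule DERIV_cong[OF DERIV_chain2[OF sstep_has_real_derivative, where Db=k]])
      (auto intro!: derivative_eq_intros)
  show "sstep (k * (r - \<alpha>)) = 0" "k * sstep' (k * (r - \<alpha>)) = 0" if "r < \<alpha>" for r
    using that assms by (auto simp: sstep_eq_0 mult_nonneg_nonpos)
qed (intro continuous_intros)

text \<open>Bounding the density s^(n-1) by its value at \<alpha> + 1 makes the volume linear in the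
  width, which compensates the slope 1/d of a cutoff across the shell.\<close>

lemma shell_measure_bound:
  assumes "\<alpha> > 0" "0 < d" "d \<le> 1"
  shows "integrable lebesgue (\<lambda>x::real^'n. indicator {\<alpha>..\<alpha>+d} (norm x) :: real)"
    and "(\<integral>x. indicator {\<alpha>..\<alpha>+d} (norm (x::real^'n)) \<partial>lebesgue) \<le> sphere_vol TYPE(real^'n) * (\<alpha> + 1) ^ (CARD('n) - 1) * d"
proof -
  let ?p = "\<lambda>r. indicator {\<alpha>..\<alpha>+d} r :: real"
  let ?W = "\<lambda>s. indicator {0..} s * (sphere_vol TYPE(real^'n) * s ^ (DIM(real^'n) - 1)) * ?p s"
  let ?B = "\<lambda>s. sphere_vol TYPE(real^'n) * (\<alpha> + 1) ^ (CARD('n) - 1) * ?p s"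
  have bd: "0 \<le> ?W s" "?W s \<le> ?B s" for s
  proof -
    show "0 \<le> ?W s" using sphere_vol_pos[where 'a="real^'n"] by (auto simp: indicator_def)
    show "?W s \<le> ?B s"
    proof (cases "s \<in> {\<alpha>..\<alpha>+d}")
      case True
      then have "s ^ (CARD('n) - 1) \<le> (\<alpha> + 1) ^ (CARD('n) - 1)" using assms by (intro power_mono) auto
      then show ?thesis using True sphere_vol_pos[where 'a="real^'n"] assms by (auto intro!: mult_left_mono)
    qed simp
  qed
  have pi: "integrable lborel ?p" using assms by (intro integrable_real_indicator) auto
  then have Bi: "integrable lborel ?B" by (intro integrable_mult_right)
  have Wi: "integrable lborel ?W"
    by (rule Bochner_Integration.integrable_bound[OF Bi]) (use bd in \<open>auto intro!: AE_I2 order_trans[OF _ abs_ge_self]\<close>)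
  have m: "(\<lambda>x::real^'n. ?p (norm x)) \<in> borel_measurable lborel" by measurable
  have "integrable lborel (\<lambda>x::real^'n. ?p (norm x))" using Wi by (subst integral_radial(1)) auto
  then show "integrable lebesgue (\<lambda>x::real^'n. ?p (norm x))" using m by (simp add: integrable_completion)
  have "(\<integral>x. ?p (norm (x::real^'n)) \<partial>lebesgue) = (\<integral>x. ?p (norm (x::real^'n)) \<partial>lborel)"
    by (rule integral_completion[OF m])
  also have "\<dots> = (\<integral>s. ?W s \<partial>lborel)" by (rule integral_radial(2)) auto
  also have "\<dots> \<le> (\<integral>s. ?B s \<partial>lborel)" by (rule integral_mono[OF Wi Bi bd(2)])
  also have "\<dots> = sphere_vol TYPE(real^'n) * (\<alpha> + 1) ^ (CARD('n) - 1) * d" using assms by simp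
  finally show "(\<integral>x. ?p (norm (x::real^'n)) \<partial>lebesgue) \<le> sphere_vol TYPE(real^'n) * (\<alpha> + 1) ^ (CARD('n) - 1) * d" .
qed

text \<open>Cutting off at a zero of the profile produces no surface term: the cutoff has slope \<open>k\<close> on a shell
  of width \<open>1/k\<close>, on which the function is small.\<close>

lemma weak_identity_outside_zero:
  fixes u :: "real^'n \<Rightarrow> real"
  assumes wg: "weak_grad u g"
    and cont: "continuous_on {0<..} v" and uv: "AE x in lebesgue. u x = v (norm x)"
    and \<alpha>: "\<alpha> > 0" "v \<alpha> = 0"
    and C: "C1grad \<phi> G" and supp: "\<And>x. norm x > R \<Longrightarrow> \<phi> x = 0"
  shows "(\<integral>x. indicator {\<alpha><..} (norm x) * (u x * G x $ i) \<partial>lebesgue)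
    = - (\<integral>x. indicator {\<alpha><..} (norm x) * (g x $ i * \<phi> x) \<partial>lebesgue)"
proof -
  define K where "K = (\<lambda>k::nat. real (Suc k))"
  define \<eta> where "\<eta> k x = sstep (K k * (norm x - \<alpha>))" for k and x :: "real^'n"
  define d where "d k x = K k * sstep' (K k * (norm x - \<alpha>)) / norm x" for k and x :: "real^'n"
  have Ck: "C1grad (\<eta> k) (\<lambda>x. d k x *\<^sub>R x)" for k
    unfolding \<eta>_def d_def K_def by (rule C1grad_inner_cutoff) (use \<alpha> in auto)
  have Cp: "C1grad (\<lambda>x. \<phi> x * \<eta> k x) (\<lambda>x. \<eta> k x *\<^sub>R G x + \<phi> x *\<^sub>R (d k x *\<^sub>R x))" for k
    by (rule C1grad_mult[OF C Ck])
  have sp: "\<phi> x * \<eta> k x = 0" if "norm x > R" for x k using supp[OF that] by simp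
  note W = weak_gradD[where R=R and i=i, OF wg Cp sp]
  note W0 = weak_gradD[where R=R and i=i, OF wg C supp]
  have \<eta>01: "0 \<le> \<eta> k x" "\<eta> k x \<le> 1" for k x unfolding \<eta>_def by (rule sstep_bounds)+
  have \<eta>m: "\<eta> k \<in> borel_measurable lebesgue" for k
    using borel_measurable_continuous_onI[OF C1gradD(3)[OF Ck[of k]]] by (intro measurable_completion) auto
  have lim: "(\<lambda>k. \<eta> k x) \<longlonglongrightarrow> indicator {\<alpha><..} (norm x)" for x
    using LIMSEQ_Suc[OF sstep_scaled_tendsto[of "norm x - \<alpha>"]] by (simp add: \<eta>_def K_def indicator_def)
  have indm: "(\<lambda>x::real^'n. indicator {\<alpha><..} (norm x) :: real) \<in> borel_measurable lebesgue"
    by (rule indicator_norm_measurable) auto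
  have conv: "(\<lambda>k. \<integral>x. \<eta> k x * h x \<partial>lebesgue) \<longlonglongrightarrow> (\<integral>x. indicator {\<alpha><..} (norm x) * h x \<partial>lebesgue)"
    if h: "integrable lebesgue h" for h :: "real^'n \<Rightarrow> real"
  proof (rule integral_dominated_convergence)
    show "integrable lebesgue (\<lambda>x. norm (h x))" using h by auto
    show "AE x in lebesgue. (\<lambda>k. \<eta> k x * h x) \<longlonglongrightarrow> indicator {\<alpha><..} (norm x) * h x"
      by (auto intro!: tendsto_mult lim)
    show "AE x in lebesgue. norm (\<eta> k x * h x) \<le> norm (h x)" for k
      using \<eta>01[of k] by (auto simp: abs_mult intro!: mult_left_le_one_le)
  qed (use h \<eta>m indm in \<open>auto intro!: borel_measurable_times\<close>)
  have \<eta>h: "integrable lebesgue (\<lambda>x. \<eta> k x * h x)" if h: "integrable lebesgue h" for h :: "real^'n \<Rightarrow> real" and k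
    by (rule Bochner_Integration.integrable_bound[OF h])
      (use h \<eta>m \<eta>01[of k] in \<open>auto simp: abs_mult intro!: mult_left_le_one_le borel_measurable_times\<close>)
  \<comment> \<open>The part in which the derivative falls on the cutoff. It would become the
    surface term on |x| = \<alpha>; the zero of the profile there makes it tend to 0.\<close>
  define M where "M k = (\<integral>x. u x * (\<phi> x * (d k x * x $ i)) \<partial>lebesgue)" for k
  have split: "u x * (\<eta> k x *\<^sub>R G x + \<phi> x *\<^sub>R (d k x *\<^sub>R x)) $ i = \<eta> k x * (u x * G x $ i) + u x * (\<phi> x * (d k x * x $ i))" for k x
    by (simp add: algebra_simps)
  have Mi: "integrable lebesgue (\<lambda>x. u x * (\<phi> x * (d k x * x $ i)))" for k
  proof -
    have "integrable lebesgue (\<lambda>x. (\<eta> k x * (u x * G x $ i) + u x * (\<phi> x * (d k x * x $ i))) - \<eta> k x * (u x * G x $ i))"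
      by (rule Bochner_Integration.integrable_diff[OF W(1)[of k, unfolded split] \<eta>h[OF W0(1)]])
    then show ?thesis by simp
  qed
  have eq: "(\<integral>x. \<eta> k x * (u x * G x $ i) \<partial>lebesgue) + M k = - (\<integral>x. \<eta> k x * (g x $ i * \<phi> x) \<partial>lebesgue)" for k
  proof -
    have "(\<integral>x. \<eta> k x * (u x * G x $ i) \<partial>lebesgue) + M k
        = (\<integral>x. u x * (\<eta> k x *\<^sub>R G x + \<phi> x *\<^sub>R (d k x *\<^sub>R x)) $ i \<partial>lebesgue)"
      unfolding split M_def by (rule Bochner_Integration.integral_add[symmetric, OF \<eta>h[OF W0(1)] Mi])
    also have "\<dots> = - (\<integral>x. g x $ i * (\<phi> x * \<eta> k x) \<partial>lebesgue)" by (rule W(3))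
    also have "(\<integral>x. g x $ i * (\<phi> x * \<eta> k x) \<partial>lebesgue) = (\<integral>x. \<eta> k x * (g x $ i * \<phi> x) \<partial>lebesgue)"
      by (simp add: mult_ac)
    finally show ?thesis .
  qed
  have "M \<longlonglongrightarrow> 0"
  proof (rule LIMSEQ_I)
    fix e :: real assume e: "e > 0"
    obtain B where B: "B > 0" "\<And>x. norm (\<phi> x) \<le> B"
      using bounded_continuous_bounded_support[OF C1gradD(3)[OF C] supp] by metis
    \<comment> \<open>The factors bound \<open>sstep'\<close>, \<phi> and the shell volume per unit
      of width. The slope \<open>K k\<close> cancels the width 1 / \<open>K k\<close>, so the final
      bound is \<epsilon> c = e/2.\<close>
    define c where "c = 2 * B * (sphere_vol TYPE(real^'n) * (\<alpha> + 1) ^ (CARD('n) - 1))"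
    have c: "c > 0" using B \<alpha> sphere_vol_pos[where 'a="real^'n"] by (simp add: c_def)
    define \<epsilon> where "\<epsilon> = e / (2 * c)"
    have \<epsilon>: "\<epsilon> > 0" using e c by (simp add: \<epsilon>_def)
    have "isCont v \<alpha>" using cont \<alpha> by (simp add: continuous_on_eq_continuous_at)
    then obtain \<delta> where \<delta>: "\<delta> > 0" "\<And>r. \<bar>r - \<alpha>\<bar> < \<delta> \<Longrightarrow> \<bar>v r\<bar> < \<epsilon>"
      using \<epsilon> \<alpha>(2) unfolding continuous_at_eps_delta dist_real_def by fastforce
    obtain k0 :: nat where k0: "1 / \<delta> < real k0" using reals_Archimedean2 by blast
    show "\<exists>k0. \<forall>k\<ge>k0. norm (M k - 0) < e"
    proof (intro exI allI impI)
      fix k assume k: "k \<ge> k0"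
      have K1: "K k \<ge> 1" "1 / \<delta> < K k" using k k0 by (auto simp: K_def)
      then have Kd: "0 < 1 / K k" "1 / K k \<le> 1" "1 / K k < \<delta>" using \<delta> by (auto simp: field_simps)
      note S = shell_measure_bound[OF \<alpha>(1) Kd(1,2), where 'n='n]
      let ?I = "\<lambda>x::real^'n. indicator {\<alpha>..\<alpha> + 1 / K k} (norm x) :: real"
      have bd: "AE x in lebesgue. \<bar>u x * (\<phi> x * (d k x * x $ i))\<bar> \<le> (2 * B * \<epsilon> * K k) * ?I x"
        using uv
      proof eventually_elim
        case (elim x)
        show ?case
        proof (cases "norm x \<in> {\<alpha>..\<alpha> + 1 / K k}")
          case True
          then have "\<bar>norm x - \<alpha>\<bar> < \<delta>" using Kd(3) by auto
          then have u: "\<bar>u x\<bar> \<le> \<epsilon>" using \<delta>(2) elim by (simp add: less_imp_le)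
          have nx: "norm x > 0" using True \<alpha> by auto
          have "\<bar>d k x * x $ i\<bar> \<le> K k * 2"
          proof -
            have "\<bar>d k x * x $ i\<bar> = K k * sstep' (K k * (norm x - \<alpha>)) * (\<bar>x $ i\<bar> / norm x)"
              using sstep'_bounds[of "K k * (norm x - \<alpha>)"] K1 nx by (simp add: d_def abs_mult)
            also have "\<dots> \<le> K k * 2 * 1"
              using sstep'_bounds[of "K k * (norm x - \<alpha>)"] K1 nx component_le_norm_cart[of x i]
              by (intro mult_mono) auto
            finally show ?thesis by simp
          qed
          then have "\<bar>u x\<bar> * (\<bar>\<phi> x\<bar> * \<bar>d k x * x $ i\<bar>) \<le> \<epsilon> * (B * (K k * 2))"
            using u B(2)[of x] B(1) \<epsilon> by (intro mult_mono) auto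
          then show ?thesis using True by (simp add: abs_mult mult_ac)
        next
          case False
          have "sstep' (K k * (norm x - \<alpha>)) = 0"
          proof (cases "norm x < \<alpha>")
            case True
            then show ?thesis using K1 by (intro sstep_eq_0) (simp add: mult_nonneg_nonpos)
          next
            case F: False
            then have "norm x > \<alpha> + 1 / K k" using False by simp
            then have "K k * (norm x - \<alpha>) \<ge> 1" using K1 by (simp add: field_simps)
            then show ?thesis by (rule sstep_eq_1)
          qed
          then show ?thesis using False by (simp add: d_def)
        qed
      qed
      have "\<bar>M k\<bar> \<le> (\<integral>x. \<bar>u x * (\<phi> x * (d k x * x $ i))\<bar> \<partial>lebesgue)" unfolding M_def by (rule integral_abs_bound)
      also have "\<dots> \<le> (\<integral>x. (2 * B * \<epsilon> * K k) * ?I x \<partial>lebesgue)"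
        by (rule integral_mono_AE) (use Mi[of k] S(1) bd in auto)
      also have "\<dots> = (2 * B * \<epsilon> * K k) * (\<integral>x. ?I x \<partial>lebesgue)" by simp
      also have "\<dots> \<le> (2 * B * \<epsilon> * K k) * (sphere_vol TYPE(real^'n) * (\<alpha> + 1) ^ (CARD('n) - 1) * (1 / K k))"
        using B(1) \<epsilon> K1 by (intro mult_left_mono S(2)) auto
      also have "\<dots> = \<epsilon> * c" using K1 by (simp add: c_def)
      also have "\<dots> < e" using e c by (simp add: \<epsilon>_def)
      finally show "norm (M k - 0) < e" by simp
    qed
  qed
  with conv[OF W0(1)] have l1: "(\<lambda>k. (\<integral>x. \<eta> k x * (u x * G x $ i) \<partial>lebesgue) + M k) \<longlonglongrightarrow>
     (\<integral>x. indicator {\<alpha><..} (norm x) * (u x * G x $ i) \<partial>lebesgue) + 0" by (intro tendsto_add)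
  have l2: "(\<lambda>k. - (\<integral>x. \<eta> k x * (g x $ i * \<phi> x) \<partial>lebesgue)) \<longlonglongrightarrow> - (\<integral>x. indicator {\<alpha><..} (norm x) * (g x $ i * \<phi> x) \<partial>lebesgue)"
    by (intro tendsto_minus conv[OF W0(2)])
  show ?thesis using LIMSEQ_unique[OF l1[unfolded eq] l2] by simp
qed

section \<open>The positive part of a radial function\<close>

lemma open_positive_set:
  fixes v :: "real \<Rightarrow> real"
  assumes "continuous_on {0<..} v"
  shows "open {r. r > 0 \<and> v r > 0}"
proof -
  have "open ({0<..} \<inter> v -` {0<..})" using assms by (intro continuous_open_preimage) auto
  moreover have "{0<..} \<inter> v -` {0<..} = {r. r > 0 \<and> v r > 0}" by auto
  ultimately show ?thesis by simp
qed

text \<open>An open subset of \<open>(0,\<infinity>)\<close> is a countable disjoint union of intervals;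
  on each of them the cutoff lemma applies at both ends.\<close>

lemma positive_component_cases:
  fixes v :: "real \<Rightarrow> real"
  assumes cont: "continuous_on {0<..} v" and C: "C \<in> components {r. r > 0 \<and> v r > 0}"
  obtains \<alpha> where "C = {\<alpha><..}" "\<alpha> = 0 \<or> \<alpha> > 0 \<and> v \<alpha> = 0"
    | \<alpha> \<beta> where "C = {\<alpha><..<\<beta>}" "\<alpha> < \<beta>" "\<alpha> = 0 \<or> \<alpha> > 0 \<and> v \<alpha> = 0" "\<beta> > 0" "v \<beta> = 0"
proof -
  let ?O = "{r. r > 0 \<and> v r > 0}"
  have o: "open ?O" by (rule open_positive_set[OF cont])
  have oC: "open C" using C o open_components by blast
  have CO: "C \<subseteq> ?O" using C in_components_subset by blast
  have ne: "C \<noteq> {}" using C in_components_nonempty by blast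
  have iv: "is_interval C" using C in_components_connected is_interval_connected_1 by blast
  have bb: "bdd_below C" using CO by (intro bdd_belowI[of _ 0]) auto
  define \<alpha> where "\<alpha> = Inf C"
  have \<alpha>0: "\<alpha> \<ge> 0" unfolding \<alpha>_def using CO ne by (intro cInf_greatest) auto
  have lb: "\<alpha> < r" if r: "r \<in> C" for r
  proof -
    obtain e where "e > 0" "ball r e \<subseteq> C" using oC r open_contains_ball by blast
    then have "r - e/2 \<in> C" by (auto simp: dist_real_def subset_eq)
    then have "\<alpha> \<le> r - e/2" unfolding \<alpha>_def using bb by (intro cInf_lower)
    then show ?thesis using \<open>e > 0\<close> by linarith
  qed
  have near: "\<exists>s\<in>C. s < r" if "r > \<alpha>" for r using that ne bb unfolding \<alpha>_def by (simp add: cInf_less_iff)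
  \<comment> \<open>An accumulation point of the component outside it cannot lie in the positivity
    set, because adding it would give a larger connected subset. By continuity v is nonnegative
    there, hence zero.\<close>
  have closing: "v s = 0" if s: "s > 0" "s \<notin> C" and acc: "\<And>e. e > 0 \<Longrightarrow> \<exists>t\<in>C. \<bar>t - s\<bar> < e" for s
  proof -
    have cl: "s \<in> closure C" using acc by (auto simp: closure_approachable dist_real_def)
    have sO: "s \<notin> ?O"
    proof
      assume "s \<in> ?O"
      have "connected (insert s C)"
        by (rule connected_intermediate_closure[of C]) (use C in_components_connected cl closure_subset in auto)
      then have "insert s C \<subseteq> C"
        using C CO \<open>s \<in> ?O\<close> ne by (intro components_maximal[OF C]) auto
      then show False using s by blast
    qed
    have cs: "isCont v s" using cont s by (simp add: continuous_on_eq_continuous_at)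
    have "v s \<ge> 0"
    proof (rule ccontr)
      assume n: "\<not> v s \<ge> 0"
      then obtain e where "e > 0" "\<forall>t. \<bar>t - s\<bar> < e \<longrightarrow> \<bar>v t - v s\<bar> < - v s"
        using cs[unfolded continuous_at_eps_delta dist_real_def, rule_format, of "- v s"] by auto
      then obtain t where "t \<in> C" "\<bar>v t - v s\<bar> < - v s" using acc by blast
      then show False using CO by fastforce
    qed
    then show ?thesis using sO s by auto
  qed
  have \<alpha>C: "\<alpha> \<notin> C" using lb by blast
  have \<alpha>v: "\<alpha> = 0 \<or> \<alpha> > 0 \<and> v \<alpha> = 0"
  proof (cases "\<alpha> = 0")
    case False
    then have a: "\<alpha> > 0" using \<alpha>0 by simp
    have "v \<alpha> = 0"
    proof (rule closing[OF a \<alpha>C])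
      fix e :: real assume "e > 0"
      then obtain s where "s \<in> C" "s < \<alpha> + e" using near[of "\<alpha> + e"] by auto
      then show "\<exists>t\<in>C. \<bar>t - \<alpha>\<bar> < e" using lb[of s] by (intro bexI[of _ s]) auto
    qed
    then show ?thesis using a by simp
  qed simp
  show ?thesis
  proof (cases "bdd_above C")
    case False
    have "r \<in> C" if ra: "r > \<alpha>" for r
    proof -
      obtain s where s: "s \<in> C" "s < r" using near[OF ra] by blast
      obtain t where t: "t \<in> C" "t > r" using False by (auto simp: bdd_above_def not_le)
      show ?thesis using iv s t unfolding is_interval_1 by (meson less_imp_le)
    qed
    then have "C = {\<alpha><..}" using lb by auto
    then show ?thesis using that(1) \<alpha>v by blast
  next
    case True
    define \<beta> where "\<beta> = Sup C"
    have ub: "r < \<beta>" if r: "r \<in> C" for r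
    proof -
      obtain e where "e > 0" "ball r e \<subseteq> C" using oC r open_contains_ball by blast
      then have "r + e/2 \<in> C" by (auto simp: dist_real_def subset_eq)
      then have "r + e/2 \<le> \<beta>" unfolding \<beta>_def using True by (intro cSup_upper)
      then show ?thesis using \<open>e > 0\<close> by linarith
    qed
    have near': "\<exists>s\<in>C. s > r" if "r < \<beta>" for r using that ne True unfolding \<beta>_def by (simp add: less_cSup_iff)
    have "r \<in> C" if ra: "\<alpha> < r" and rb: "r < \<beta>" for r
    proof -
      obtain s where s: "s \<in> C" "s < r" using near[OF ra] by blast
      obtain t where t: "t \<in> C" "t > r" using near'[OF rb] by blast
      show ?thesis using iv s t unfolding is_interval_1 by (meson less_imp_le)
    qed
    then have Ceq: "C = {\<alpha><..<\<beta>}" using lb ub by auto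
    then have ab: "\<alpha> < \<beta>" using ne by auto
    have "v \<beta> = 0"
    proof (rule closing)
      show "\<beta> > 0" using ab \<alpha>0 by simp
      show "\<beta> \<notin> C" using ub by blast
      fix e :: real assume "e > 0"
      then obtain s where "s \<in> C" "s > \<beta> - e" using near'[of "\<beta> - e"] by auto
      then show "\<exists>t\<in>C. \<bar>t - \<beta>\<bar> < e" using ub[of s] by (intro bexI[of _ s]) auto
    qed
    then show ?thesis using that(2) Ceq ab \<alpha>v \<alpha>0 by auto
  qed
qed

text \<open>The integrand \<open>?h\<close> of the weak identity has integral 0 outside every ball
  bounded by a zero of v. A bounded component is, up to a sphere, a difference of two such
  exteriors; countable additivity then gives integral 0 over the whole positivity set.\<close>

theorem weak_grad_positive_part:
  fixes u :: "real^'n \<Rightarrow> real"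
  assumes um: "u \<in> borel_measurable lebesgue" and wg: "weak_grad u g"
    and cont: "continuous_on {0<..} v" and uv: "AE x in lebesgue. u x = v (norm x)"
  shows "weak_grad (\<lambda>x. max 0 (u x)) (\<lambda>x. indicator {r. r > 0 \<and> v r > 0} (norm x) *\<^sub>R g x)"
proof -
  let ?O = "{r. r > 0 \<and> v r > 0}"
  have o: "open ?O" by (rule open_positive_set[OF cont])
  have gm: "g \<in> borel_measurable lebesgue" using wg by (simp add: weak_grad_def)
  have indm: "(\<lambda>x::real^'n. indicator A (norm x) :: real) \<in> borel_measurable lebesgue" if "open A" for A
    using that by (intro indicator_norm_measurable) auto
  have x0: "AE x::real^'n in lebesgue. norm x \<noteq> r" for r by (rule AE_norm_neq)
  show ?thesis
  proof (rule weak_gradI)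
    show "(\<lambda>x. indicator ?O (norm x) *\<^sub>R g x) \<in> borel_measurable lebesgue"
      by (intro borel_measurable_scaleR indm[OF o] gm)
  next
    fix i :: 'n and \<phi> :: "real^'n \<Rightarrow> real" and G R
    assume C: "C1grad \<phi> G" and "R > 0" and supp: "\<And>x. norm x > R \<Longrightarrow> \<phi> x = 0"
    note W0 = weak_gradD[where R=R and i=i, OF wg C supp]
    let ?h = "\<lambda>x. u x * G x $ i + g x $ i * \<phi> x"
    have h: "integrable lebesgue ?h" using W0 by simp
    have hA: "integrable lebesgue (\<lambda>x. indicator A (norm x) * f x)"
      if "open A" "integrable lebesgue f" for A and f :: "real^'n \<Rightarrow> real"
      by (rule Bochner_Integration.integrable_bound[OF that(2)])
        (use indm[OF that(1)] that in \<open>auto intro!: borel_measurable_times simp: indicator_def\<close>)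
    have comb: "(\<integral>x. indicator A (norm x) * ?h x \<partial>lebesgue) =
        (\<integral>x. indicator A (norm x) * (u x * G x $ i) \<partial>lebesgue) + (\<integral>x. indicator A (norm x) * (g x $ i * \<phi> x) \<partial>lebesgue)"
      if "open A" for A
      using hA[OF that W0(1)] hA[OF that W0(2)] by (simp add: distrib_left)
    \<comment> \<open>For \<alpha> = 0 there is no cut: the exterior is the whole space up to a null
      set, and the claim is the weak identity itself.\<close>
    have L: "(\<integral>x. indicator {\<alpha><..} (norm x) * ?h x \<partial>lebesgue) = 0" if "\<alpha> = 0 \<or> \<alpha> > 0 \<and> v \<alpha> = 0" for \<alpha>
      using that
    proof
      assume \<alpha>: "\<alpha> = 0"
      have "(\<integral>x. indicator {\<alpha><..} (norm x) * ?h x \<partial>lebesgue) = (\<integral>x. ?h x \<partial>lebesgue)"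
      proof (rule integral_cong_AE)
        show "AE x in lebesgue. indicator {\<alpha><..} (norm x) * ?h x = ?h x"
          using x0[of 0] by eventually_elim (simp add: \<alpha>)
      qed (use h hA[OF open_greaterThan h] in auto)
      also have "\<dots> = 0" using W0 by simp
      finally show ?thesis .
    next
      assume "\<alpha> > 0 \<and> v \<alpha> = 0"
      then show ?thesis
        using weak_identity_outside_zero[OF wg cont uv _ _ C supp, of \<alpha>, where i=i] by (simp add: comb)
    qed
    have comp: "(\<integral>x. indicator C (norm x) * ?h x \<partial>lebesgue) = 0" if "C \<in> components ?O" for C
      using cont that
    proof (cases rule: positive_component_cases)
      case (1 \<alpha>)
      then show ?thesis using L by simp
    next
      case (2 \<alpha> \<beta>)
      have "(\<integral>x. indicator C (norm x) * ?h x \<partial>lebesgue) =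
          (\<integral>x. indicator {\<alpha><..} (norm x) * ?h x - indicator {\<beta><..} (norm x) * ?h x \<partial>lebesgue)"
      proof (rule integral_cong_AE)
        show "AE x in lebesgue. indicator C (norm x) * ?h x = indicator {\<alpha><..} (norm x) * ?h x - indicator {\<beta><..} (norm x) * ?h x"
          using x0[of \<beta>] by eventually_elim (use 2 in \<open>auto simp: indicator_def\<close>)
      qed (use hA[OF _ h] 2 in auto)
      also have "\<dots> = 0" using L[of \<alpha>] L[of \<beta>] 2 hA[OF open_greaterThan h] by simp
      finally show ?thesis .
    qed
    have cnt: "countable (components ?O)"
    proof (rule countable_disjoint_open_subsets)
      show "open C" if "C \<in> components ?O" for C using that o open_components by blast
      show "pairwise disjnt (components ?O)"
        using pairwise_disjoint_components[of ?O] by (simp add: pairwise_def disjnt_def)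
    qed
    \<comment> \<open>An enumeration of the components by natural numbers; indices without a
      component give the empty set, so finite and infinite families are treated alike.\<close>
    define A where "A n = \<Union>{C \<in> components ?O. to_nat_on (components ?O) C = n}" for n
    have A: "A n = {} \<or> A n \<in> components ?O" for n
    proof (cases "\<exists>C\<in>components ?O. to_nat_on (components ?O) C = n")
      case True
      then obtain C where C: "C \<in> components ?O" "to_nat_on (components ?O) C = n" by blast
      then have "{C \<in> components ?O. to_nat_on (components ?O) C = n} = {C}"
        using cnt by auto
      then show ?thesis using C by (simp add: A_def)
    qed (auto simp: A_def)
    have Aopen: "open (A n)" for n using A[of n] o open_components by auto
    have AU: "(\<Union>n. A n) = ?O"
    proof -
      have "(\<Union>n. A n) = \<Union>(components ?O)" unfolding A_def by blast
      then show ?thesis using Union_components[of ?O] by simp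
    qed
    have Adisj: "A m \<inter> A n = {}" if "m \<noteq> n" for m n
    proof -
      have "C = D \<or> C \<inter> D = {}" if "C \<in> components ?O" "D \<in> components ?O" for C D
        using that components_nonoverlap by blast
      then show ?thesis using that unfolding A_def by blast
    qed
    have z: "(\<integral>x. indicator (A n) (norm x) * ?h x \<partial>lebesgue) = 0" for n
      using A[of n] comp by auto
    let ?B = "\<lambda>n. {x::real^'n. norm x \<in> A n}"
    have Bm: "?B n \<in> sets lebesgue" for n
    proof -
      have "norm -` A n \<inter> space lborel \<in> sets (lborel :: (real^'n) measure)"
        by (rule measurable_sets[of _ _ borel]) (use Aopen in auto)
      then show ?thesis by (auto simp: vimage_def)
    qed
    have iB: "indicator (?B n) x = (indicator (A n) (norm x) :: real)" for n x by (simp add: indicator_def)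
    have UB: "(\<Union>n. ?B n) = {x. norm x \<in> ?O}" using AU by blast
    have iO: "indicator (\<Union>n. ?B n) x = (indicator ?O (norm x) :: real)" for x unfolding UB by (simp add: indicator_def)
    have "(\<integral>x\<in>(\<Union>n. ?B n). ?h x \<partial>lebesgue) = (\<Sum>n. (\<integral>x\<in>?B n. ?h x \<partial>lebesgue))"
    proof (rule lebesgue_integral_countable_add)
      show "?B m \<inter> ?B n = {}" if "m \<noteq> n" for m n using Adisj[OF that] by blast
      show "set_integrable lebesgue (\<Union>n. ?B n) ?h"
        unfolding set_integrable_def iO real_scaleR_def by (rule hA[OF o h])
    qed (rule Bm)
    then have "(\<integral>x. indicator ?O (norm x) * ?h x \<partial>lebesgue) = 0"
      unfolding set_lebesgue_integral_def iO iB real_scaleR_def z by simp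
    then have fin: "(\<integral>x. indicator ?O (norm x) * (u x * G x $ i) \<partial>lebesgue) = - (\<integral>x. indicator ?O (norm x) * (g x $ i * \<phi> x) \<partial>lebesgue)"
      unfolding comb[OF o] by linarith
    have Gm: "(\<lambda>x. G x $ i) \<in> borel_measurable lebesgue"
      using C1gradD(2)[OF C] by (intro measurable_completion) (auto intro!: borel_measurable_continuous_onI continuous_intros)
    have pm: "(\<lambda>x. max 0 (u x) * G x $ i) \<in> borel_measurable lebesgue"
      using um Gm by (intro borel_measurable_times borel_measurable_max) auto
    have ae: "AE x in lebesgue. max 0 (u x) * G x $ i = indicator ?O (norm x) * (u x * G x $ i)"
      using uv x0[of 0] by eventually_elim (auto simp: indicator_def max_def)
    have i1: "integrable lebesgue (\<lambda>x. max 0 (u x) * G x $ i)"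
      using hA[OF o W0(1)] integrable_cong_AE[OF pm _ ae] by auto
    have e1: "(\<integral>x. max 0 (u x) * G x $ i \<partial>lebesgue) = (\<integral>x. indicator ?O (norm x) * (u x * G x $ i) \<partial>lebesgue)"
      by (rule integral_cong_AE[OF pm _ ae]) (use hA[OF o W0(1)] in auto)
    show "integrable lebesgue (\<lambda>x. max 0 (u x) * G x $ i) \<and>
       integrable lebesgue (\<lambda>x. (indicator ?O (norm x) *\<^sub>R g x) $ i * \<phi> x) \<and>
       (\<integral>x. max 0 (u x) * G x $ i \<partial>lebesgue) = - (\<integral>x. (indicator ?O (norm x) *\<^sub>R g x) $ i * \<phi> x \<partial>lebesgue)"
      using i1 hA[OF o W0(2)] fin e1 by (simp add: mult.assoc)
  qed
qed

section \<open>The energy functional\<close>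

lemma weak_grad_add_scaled:
  fixes u h :: "real^'n \<Rightarrow> real"
  assumes u: "weak_grad u g" and h: "weak_grad h k"
  shows "weak_grad (\<lambda>x. u x + c * h x) (\<lambda>x. g x + c *\<^sub>R k x)"
proof (rule weak_gradI)
  show "(\<lambda>x. g x + c *\<^sub>R k x) \<in> borel_measurable lebesgue"
    using u h by (auto simp: weak_grad_def)
next
  fix i :: 'n and \<phi> :: "real^'n \<Rightarrow> real" and G R
  assume C: "C1grad \<phi> G" and "R > 0" and s: "\<And>x. norm x > R \<Longrightarrow> \<phi> x = 0"
  note U = weak_gradD[where R=R and i=i, OF u C s] and H = weak_gradD[where R=R and i=i, OF h C s]
  have 1: "(\<lambda>x. (u x + c * h x) * G x $ i) = (\<lambda>x. u x * G x $ i + c * (h x * G x $ i))"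
    by (auto simp: algebra_simps)
  have 2: "(\<lambda>x. (g x + c *\<^sub>R k x) $ i * \<phi> x) = (\<lambda>x. g x $ i * \<phi> x + c * (k x $ i * \<phi> x))"
    by (auto simp: algebra_simps)
  show "integrable lebesgue (\<lambda>x. (u x + c * h x) * G x $ i) \<and>
      integrable lebesgue (\<lambda>x. (g x + c *\<^sub>R k x) $ i * \<phi> x) \<and>
      (\<integral>x. (u x + c * h x) * G x $ i \<partial>lebesgue) = - (\<integral>x. (g x + c *\<^sub>R k x) $ i * \<phi> x \<partial>lebesgue)"
    unfolding 1 2 using U H by simp
qed

lemma radial_add_scaled: "radial u \<Longrightarrow> radial h \<Longrightarrow> radial (\<lambda>x. u x + c * h x)"
  unfolding radial_def
proof (elim exE)
  fix v w assume "AE x in lebesgue. u x = v (norm x)" "AE x in lebesgue. h x = w (norm x)"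
  then have "AE x in lebesgue. u x + c * h x = (\<lambda>r. v r + c * w r) (norm x)" by eventually_elim simp
  then show "\<exists>v. AE x in lebesgue. u x + c * h x = v (norm x)" by (rule exI[of _ "\<lambda>r. v r + c * w r"])
qed

lemma abs_add_powr_le:
  fixes a b p :: real
  assumes "p \<ge> 0"
  shows "\<bar>a + b\<bar> powr p \<le> 2 powr p * (\<bar>a\<bar> powr p + \<bar>b\<bar> powr p)"
proof -
  have "\<bar>a + b\<bar> powr p \<le> (2 * max \<bar>a\<bar> \<bar>b\<bar>) powr p" by (rule powr_mono2[OF assms]) auto
  also have "\<dots> = 2 powr p * max \<bar>a\<bar> \<bar>b\<bar> powr p" by (simp add: powr_mult)
  also have "\<dots> \<le> 2 powr p * (\<bar>a\<bar> powr p + \<bar>b\<bar> powr p)"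
    by (intro mult_left_mono) (auto simp: max_def)
  finally show ?thesis .
qed

lemma norm_add_square_le: "(norm (a + b))\<^sup>2 \<le> 2 * (norm a)\<^sup>2 + 2 * (norm (b::'a::real_inner))\<^sup>2"
  using sum_squares_bound[of "norm a" "norm b"] power_mono[OF norm_triangle_ineq[of a b], of 2]
  by (simp add: power2_sum)

lemma L2_integrable_add:
  fixes g h :: "'b \<Rightarrow> 'a::euclidean_space"
  assumes "g \<in> borel_measurable M" "h \<in> borel_measurable M"
    and "integrable M (\<lambda>x. (norm (g x))\<^sup>2)" "integrable M (\<lambda>x. (norm (h x))\<^sup>2)"
  shows "integrable M (\<lambda>x. (norm (g x + h x))\<^sup>2)"
proof (rule Bochner_Integration.integrable_bound)
  show "integrable M (\<lambda>x. 2 * (norm (g x))\<^sup>2 + 2 * (norm (h x))\<^sup>2)" using assms by auto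
  show "AE x in M. norm ((norm (g x + h x))\<^sup>2) \<le> norm (2 * (norm (g x))\<^sup>2 + 2 * (norm (h x))\<^sup>2)"
    using norm_add_square_le by auto
qed (use assms in auto)

lemma L2_integrable_diff:
  fixes g h :: "'b \<Rightarrow> 'a::euclidean_space"
  assumes "g \<in> borel_measurable M" "h \<in> borel_measurable M"
    and "integrable M (\<lambda>x. (norm (g x))\<^sup>2)" "integrable M (\<lambda>x. (norm (h x))\<^sup>2)"
  shows "integrable M (\<lambda>x. (norm (g x - h x))\<^sup>2)"
  using L2_integrable_add[of g M "\<lambda>x. - h x"] assms by auto

lemma D12_add_scaled:
  fixes u h :: "real^'n \<Rightarrow> real"
  assumes n3: "CARD('n) \<ge> 3" and u: "D12 u" and h: "D12 h"
  shows "D12 (\<lambda>x. u x + c * h x)"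
proof -
  let ?p = "2 * real CARD('n) / (real CARD('n) - 2)"
  have p: "?p \<ge> 0" using n3 by simp
  have um: "u \<in> borel_measurable lebesgue" "integrable lebesgue (\<lambda>x. \<bar>u x\<bar> powr ?p)"
    and hm: "h \<in> borel_measurable lebesgue" "integrable lebesgue (\<lambda>x. \<bar>h x\<bar> powr ?p)"
    using u h by (auto simp: D12_def)
  obtain g where g: "weak_grad u g" "integrable lebesgue (\<lambda>x. (norm (g x))\<^sup>2)" using u by (auto simp: D12_def)
  obtain k where k: "weak_grad h k" "integrable lebesgue (\<lambda>x. (norm (k x))\<^sup>2)" using h by (auto simp: D12_def)
  have gm: "g \<in> borel_measurable lebesgue" "k \<in> borel_measurable lebesgue" using g k by (auto simp: weak_grad_def)
  have 1: "integrable lebesgue (\<lambda>x. \<bar>u x + c * h x\<bar> powr ?p)"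
  proof (rule Bochner_Integration.integrable_bound)
    show "integrable lebesgue (\<lambda>x. 2 powr ?p * (\<bar>u x\<bar> powr ?p + \<bar>c\<bar> powr ?p * \<bar>h x\<bar> powr ?p))"
      using um hm by (intro integrable_mult_right Bochner_Integration.integrable_add) auto
    show "AE x in lebesgue. norm (\<bar>u x + c * h x\<bar> powr ?p) \<le> norm (2 powr ?p * (\<bar>u x\<bar> powr ?p + \<bar>c\<bar> powr ?p * \<bar>h x\<bar> powr ?p))"
    proof (rule AE_I2)
      fix x
      have "\<bar>u x + c * h x\<bar> powr ?p \<le> 2 powr ?p * (\<bar>u x\<bar> powr ?p + \<bar>c * h x\<bar> powr ?p)" by (rule abs_add_powr_le[OF p])
      also have "\<bar>c * h x\<bar> powr ?p = \<bar>c\<bar> powr ?p * \<bar>h x\<bar> powr ?p" by (simp add: abs_mult powr_mult)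
      finally show "norm (\<bar>u x + c * h x\<bar> powr ?p) \<le> norm (2 powr ?p * (\<bar>u x\<bar> powr ?p + \<bar>c\<bar> powr ?p * \<bar>h x\<bar> powr ?p))" by simp
    qed
  qed (use um hm in auto)
  have 2: "integrable lebesgue (\<lambda>x. (norm (g x + c *\<^sub>R k x))\<^sup>2)"
    by (rule L2_integrable_add) (use g k gm in \<open>auto simp: power_mult_distrib\<close>)
  show ?thesis unfolding D12_def
    using 1 2 weak_grad_add_scaled[OF g(1) k(1), of c] um hm by auto
qed

lemma Fatou_integrable:
  fixes f :: "nat \<Rightarrow> 'a \<Rightarrow> real"
  assumes f: "\<And>k. integrable M (f k)" "\<And>k. AE x in M. 0 \<le> f k x" "\<And>k. (\<integral>x. f k x \<partial>M) \<le> A"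
    and lim: "AE x in M. (\<lambda>k. f k x) \<longlonglongrightarrow> F x" and F: "F \<in> borel_measurable M"
  shows "integrable M F" "(\<integral>x. F x \<partial>M) \<le> A"
proof -
  have "0 \<le> (\<integral>x. f 0 x \<partial>M)" by (rule integral_nonneg_AE[OF f(2)])
  then have A: "A \<ge> 0" using f(3)[of 0] by linarith
  have nn: "AE x in M. \<forall>k. 0 \<le> f k x" using f(2) by (simp add: AE_all_countable)
  have F0: "AE x in M. 0 \<le> F x"
    using nn lim by eventually_elim (auto intro: LIMSEQ_le_const)
  have "(\<integral>\<^sup>+x. ennreal (F x) \<partial>M) = (\<integral>\<^sup>+x. liminf (\<lambda>k. ennreal (f k x)) \<partial>M)"
  proof (rule nn_integral_cong_AE)
    show "AE x in M. ennreal (F x) = liminf (\<lambda>k. ennreal (f k x))"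
      using lim by eventually_elim (auto intro!: lim_imp_Liminf[symmetric] tendsto_ennrealI)
  qed
  also have "\<dots> \<le> liminf (\<lambda>k. \<integral>\<^sup>+x. ennreal (f k x) \<partial>M)"
    using f(1) by (intro nn_integral_liminf) auto
  also have "\<dots> \<le> ennreal A"
  proof -
    have "(\<integral>\<^sup>+x. ennreal (f k x) \<partial>M) \<le> ennreal A" for k
      using f by (subst nn_integral_eq_integral) (auto intro: ennreal_leI)
    then have "limsup (\<lambda>k. \<integral>\<^sup>+x. ennreal (f k x) \<partial>M) \<le> ennreal A" by (intro Limsup_bounded) auto
    then show ?thesis using Liminf_le_Limsup[of sequentially "\<lambda>k. \<integral>\<^sup>+x. ennreal (f k x) \<partial>M"] by auto
  qed
  finally have le: "(\<integral>\<^sup>+x. ennreal (F x) \<partial>M) \<le> ennreal A" .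
  show 1: "integrable M F"
    by (rule integrableI_nonneg[OF F F0]) (use le in \<open>auto intro: le_less_trans\<close>)
  then show "(\<integral>x. F x \<partial>M) \<le> A"
    using le A F0 by (simp add: nn_integral_eq_integral)
qed

text \<open>For t < 0 the interval of integration is empty and \<open>Fprim f\<close> is 0. The
  condition \<open>f 0 = 0\<close> makes \<open>f (max 0 t)\<close> a continuous extension of f by
  0, and \<open>Fprim f\<close> is differentiable on the whole line with this derivative.\<close>

lemma Fprim_has_derivative:
  assumes f: "continuous_on UNIV f" and f0: "f 0 = 0"
  shows "(Fprim f has_real_derivative f (max 0 t)) (at t)"
proof -
  define h where "h s = f (max 0 s)" for s
  have hc: "continuous_on A h" for A unfolding h_def
    by (rule continuous_on_compose2[OF f]) (auto intro!: continuous_intros)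
  \<comment> \<open>A base point to the left of both 0 and t: near t, integrals of the truncated
    function from c agree with \<open>Fprim f\<close>, and t is interior to the interval.\<close>
  define c where "c = min t 0 - 1"
  have eq: "integral {c..s} h = Fprim f s" if "s > c" for s
  proof (cases "s \<ge> 0")
    case True
    have "integral {c..0} h + integral {0..s} h = integral {c..s} h"
      using True by (intro Henstock_Kurzweil_Integration.integral_combine integrable_continuous_real hc) (auto simp: c_def)
    moreover have "integral {c..0} h = integral {c..0} (\<lambda>_. 0)"
      by (rule integral_cong) (auto simp: h_def f0)
    moreover have "integral {0..s} h = integral {0..s} f" by (rule integral_cong) (auto simp: h_def)
    ultimately show ?thesis by (simp add: Fprim_def)
  next
    case False
    have "integral {c..s} h = integral {c..s} (\<lambda>_. 0)"
      by (rule integral_cong) (use False in \<open>auto simp: h_def f0\<close>)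
    then show ?thesis using False by (simp add: Fprim_def)
  qed
  have ct: "c < t" by (simp add: c_def)
  have "((\<lambda>s. integral {c..s} h) has_real_derivative h t) (at t within {c..t+1})"
    by (rule integral_has_real_derivative[OF hc]) (use ct in auto)
  moreover have "at t within {c..t+1} = at t" by (rule at_within_interior) (use ct in auto)
  ultimately have "((\<lambda>s. integral {c..s} h) has_real_derivative h t) (at t)" by simp
  then show ?thesis
    unfolding h_def[of t, symmetric]
    by (rule has_field_derivative_transform_within_open[of _ _ _ "{c<..}"]) (use ct eq in auto)
qed

lemma Fprim_nonpos: "t \<le> 0 \<Longrightarrow> Fprim f t = 0"
  by (cases "t = 0") (auto simp: Fprim_def)

text \<open>The exponents enter the variational argument only through \<open>weights\<close>, where
  t B(t) bounds both |F(t)| and, by monotonicity of \<open>B\<close>, the terms f(u) h. Arbitrarily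
  small e is what gives coercivity of the energy and continuity of \<open>J\<close>.\<close>

locale sublinear_problem =
  fixes V K f B :: "real \<Rightarrow> real" and w :: "real^'n \<Rightarrow> real"
  assumes n3: "CARD('n) \<ge> 3"
    and V_cont: "continuous_on {0<..} V" and V_nonneg: "\<And>r. r > 0 \<Longrightarrow> V r \<ge> 0"
    and K_cont: "continuous_on {0<..} K" and K_nonneg: "\<And>r. r > 0 \<Longrightarrow> K r \<ge> 0"
    and f_cont: "continuous_on UNIV f" and f0: "f 0 = 0"
    and f_growth: "\<And>t. t \<ge> 0 \<Longrightarrow> \<bar>f t\<bar> \<le> B t"
    and B_mono: "\<And>s t. 0 \<le> s \<Longrightarrow> s \<le> t \<Longrightarrow> B s \<le> B t"
    and w_int: "integrable lebesgue w" and w_nonneg: "\<And>x. w x \<ge> 0"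
    and weights: "\<And>e. e > 0 \<Longrightarrow> \<exists>C\<ge>0. \<forall>x t. x \<noteq> 0 \<longrightarrow> t \<ge> 0 \<longrightarrow>
      K (norm x) * (t * B t) \<le> e * ((V (norm x) + 1 / (norm x)\<^sup>2) * t\<^sup>2) + C * w x"
begin

definition W :: "real^'n \<Rightarrow> real" where "W x = V (norm x) + 1 / (norm x)\<^sup>2"

text \<open>\<open>D12\<close> hides the gradient behind an existential quantifier; admissible pairs
  carry a chosen square-integrable one.\<close>

definition adm :: "(real^'n \<Rightarrow> real) \<Rightarrow> (real^'n \<Rightarrow> real^'n) \<Rightarrow> bool" where
  "adm u g \<longleftrightarrow> H1Vr V u \<and> weak_grad u g \<and> integrable lebesgue (\<lambda>x. (norm (g x))\<^sup>2)"

definition Q :: "(real^'n \<Rightarrow> real) \<Rightarrow> (real^'n \<Rightarrow> real^'n) \<Rightarrow> real" where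
  "Q u g = (\<integral>x. (norm (g x))\<^sup>2 \<partial>lebesgue) + (\<integral>x. V (norm x) * (u x)\<^sup>2 \<partial>lebesgue)"

definition J :: "(real^'n \<Rightarrow> real) \<Rightarrow> real" where
  "J u = (\<integral>x. K (norm x) * Fprim f (u x) \<partial>lebesgue)"

definition energy :: "(real^'n \<Rightarrow> real) \<Rightarrow> (real^'n \<Rightarrow> real^'n) \<Rightarrow> real" where
  "energy u g = Q u g / 2 - J u"

lemma AE_nonzero: "AE x::real^'n in lebesgue. x \<noteq> 0"
  using AE_norm_neq[of 0] by simp

lemma V_meas: "(\<lambda>x::real^'n. V (norm x)) \<in> borel_measurable lebesgue"
  using radial_weight_measurable[OF V_cont] by (intro measurable_completion) auto

lemma K_meas: "(\<lambda>x::real^'n. K (norm x)) \<in> borel_measurable lebesgue"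
  using radial_weight_measurable[OF K_cont] by (intro measurable_completion) auto

lemma norm_meas: "(\<lambda>x::real^'n. norm x) \<in> borel_measurable lebesgue"
  by (intro measurable_completion) auto

lemma W_meas: "W \<in> borel_measurable lebesgue"
  unfolding W_def[abs_def] using V_meas norm_meas by auto

lemma W_nonneg: "x \<noteq> 0 \<Longrightarrow> W x \<ge> 0"
  using V_nonneg[of "norm x"] by (simp add: W_def)

lemma B_nonneg: "t \<ge> 0 \<Longrightarrow> B t \<ge> 0"
  using f_growth[of t] by (meson abs_ge_zero order_trans)

lemma F_deriv: "(Fprim f has_real_derivative f (max 0 t)) (at t)"
  by (rule Fprim_has_derivative[OF f_cont f0])

lemma F_cont: "continuous_on UNIV (Fprim f)"
  using F_deriv by (intro continuous_at_imp_continuous_on) (auto intro: DERIV_isCont)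

lemma F_meas: "u \<in> borel_measurable lebesgue \<Longrightarrow> (\<lambda>x. Fprim f (u x)) \<in> borel_measurable lebesgue"
  using borel_measurable_continuous_onI[OF F_cont] by (rule measurable_compose[rotated])

lemma F_diff:
  assumes "\<bar>s\<bar> \<le> T" "\<bar>t\<bar> \<le> T"
  shows "\<bar>Fprim f t - Fprim f s\<bar> \<le> B T * \<bar>t - s\<bar>"
proof -
  have "norm (Fprim f t - Fprim f s) \<le> B T * norm (t - s)"
  proof (rule field_differentiable_bound[of "{min s t..max s t}" _ "\<lambda>t. f (max 0 t)"])
    fix z assume z: "z \<in> {min s t..max s t}"
    show "(Fprim f has_field_derivative f (max 0 z)) (at z within {min s t..max s t})"
      by (rule has_field_derivative_at_within[OF F_deriv])
    have "max 0 z \<le> T" using z assms by auto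
    then have "B (max 0 z) \<le> B T" by (intro B_mono) auto
    then show "norm (f (max 0 z)) \<le> B T" using f_growth[of "max 0 z"] by simp
  qed auto
  then show ?thesis by simp
qed

lemma F_bound: "\<bar>Fprim f t\<bar> \<le> \<bar>t\<bar> * B \<bar>t\<bar>"
  using F_diff[of 0 "\<bar>t\<bar>" t] by (simp add: Fprim_nonpos mult.commute)

lemma KF_bound:
  assumes "e > 0"
  shows "\<exists>C\<ge>0. \<forall>x t. x \<noteq> 0 \<longrightarrow> \<bar>K (norm x) * Fprim f t\<bar> \<le> e * (W x * t\<^sup>2) + C * w x"
proof -
  obtain C where C: "C \<ge> 0" and b: "\<forall>x t. x \<noteq> 0 \<longrightarrow> t \<ge> 0 \<longrightarrow>
      K (norm x) * (t * B t) \<le> e * ((V (norm x) + 1 / (norm x)\<^sup>2) * t\<^sup>2) + C * w x"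
    using weights[OF assms] by blast
  have "\<bar>K (norm x) * Fprim f t\<bar> \<le> e * (W x * t\<^sup>2) + C * w x" if "x \<noteq> 0" for x t
  proof -
    have k: "K (norm x) \<ge> 0" using K_nonneg that by simp
    have "\<bar>K (norm x) * Fprim f t\<bar> \<le> K (norm x) * (\<bar>t\<bar> * B \<bar>t\<bar>)"
      using k F_bound[of t] by (simp add: abs_mult mult_left_mono)
    also have "\<dots> \<le> e * (W x * t\<^sup>2) + C * w x" using b[rule_format, of x "\<bar>t\<bar>"] that by (simp add: W_def)
    finally show ?thesis .
  qed
  then show ?thesis using C by blast
qed

lemma KF_integrable:
  assumes um: "u \<in> borel_measurable lebesgue" and Wu: "integrable lebesgue (\<lambda>x. W x * (u x)\<^sup>2)"
  shows "integrable lebesgue (\<lambda>x. K (norm x) * Fprim f (u x))"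
proof -
  obtain C where C: "C \<ge> 0" "\<forall>x t. x \<noteq> 0 \<longrightarrow> \<bar>K (norm x) * Fprim f t\<bar> \<le> 1 * (W x * t\<^sup>2) + C * w x"
    using KF_bound[of 1] by auto
  show ?thesis
  proof (rule Bochner_Integration.integrable_bound)
    show "integrable lebesgue (\<lambda>x. W x * (u x)\<^sup>2 + C * w x)" using Wu w_int by auto
    show "(\<lambda>x. K (norm x) * Fprim f (u x)) \<in> borel_measurable lebesgue"
      using K_meas F_meas[OF um] by auto
    show "AE x in lebesgue. norm (K (norm x) * Fprim f (u x)) \<le> norm (W x * (u x)\<^sup>2 + C * w x)"
      using AE_nonzero
    proof eventually_elim
      case (elim x)
      then show ?case using C(2)[rule_format, of x "u x"] by simp
    qed
  qed
qed

lemma J_abs_bound: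
  assumes "e > 0"
  shows "\<exists>C\<ge>0. \<forall>u. u \<in> borel_measurable lebesgue \<longrightarrow> integrable lebesgue (\<lambda>x. W x * (u x)\<^sup>2) \<longrightarrow>
    \<bar>J u\<bar> \<le> e * (\<integral>x. W x * (u x)\<^sup>2 \<partial>lebesgue) + C"
proof -
  obtain C where C: "C \<ge> 0" "\<forall>x t. x \<noteq> 0 \<longrightarrow> \<bar>K (norm x) * Fprim f t\<bar> \<le> e * (W x * t\<^sup>2) + C * w x"
    using KF_bound[OF assms] by auto
  have "\<bar>J u\<bar> \<le> e * (\<integral>x. W x * (u x)\<^sup>2 \<partial>lebesgue) + C * (\<integral>x. w x \<partial>lebesgue)"
    if um: "u \<in> borel_measurable lebesgue" and Wu: "integrable lebesgue (\<lambda>x. W x * (u x)\<^sup>2)" for u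
  proof -
    have "\<bar>J u\<bar> \<le> (\<integral>x. \<bar>K (norm x) * Fprim f (u x)\<bar> \<partial>lebesgue)" unfolding J_def by (rule integral_abs_bound)
    also have "\<dots> \<le> (\<integral>x. e * (W x * (u x)\<^sup>2) + C * w x \<partial>lebesgue)"
    proof (rule integral_mono_AE)
      show "AE x in lebesgue. \<bar>K (norm x) * Fprim f (u x)\<bar> \<le> e * (W x * (u x)\<^sup>2) + C * w x"
        using AE_nonzero by eventually_elim (use C(2) in auto)
    qed (use KF_integrable[OF um Wu] Wu w_int in auto)
    also have "\<dots> = e * (\<integral>x. W x * (u x)\<^sup>2 \<partial>lebesgue) + C * (\<integral>x. w x \<partial>lebesgue)" using Wu w_int by simp
    finally show ?thesis .
  qed
  moreover have "C * (\<integral>x. w x \<partial>lebesgue) \<ge> 0" using C w_nonneg by simp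
  ultimately show ?thesis by blast
qed

text \<open>The integrands are not dominated by a fixed function, but the excess of their difference
  over e (W u_k^2 + W u^2) is dominated by 2 C w and tends to 0. The part split off has integral at
  most 2 e A, uniformly in k.\<close>

lemma J_tendsto:
  fixes us :: "nat \<Rightarrow> real^'n \<Rightarrow> real"
  assumes usm: "\<And>k. us k \<in> borel_measurable lebesgue" and um: "u \<in> borel_measurable lebesgue"
    and Wi: "\<And>k. integrable lebesgue (\<lambda>x. W x * (us k x)\<^sup>2)"
    and WA: "\<And>k. (\<integral>x. W x * (us k x)\<^sup>2 \<partial>lebesgue) \<le> A"
    and lim: "AE x in lebesgue. (\<lambda>k. us k x) \<longlonglongrightarrow> u x"
  shows "integrable lebesgue (\<lambda>x. W x * (u x)\<^sup>2)" "(\<integral>x. W x * (u x)\<^sup>2 \<partial>lebesgue) \<le> A"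
    and "(\<lambda>k. J (us k)) \<longlonglongrightarrow> J u"
proof -
  have nn: "AE x in lebesgue. 0 \<le> W x * (h x)\<^sup>2" for h :: "real^'n \<Rightarrow> real"
    using AE_nonzero by eventually_elim (auto intro!: mult_nonneg_nonneg W_nonneg)
  have l2: "AE x in lebesgue. (\<lambda>k. W x * (us k x)\<^sup>2) \<longlonglongrightarrow> W x * (u x)\<^sup>2"
    using lim by eventually_elim (intro tendsto_intros)
  have m2: "(\<lambda>x. W x * (u x)\<^sup>2) \<in> borel_measurable lebesgue" using W_meas um by auto
  show Wu: "integrable lebesgue (\<lambda>x. W x * (u x)\<^sup>2)" and WuA: "(\<integral>x. W x * (u x)\<^sup>2 \<partial>lebesgue) \<le> A"
    using Fatou_integrable[OF Wi nn WA l2 m2] by auto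
  have A0: "A \<ge> 0" using WA[of 0] integral_nonneg_AE[OF nn, of "us 0"] by linarith
  show "(\<lambda>k. J (us k)) \<longlonglongrightarrow> J u"
  proof (rule LIMSEQ_I)
    fix r :: real assume r: "r > 0"
    \<comment> \<open>Chosen so that 2 e A is at most r/2; the summand 4 avoids a zero denominator
      when A = 0.\<close>
    define e where "e = r / (4 * A + 4)"
    have e: "e > 0" using r A0 by (simp add: e_def)
    obtain C where C: "C \<ge> 0" "\<forall>x t. x \<noteq> 0 \<longrightarrow> \<bar>K (norm x) * Fprim f t\<bar> \<le> e * (W x * t\<^sup>2) + C * w x"
      using KF_bound[OF e] by auto
    define \<delta> where "\<delta> k x = \<bar>K (norm x) * Fprim f (us k x) - K (norm x) * Fprim f (u x)\<bar>" for k x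
    define b where "b k x = e * (W x * (us k x)\<^sup>2 + W x * (u x)\<^sup>2)" for k x
    define p where "p k x = max 0 (\<delta> k x - b k x)" for k x
    have \<delta>i: "integrable lebesgue (\<delta> k)" for k unfolding \<delta>_def
      using KF_integrable[OF usm Wi, of k] KF_integrable[OF um Wu] by (intro integrable_abs Bochner_Integration.integrable_diff)
    have bi: "integrable lebesgue (b k)" for k unfolding b_def using Wi[of k] Wu by auto
    have pi: "integrable lebesgue (p k)" for k unfolding p_def using \<delta>i[of k] bi[of k] by auto
    have "(\<lambda>k. \<integral>x. p k x \<partial>lebesgue) \<longlonglongrightarrow> (\<integral>x. 0 \<partial>(lebesgue :: (real^'n) measure))"
    proof (rule integral_dominated_convergence)
      show "integrable lebesgue (\<lambda>x. 2 * C * w x)" using w_int by auto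
      show "AE x in lebesgue. (\<lambda>k. p k x) \<longlonglongrightarrow> 0"
        using lim AE_nonzero
      proof eventually_elim
        case (elim x)
        have "(\<lambda>k. Fprim f (us k x)) \<longlonglongrightarrow> Fprim f (u x)"
          using elim(1) F_cont by (auto intro!: isCont_tendsto_compose[of "u x" "Fprim f"] simp: continuous_on_eq_continuous_at)
        then have "(\<lambda>k. \<delta> k x) \<longlonglongrightarrow> \<bar>K (norm x) * Fprim f (u x) - K (norm x) * Fprim f (u x)\<bar>"
          unfolding \<delta>_def by (intro tendsto_intros)
        then have \<delta>0: "(\<lambda>k. \<delta> k x) \<longlonglongrightarrow> 0" by simp
        have "norm (p k x) \<le> \<delta> k x" for k
        proof -
          have "b k x \<ge> 0" using e W_nonneg[OF elim(2)] by (simp add: b_def)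
          moreover have "\<delta> k x \<ge> 0" by (simp add: \<delta>_def)
          ultimately show ?thesis by (simp add: p_def)
        qed
        then show ?case by (intro Lim_null_comparison[OF _ \<delta>0] always_eventually) auto
      qed
      show "AE x in lebesgue. norm (p k x) \<le> 2 * C * w x" for k
        using AE_nonzero
      proof eventually_elim
        case (elim x)
        have "\<delta> k x \<le> \<bar>K (norm x) * Fprim f (us k x)\<bar> + \<bar>K (norm x) * Fprim f (u x)\<bar>" by (simp add: \<delta>_def)
        also have "\<dots> \<le> b k x + 2 * C * w x"
          using C(2)[rule_format, OF elim, of "us k x"] C(2)[rule_format, OF elim, of "u x"]
          unfolding b_def by (simp add: algebra_simps)
        finally have "\<delta> k x - b k x \<le> 2 * C * w x" by simp
        moreover have "0 \<le> 2 * C * w x" using C(1) w_nonneg[of x] by simp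
        ultimately show ?case by (simp add: p_def)
      qed
    qed (use pi in auto)
    then have "(\<lambda>k. \<integral>x. p k x \<partial>lebesgue) \<longlonglongrightarrow> 0" by simp
    then obtain k0 where k0: "\<And>k. k \<ge> k0 \<Longrightarrow> \<bar>\<integral>x. p k x \<partial>lebesgue\<bar> < r / 2"
      using LIMSEQ_D[of _ 0 "r / 2"] r by fastforce
    show "\<exists>k0. \<forall>k\<ge>k0. norm (J (us k) - J u) < r"
    proof (intro exI allI impI)
      fix k assume k: "k \<ge> k0"
      have "J (us k) - J u = (\<integral>x. K (norm x) * Fprim f (us k x) - K (norm x) * Fprim f (u x) \<partial>lebesgue)"
        unfolding J_def by (rule Bochner_Integration.integral_diff[symmetric]) (use KF_integrable[OF usm Wi] KF_integrable[OF um Wu] in auto)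
      then have "\<bar>J (us k) - J u\<bar> \<le> (\<integral>x. \<delta> k x \<partial>lebesgue)" unfolding \<delta>_def by (simp only: integral_abs_bound)
      also have "\<dots> \<le> (\<integral>x. p k x + b k x \<partial>lebesgue)"
        by (rule integral_mono) (use \<delta>i pi bi in \<open>auto simp: p_def\<close>)
      also have "\<dots> = (\<integral>x. p k x \<partial>lebesgue) + e * ((\<integral>x. W x * (us k x)\<^sup>2 \<partial>lebesgue) + (\<integral>x. W x * (u x)\<^sup>2 \<partial>lebesgue))"
        using pi[of k] bi[of k] Wi[of k] Wu by (simp add: b_def)
      also have "\<dots> < r / 2 + e * (A + A)"
        using k0[OF k] WA[of k] WuA e by (intro add_less_le_mono mult_left_mono add_mono) auto
      also have "\<dots> \<le> r / 2 + r / 2"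
      proof -
        have "e * (4 * A) \<le> e * (4 * A + 4)" using e by (intro mult_left_mono) auto
        also have "\<dots> = r" using A0 by (simp add: e_def)
        finally show ?thesis by simp
      qed
      finally show "norm (J (us k) - J u) < r" by simp
    qed
  qed
qed

end

text \<open>An Arzela-Ascoli argument with pointwise conclusion: a diagonal sequence converges at
  all positive rationals, and the common Hoelder estimate carries the Cauchy property to every
  positive radius.\<close>

lemma profile_convergent_subsequence:
  fixes gs :: "nat \<Rightarrow> real^'n \<Rightarrow> real^'n"
  assumes n3: "CARD('n) \<ge> 3" and gm: "\<And>k. gs k \<in> borel_measurable lebesgue"
    and g2: "\<And>k. integrable lebesgue (\<lambda>x. (norm (gs k x))\<^sup>2)"
    and M: "\<And>k. (\<integral>x. (norm (gs k x))\<^sup>2 \<partial>lebesgue) \<le> M"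
  shows "\<exists>s::nat \<Rightarrow> nat. strict_mono s \<and> (\<forall>r>0. convergent (\<lambda>j. profile (gs (s j)) r))"
proof -
  let ?\<tau> = "\<lambda>r. r powr (2 - real CARD('n))"
  define D where "D = profile_const TYPE('n) * sqrt M"
  have pc: "profile_const TYPE('n) \<ge> 0"
    using n3 sphere_vol_pos[where 'a="real^'n"] by (simp add: profile_const_def)
  have le: "profile_const TYPE('n) * sqrt (\<integral>x. (norm (gs k x))\<^sup>2 \<partial>lebesgue) \<le> D" for k
    unfolding D_def using pc M by (intro mult_left_mono) auto
  have b1: "\<bar>profile (gs k) r\<bar> \<le> D * sqrt (?\<tau> r)" if "r > 0" for k r
    using profile_bound[OF n3 gm[of k] g2[of k] that] mult_right_mono[OF le[of k], of "sqrt (?\<tau> r)"] by auto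
  have b2: "\<bar>profile (gs k) s - profile (gs k) r\<bar> \<le> D * sqrt \<bar>?\<tau> s - ?\<tau> r\<bar>" if "r > 0" "s > 0" for k r s
    using profile_diff_bound_abs[OF n3 gm[of k] g2[of k] that] mult_right_mono[OF le[of k], of "sqrt \<bar>?\<tau> s - ?\<tau> r\<bar>"] by auto
  have cnt: "countable (\<rat> \<inter> {0::real<..})" using countable_rat by (rule countable_subset[rotated]) auto
  \<comment> \<open>Dividing by the decay rate gives one bound for all positive radii, as the
    diagonal selection asks for; the factor is removed again afterwards.\<close>
  have nb: "norm (profile (gs k) r / sqrt (?\<tau> r)) \<le> D" if "r \<in> \<rat> \<inter> {0<..}" for k r
    using b1[of r k] that by (simp add: divide_le_eq)
  obtain s :: "nat \<Rightarrow> nat" where s: "strict_mono s"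
    and sc: "\<And>r. r \<in> \<rat> \<inter> {0<..} \<Longrightarrow> \<exists>l. (\<lambda>j. profile (gs (s j)) r / sqrt (?\<tau> r)) \<longlonglongrightarrow> l"
    using function_convergent_subsequence[where f="\<lambda>k r. profile (gs k) r / sqrt (?\<tau> r)" and M=D, OF cnt nb] by blast
  have cq: "Cauchy (\<lambda>j. profile (gs (s j)) q)" if q: "q \<in> \<rat>" "q > 0" for q
  proof -
    obtain l where "(\<lambda>j. profile (gs (s j)) q / sqrt (?\<tau> q)) \<longlonglongrightarrow> l" using sc[of q] q by auto
    then have "(\<lambda>j. profile (gs (s j)) q / sqrt (?\<tau> q) * sqrt (?\<tau> q)) \<longlonglongrightarrow> l * sqrt (?\<tau> q)" by (intro tendsto_intros)
    then have "(\<lambda>j. profile (gs (s j)) q) \<longlonglongrightarrow> l * sqrt (?\<tau> q)" using q by simp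
    then show ?thesis by (rule LIMSEQ_imp_Cauchy)
  qed
  show ?thesis
  proof (intro exI conjI allI impI)
    show "strict_mono s" by (rule s)
    fix r :: real assume r: "r > 0"
    have "Cauchy (\<lambda>j. profile (gs (s j)) r)"
    proof (rule metric_CauchyI)
      fix e :: real assume e: "e > 0"
      have "((\<lambda>q. D * sqrt \<bar>?\<tau> q - ?\<tau> r\<bar>) \<longlongrightarrow> D * sqrt \<bar>?\<tau> r - ?\<tau> r\<bar>) (at r)"
        using r by (intro tendsto_intros) auto
      then have "\<forall>\<^sub>F q in at r. D * sqrt \<bar>?\<tau> q - ?\<tau> r\<bar> < e / 3"
        using e by (intro order_tendstoD(2)) auto
      then obtain d where d: "d > 0" "\<And>q. q \<noteq> r \<Longrightarrow> \<bar>q - r\<bar> < d \<Longrightarrow> D * sqrt \<bar>?\<tau> q - ?\<tau> r\<bar> < e / 3"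
        by (auto simp: eventually_at dist_real_def)
      obtain q where q: "q \<in> \<rat>" "r < q" "q < r + d" using Rats_dense_in_real[of r "r + d"] d by auto
      have q0: "q > 0" using q r by linarith
      have near: "\<bar>profile (gs k) q - profile (gs k) r\<bar> < e / 3" for k
        using b2[OF r q0, of k] d(2)[of q] q by auto
      obtain N where N: "\<And>i j. i \<ge> N \<Longrightarrow> j \<ge> N \<Longrightarrow> dist (profile (gs (s i)) q) (profile (gs (s j)) q) < e / 3"
        using metric_CauchyD[OF cq[OF q(1) q0], of "e / 3"] e by auto
      show "\<exists>N. \<forall>i\<ge>N. \<forall>j\<ge>N. dist (profile (gs (s i)) r) (profile (gs (s j)) r) < e"
      proof (intro exI allI impI)
        fix i j assume "i \<ge> N" "j \<ge> N"
        then show "dist (profile (gs (s i)) r) (profile (gs (s j)) r) < e"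
          using N[of i j] near[of "s i"] near[of "s j"] unfolding dist_real_def by linarith
      qed
    qed
    then show "convergent (\<lambda>j. profile (gs (s j)) r)" by (rule Cauchy_convergent)
  qed
qed

text \<open>Riesz-Fischer for vector-valued functions, with the almost everywhere convergent
  subsequence made explicit: the limit of the gradients is needed both in mean and
  pointwise.\<close>

lemma L2_Cauchy_limit:
  fixes gs :: "nat \<Rightarrow> 'b \<Rightarrow> 'a::euclidean_space"
  assumes gm: "\<And>k. gs k \<in> borel_measurable M"
    and g2: "\<And>k. integrable M (\<lambda>x. (norm (gs k x))\<^sup>2)"
    and Cau: "\<And>e. e > 0 \<Longrightarrow> \<exists>N. \<forall>m\<ge>N. \<forall>n\<ge>N. (\<integral>x. (norm (gs m x - gs n x))\<^sup>2 \<partial>M) < e"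
  obtains g and s :: "nat \<Rightarrow> nat" where "strict_mono s" "g \<in> borel_measurable M"
    "AE x in M. (\<lambda>j. gs (s j) x) \<longlonglongrightarrow> g x" "integrable M (\<lambda>x. (norm (g x))\<^sup>2)"
    "(\<lambda>j. \<integral>x. (norm (gs (s j) x - g x))\<^sup>2 \<partial>M) \<longlonglongrightarrow> 0"
proof -
  have di: "integrable M (\<lambda>x. (norm (gs m x - gs n x))\<^sup>2)" for m n
    by (rule L2_integrable_diff[OF gm gm g2 g2])
  have "\<forall>j. \<exists>N. \<forall>m\<ge>N. \<forall>n\<ge>N. (\<integral>x. (norm (gs m x - gs n x))\<^sup>2 \<partial>M) < (1/4) ^ j"
    using Cau by simp
  then obtain N where N: "\<And>j m n. m \<ge> N j \<Longrightarrow> n \<ge> N j \<Longrightarrow> (\<integral>x. (norm (gs m x - gs n x))\<^sup>2 \<partial>M) < (1/4) ^ j"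
    by metis
  \<comment> \<open>Strictly increasing and at least \<open>N j\<close>, so that consecutive
    differences have squared norm below 4^(-j).\<close>
  define s where "s = rec_nat (N 0) (\<lambda>j p. max (Suc p) (N (Suc j)))"
  have sS: "s (Suc j) = max (Suc (s j)) (N (Suc j))" for j by (simp add: s_def)
  have sm: "strict_mono s" by (rule strict_monoI_Suc) (simp add: sS)
  have sN: "s j \<ge> N j" for j by (cases j) (auto simp: sS s_def)
  define \<Delta> where "\<Delta> j x = gs (s (Suc j)) x - gs (s j) x" for j x
  have \<Delta>m: "\<Delta> j \<in> borel_measurable M" for j unfolding \<Delta>_def using gm by auto
  have \<Delta>i: "(\<integral>x. (norm (\<Delta> j x))\<^sup>2 \<partial>M) < (1/4) ^ j" for j
    unfolding \<Delta>_def using sN[of j] strict_monoD[OF sm, of j "Suc j"] by (intro N) auto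
  \<comment> \<open>The factor 2^j still leaves the geometric bound 2^(-j) after integration, and
    makes it possible to pass from squares to norms pointwise.\<close>
  have "AE x in M. summable (\<lambda>j. 2 ^ j * (norm (\<Delta> j x))\<^sup>2)"
  proof -
    have "(\<integral>\<^sup>+x. (\<Sum>j. ennreal (2 ^ j * (norm (\<Delta> j x))\<^sup>2)) \<partial>M) = (\<Sum>j. \<integral>\<^sup>+x. ennreal (2 ^ j * (norm (\<Delta> j x))\<^sup>2) \<partial>M)"
      using \<Delta>m by (intro nn_integral_suminf) auto
    also have "\<dots> \<le> (\<Sum>j. ennreal ((1/2) ^ j))"
    proof (intro suminf_le allI)
      fix j
      have "(\<integral>\<^sup>+x. ennreal (2 ^ j * (norm (\<Delta> j x))\<^sup>2) \<partial>M) = ennreal (\<integral>x. 2 ^ j * (norm (\<Delta> j x))\<^sup>2 \<partial>M)"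
        using di by (intro nn_integral_eq_integral) (auto simp: \<Delta>_def)
      also have "\<dots> = ennreal (2 ^ j * (\<integral>x. (norm (\<Delta> j x))\<^sup>2 \<partial>M))" by simp
      also have "\<dots> \<le> ennreal (2 ^ j * (1/4) ^ j)"
        using \<Delta>i[of j] by (intro ennreal_leI mult_left_mono) auto
      also have "(2::real) ^ j * (1/4) ^ j = (1/2) ^ j" by (simp add: power_mult_distrib[symmetric])
      finally show "(\<integral>\<^sup>+x. ennreal (2 ^ j * (norm (\<Delta> j x))\<^sup>2) \<partial>M) \<le> ennreal ((1/2) ^ j)" .
    qed auto
    also have "\<dots> = ennreal (\<Sum>j. (1/2) ^ j)" by (intro suminf_ennreal2 summable_geometric) auto
    finally have "(\<integral>\<^sup>+x. (\<Sum>j. ennreal (2 ^ j * (norm (\<Delta> j x))\<^sup>2)) \<partial>M) \<noteq> \<infinity>" by (auto simp: top_unique)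
    then have "AE x in M. (\<Sum>j. ennreal (2 ^ j * (norm (\<Delta> j x))\<^sup>2)) \<noteq> \<infinity>"
      using \<Delta>m by (intro nn_integral_PInf_AE) auto
    then show ?thesis by eventually_elim (auto intro!: summable_suminf_not_top)
  qed
  then have conv: "AE x in M. convergent (\<lambda>j. gs (s j) x)"
  proof eventually_elim
    case (elim x)
    \<comment> \<open>Completing the square, a weighted inequality of arithmetic and geometric
      means; it bounds the increments by two summable sequences.\<close>
    have "norm (\<Delta> j x) \<le> (1/2) ^ j + 2 ^ j * (norm (\<Delta> j x))\<^sup>2" for j
    proof -
      let ?a = "norm (\<Delta> j x)"
      have "0 \<le> 2 ^ j * (?a - (1/2) ^ j)\<^sup>2" by simp
      also have "\<dots> = 2 ^ j * ?a\<^sup>2 - 2 * (2 ^ j * (1/2) ^ j) * ?a + (2 ^ j * (1/2) ^ j) * (1/2) ^ j"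
        by (simp add: power2_diff algebra_simps power2_eq_square)
      also have "(2::real) ^ j * (1/2) ^ j = 1" by (simp add: power_mult_distrib[symmetric])
      finally show ?thesis by (simp add: norm_ge_zero[of "\<Delta> j x"]) (use norm_ge_zero[of "\<Delta> j x"] in linarith)
    qed
    moreover have "summable (\<lambda>j. (1/2) ^ j + 2 ^ j * (norm (\<Delta> j x))\<^sup>2)"
      using elim by (intro summable_add summable_geometric) auto
    ultimately have "summable (\<lambda>j. \<Delta> j x)"
      by (intro summable_comparison_test'[of _ 0 "\<lambda>j. \<Delta> j x"]) auto
    then have "(\<lambda>j. \<Sum>i<j. \<Delta> i x) \<longlonglongrightarrow> (\<Sum>i. \<Delta> i x)" by (rule summable_LIMSEQ)
    then have "(\<lambda>j. gs (s 0) x + (\<Sum>i<j. \<Delta> i x)) \<longlonglongrightarrow> gs (s 0) x + (\<Sum>i. \<Delta> i x)" by (intro tendsto_intros)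
    moreover have "gs (s 0) x + (\<Sum>i<j. \<Delta> i x) = gs (s j) x" for j
      unfolding \<Delta>_def using sum_lessThan_telescope[of "\<lambda>i. gs (s i) x" j] by (simp add: algebra_simps)
    ultimately show ?case by (auto simp: convergent_def)
  qed
  define g where "g x = lim (\<lambda>j. gs (s j) x)" for x
  have gmm: "g \<in> borel_measurable M" unfolding g_def using gm by measurable
  have lim: "AE x in M. (\<lambda>j. gs (s j) x) \<longlonglongrightarrow> g x"
    using conv by eventually_elim (simp add: g_def convergent_LIMSEQ_iff)
  \<comment> \<open>Fatou's lemma in the second index. Shifting by \<open>j0\<close> makes the bound
    hold for every term of the sequence.\<close>
  have tail: "integrable M (\<lambda>x. (norm (gs (s i) x - g x))\<^sup>2) \<and> (\<integral>x. (norm (gs (s i) x - g x))\<^sup>2 \<partial>M) \<le> e"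
    if e: "\<And>j. j \<ge> j0 \<Longrightarrow> (\<integral>x. (norm (gs (s i) x - gs (s j) x))\<^sup>2 \<partial>M) \<le> e" for i j0 e
  proof -
    have l: "AE x in M. (\<lambda>j. (norm (gs (s i) x - gs (s (j + j0)) x))\<^sup>2) \<longlonglongrightarrow> (norm (gs (s i) x - g x))\<^sup>2"
      using lim by eventually_elim (intro tendsto_intros LIMSEQ_ignore_initial_segment)
    have m: "(\<lambda>x. (norm (gs (s i) x - g x))\<^sup>2) \<in> borel_measurable M" using gm gmm by auto
    show ?thesis
      using Fatou_integrable[where f="\<lambda>j x. (norm (gs (s i) x - gs (s (j + j0)) x))\<^sup>2" and A=e, OF di _ _ l m] e by auto
  qed
  have small: "\<exists>j0. \<forall>i\<ge>j0. integrable M (\<lambda>x. (norm (gs (s i) x - g x))\<^sup>2) \<and> (\<integral>x. (norm (gs (s i) x - g x))\<^sup>2 \<partial>M) \<le> e"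
    if e: "e > 0" for e
  proof -
    obtain N0 where N0: "\<forall>m\<ge>N0. \<forall>n\<ge>N0. (\<integral>x. (norm (gs m x - gs n x))\<^sup>2 \<partial>M) < e" using Cau[OF e] by blast
    have sj: "s j \<ge> N0" if "j \<ge> N0" for j using that seq_suble[OF sm, of j] by linarith
    show ?thesis
    proof (intro exI allI impI)
      fix i assume "i \<ge> N0"
      then show "integrable M (\<lambda>x. (norm (gs (s i) x - g x))\<^sup>2) \<and> (\<integral>x. (norm (gs (s i) x - g x))\<^sup>2 \<partial>M) \<le> e"
        using N0 sj by (intro tail[of N0]) (auto intro: less_imp_le)
    qed
  qed
  have gi: "integrable M (\<lambda>x. (norm (g x))\<^sup>2)"
  proof -
    obtain i where i: "integrable M (\<lambda>x. (norm (gs (s i) x - g x))\<^sup>2)" using small[of 1] by auto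
    have "integrable M (\<lambda>x. (norm (gs (s i) x - (gs (s i) x - g x)))\<^sup>2)"
      by (rule L2_integrable_diff[OF gm _ g2 i]) (use gm gmm in auto)
    then show ?thesis by simp
  qed
  have "(\<lambda>j. \<integral>x. (norm (gs (s j) x - g x))\<^sup>2 \<partial>M) \<longlonglongrightarrow> 0"
  proof (rule LIMSEQ_I)
    fix e :: real assume "e > 0"
    then obtain j0 where "\<forall>i\<ge>j0. (\<integral>x. (norm (gs (s i) x - g x))\<^sup>2 \<partial>M) \<le> e / 2" using small[of "e / 2"] by auto
    then show "\<exists>j0. \<forall>i\<ge>j0. norm ((\<integral>x. (norm (gs (s i) x - g x))\<^sup>2 \<partial>M) - 0) < e"
      using \<open>e > 0\<close> by (intro exI[of _ j0]) force
  qed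
  then show ?thesis using that[OF sm gmm lim gi] by blast
qed

section \<open>Admissible pairs: linearity, parallelogram inequality, truncation, coercivity\<close>

context sublinear_problem
begin

text \<open>The \<open>V\<close> part of \<open>W\<close> contributes 1 and the part 1/|x|^2 the
  constant of Hardy's inequality.\<close>

definition cW :: real where "cW = 1 + 4 / (real CARD('n) - 2)\<^sup>2"

lemma cW_ge_1: "cW \<ge> 1" by (simp add: cW_def)

lemma admD:
  assumes "adm u g"
  shows "u \<in> borel_measurable lebesgue" "g \<in> borel_measurable lebesgue"
    "integrable lebesgue (\<lambda>x. (norm (g x))\<^sup>2)" "integrable lebesgue (\<lambda>x. V (norm x) * (u x)\<^sup>2)"
    "D12 u" "radial u" "weak_grad u g"
  using assms by (auto simp: adm_def H1Vr_def D12_def weak_grad_def)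

lemma adm_profile: "adm u g \<Longrightarrow> AE x in lebesgue. u x = profile g (norm x)"
  by (rule radial_representation[OF n3]) (auto dest: admD)

lemma V_term_nonneg: "AE x in lebesgue. 0 \<le> V (norm x) * (u x)\<^sup>2" for u :: "real^'n \<Rightarrow> real"
  using AE_nonzero by eventually_elim (auto intro!: mult_nonneg_nonneg V_nonneg)

lemma Q_nonneg: "Q u g \<ge> 0"
  unfolding Q_def by (intro add_nonneg_nonneg integral_nonneg_AE V_term_nonneg) auto

lemma Q_ge_grad: "(\<integral>x. (norm (g x))\<^sup>2 \<partial>lebesgue) \<le> Q u g"
  unfolding Q_def using integral_nonneg_AE[OF V_term_nonneg, of u] by simp

lemma adm_W:
  assumes "adm u g"
  shows "integrable lebesgue (\<lambda>x. W x * (u x)\<^sup>2)" "(\<integral>x. W x * (u x)\<^sup>2 \<partial>lebesgue) \<le> cW * Q u g"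
proof -
  note a = admD[OF assms]
  note H = Hardy_profile[OF n3 a(2,3)]
  let ?q = "\<lambda>x. (u x)\<^sup>2 / (norm x)\<^sup>2"
  have qm: "?q \<in> borel_measurable lebesgue" using a(1) norm_meas by auto
  have ae: "AE x in lebesgue. ?q x = (profile g (norm x))\<^sup>2 / (norm x)\<^sup>2"
    using adm_profile[OF assms] by eventually_elim simp
  have qi: "integrable lebesgue ?q" using H(1) integrable_cong_AE[OF qm _ ae] by auto
  have "(\<integral>x. ?q x \<partial>lebesgue) = (\<integral>x. (profile g (norm x))\<^sup>2 / (norm (x::real^'n))\<^sup>2 \<partial>lebesgue)"
    by (rule integral_cong_AE[OF qm _ ae]) (use H(1) in auto)
  also note H(2)
  finally have q: "(\<integral>x. ?q x \<partial>lebesgue) \<le> 4 / (real CARD('n) - 2)\<^sup>2 * (\<integral>x. (norm (g x))\<^sup>2 \<partial>lebesgue)" .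
  have eq: "W x * (u x)\<^sup>2 = V (norm x) * (u x)\<^sup>2 + ?q x" for x by (simp add: W_def distrib_right)
  show "integrable lebesgue (\<lambda>x. W x * (u x)\<^sup>2)" unfolding eq using a(4) qi by simp
  have "(\<integral>x. W x * (u x)\<^sup>2 \<partial>lebesgue) = (\<integral>x. V (norm x) * (u x)\<^sup>2 \<partial>lebesgue) + (\<integral>x. ?q x \<partial>lebesgue)"
    unfolding eq using a(4) qi by simp
  also have "\<dots> \<le> Q u g + 4 / (real CARD('n) - 2)\<^sup>2 * Q u g"
  proof (rule add_mono)
    show "(\<integral>x. V (norm x) * (u x)\<^sup>2 \<partial>lebesgue) \<le> Q u g" by (simp add: Q_def)
    show "(\<integral>x. ?q x \<partial>lebesgue) \<le> 4 / (real CARD('n) - 2)\<^sup>2 * Q u g"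
      using q mult_left_mono[OF Q_ge_grad, of "4 / (real CARD('n) - 2)\<^sup>2" g u] by simp
  qed
  finally show "(\<integral>x. W x * (u x)\<^sup>2 \<partial>lebesgue) \<le> cW * Q u g" by (simp add: cW_def distrib_right)
qed

lemma adm_add_scaled:
  assumes "adm u g" "adm h k"
  shows "adm (\<lambda>x. u x + c * h x) (\<lambda>x. g x + c *\<^sub>R k x)"
proof -
  note a = admD[OF assms(1)] and b = admD[OF assms(2)]
  have "integrable lebesgue (\<lambda>x. (norm (g x + c *\<^sub>R k x))\<^sup>2)"
    by (rule L2_integrable_add[OF a(2) _ a(3)]) (use b in \<open>auto simp: power_mult_distrib\<close>)
  moreover have "integrable lebesgue (\<lambda>x. V (norm x) * (u x + c * h x)\<^sup>2)"
  proof (rule Bochner_Integration.integrable_bound)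
    show "integrable lebesgue (\<lambda>x. 2 * (V (norm x) * (u x)\<^sup>2) + 2 * c\<^sup>2 * (V (norm x) * (h x)\<^sup>2))"
      using a(4) b(4) by (intro Bochner_Integration.integrable_add integrable_mult_right)
    show "(\<lambda>x. V (norm x) * (u x + c * h x)\<^sup>2) \<in> borel_measurable lebesgue"
      using V_meas a(1) b(1) by auto
    show "AE x in lebesgue. norm (V (norm x) * (u x + c * h x)\<^sup>2) \<le> norm (2 * (V (norm x) * (u x)\<^sup>2) + 2 * c\<^sup>2 * (V (norm x) * (h x)\<^sup>2))"
      using AE_nonzero
    proof eventually_elim
      case (elim x)
      have v: "V (norm x) \<ge> 0" using V_nonneg elim by simp
      have "(u x + c * h x)\<^sup>2 \<le> 2 * (u x)\<^sup>2 + 2 * (c * h x)\<^sup>2"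
        using sum_squares_bound[of "u x" "c * h x"] by (simp add: power2_sum)
      then have "V (norm x) * (u x + c * h x)\<^sup>2 \<le> V (norm x) * (2 * (u x)\<^sup>2 + 2 * (c * h x)\<^sup>2)"
        using v by (rule mult_left_mono)
      also have "\<dots> = 2 * (V (norm x) * (u x)\<^sup>2) + 2 * c\<^sup>2 * (V (norm x) * (h x)\<^sup>2)"
        by (simp add: algebra_simps power_mult_distrib)
      finally show ?case using v by simp
    qed
  qed
  ultimately show ?thesis
    unfolding adm_def H1Vr_def
    using D12_add_scaled[OF n3 a(5) b(5)] radial_add_scaled[OF a(6) b(6)] weak_grad_add_scaled[OF a(7) b(7)] by blast
qed

lemma adm_zero: "adm (\<lambda>_. 0) (\<lambda>_. 0)"
proof -
  have "weak_grad (\<lambda>_::real^'n. 0) (\<lambda>_. 0)" by (rule weak_grad_C1grad[OF C1grad_const])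
  then show ?thesis by (auto simp: adm_def H1Vr_def D12_def radial_def intro!: exI[of _ "\<lambda>_. 0"])
qed

lemma adm_scale: "adm u g \<Longrightarrow> adm (\<lambda>x. c * u x) (\<lambda>x. c *\<^sub>R g x)"
  using adm_add_scaled[OF adm_zero, of u g c] by simp

lemma adm_average:
  assumes "adm u g" "adm h k"
  shows "adm (\<lambda>x. (u x + h x) / 2) (\<lambda>x. (1/2) *\<^sub>R (g x + k x))"
proof -
  have "adm (\<lambda>x. (1/2) * (u x + 1 * h x)) (\<lambda>x. (1/2) *\<^sub>R (g x + 1 *\<^sub>R k x))"
    by (intro adm_scale adm_add_scaled assms)
  then show ?thesis by simp
qed

text \<open>The parallelogram identity is kept exactly for the gradients, whereas the nonnegative
  term from the difference of the functions is dropped, leaving an inequality. Only the gradients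
  have to be proved Cauchy, since the functions converge pointwise.\<close>

lemma Q_parallelogram:
  assumes "adm u g" "adm h k"
  shows "(\<integral>x. (norm (g x - k x))\<^sup>2 \<partial>lebesgue) / 4 + Q (\<lambda>x. (u x + h x) / 2) (\<lambda>x. (1/2) *\<^sub>R (g x + k x))
    \<le> (Q u g + Q h k) / 2"
proof -
  note a = admD[OF assms(1)] and b = admD[OF assms(2)] and c = admD[OF adm_average[OF assms]]
  have di: "integrable lebesgue (\<lambda>x. (norm (g x - k x))\<^sup>2)" by (rule L2_integrable_diff[OF a(2) b(2) a(3) b(3)])
  have "(norm (g x - k x))\<^sup>2 / 4 + (norm ((1/2) *\<^sub>R (g x + k x)))\<^sup>2 = (norm (g x))\<^sup>2 / 2 + (norm (k x))\<^sup>2 / 2" for x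
    by (simp add: power2_norm_eq_inner inner_diff_left inner_diff_right inner_add_left inner_add_right inner_commute field_simps)
  then have "(\<integral>x. (norm (g x - k x))\<^sup>2 / 4 + (norm ((1/2) *\<^sub>R (g x + k x)))\<^sup>2 \<partial>lebesgue) = (\<integral>x. (norm (g x))\<^sup>2 / 2 + (norm (k x))\<^sup>2 / 2 \<partial>lebesgue)"
    by simp
  moreover have "(\<integral>x. (norm (g x - k x))\<^sup>2 / 4 + (norm ((1/2) *\<^sub>R (g x + k x)))\<^sup>2 \<partial>lebesgue)
      = (\<integral>x. (norm (g x - k x))\<^sup>2 / 4 \<partial>lebesgue) + (\<integral>x. (norm ((1/2) *\<^sub>R (g x + k x)))\<^sup>2 \<partial>lebesgue)"
    by (rule Bochner_Integration.integral_add) (use di c(3) in auto)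
  ultimately have G: "(\<integral>x. (norm (g x - k x))\<^sup>2 \<partial>lebesgue) / 4 + (\<integral>x. (norm ((1/2) *\<^sub>R (g x + k x)))\<^sup>2 \<partial>lebesgue)
      = (\<integral>x. (norm (g x))\<^sup>2 \<partial>lebesgue) / 2 + (\<integral>x. (norm (k x))\<^sup>2 \<partial>lebesgue) / 2"
    using a(3) b(3) by simp
  have "(\<integral>x. V (norm x) * ((u x + h x) / 2)\<^sup>2 \<partial>lebesgue) \<le> (\<integral>x. V (norm x) * (u x)\<^sup>2 / 2 + V (norm x) * (h x)\<^sup>2 / 2 \<partial>lebesgue)"
  proof (rule integral_mono_AE[OF c(4)])
    show "AE x in lebesgue. V (norm x) * ((u x + h x) / 2)\<^sup>2 \<le> V (norm x) * (u x)\<^sup>2 / 2 + V (norm x) * (h x)\<^sup>2 / 2"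
      using AE_nonzero
    proof eventually_elim
      case (elim x)
      have "((u x + h x) / 2)\<^sup>2 \<le> (u x)\<^sup>2 / 2 + (h x)\<^sup>2 / 2"
        using sum_squares_bound[of "u x" "h x"] by (simp add: power_divide power2_sum)
      then have "V (norm x) * ((u x + h x) / 2)\<^sup>2 \<le> V (norm x) * ((u x)\<^sup>2 / 2 + (h x)\<^sup>2 / 2)"
        using V_nonneg elim by (intro mult_left_mono) auto
      then show ?case by (simp add: distrib_left)
    qed
  qed (use a(4) b(4) in auto)
  also have "\<dots> = (\<integral>x. V (norm x) * (u x)\<^sup>2 \<partial>lebesgue) / 2 + (\<integral>x. V (norm x) * (h x)\<^sup>2 \<partial>lebesgue) / 2"
    using a(4) b(4) by simp
  finally show ?thesis using G unfolding Q_def by (simp add: add_divide_distrib)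
qed

text \<open>\<open>J\<close> is unchanged because \<open>Fprim f\<close> vanishes on negative
  arguments, while both parts of \<open>Q\<close> can only decrease.\<close>

lemma adm_positive_part:
  assumes "adm u g"
  shows "\<exists>k. adm (\<lambda>x. max 0 (u x)) k \<and> energy (\<lambda>x. max 0 (u x)) k \<le> energy u g"
proof -
  note a = admD[OF assms]
  let ?k = "\<lambda>x. indicator {r. r > 0 \<and> profile g r > 0} (norm x) *\<^sub>R g x"
  have wk: "weak_grad (\<lambda>x. max 0 (u x)) ?k"
    by (rule weak_grad_positive_part[OF a(1,7) continuous_on_profile[OF n3 a(2,3)] adm_profile[OF assms]])
  then have km: "?k \<in> borel_measurable lebesgue" by (simp add: weak_grad_def)
  have kle: "(norm (?k x))\<^sup>2 \<le> (norm (g x))\<^sup>2" for x by (auto simp: indicator_def)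
  have ki: "integrable lebesgue (\<lambda>x. (norm (?k x))\<^sup>2)"
  proof (rule Bochner_Integration.integrable_bound[OF a(3)])
    show "(\<lambda>x. (norm (?k x))\<^sup>2) \<in> borel_measurable lebesgue" 
      by (rule borel_measurable_power[OF measurable_compose[OF km]]) auto
  qed (use kle in auto)
  have pm: "(\<lambda>x. max 0 (u x)) \<in> borel_measurable lebesgue" using a(1) by auto
  have p2: "(max 0 t)\<^sup>2 \<le> t\<^sup>2" for t :: real by (auto simp: max_def)
  have Vle: "AE x in lebesgue. V (norm x) * (max 0 (u x))\<^sup>2 \<le> V (norm x) * (u x)\<^sup>2"
    using AE_nonzero by eventually_elim (auto intro!: mult_left_mono p2 V_nonneg)
  have Vi: "integrable lebesgue (\<lambda>x. V (norm x) * (max 0 (u x))\<^sup>2)"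
  proof (rule Bochner_Integration.integrable_bound[OF a(4)])
    show "(\<lambda>x. V (norm x) * (max 0 (u x))\<^sup>2) \<in> borel_measurable lebesgue" using V_meas pm by auto
    show "AE x in lebesgue. norm (V (norm x) * (max 0 (u x))\<^sup>2) \<le> norm (V (norm x) * (u x)\<^sup>2)"
      using Vle AE_nonzero by eventually_elim (simp add: abs_mult V_nonneg)
  qed
  let ?p = "2 * real CARD('n) / (real CARD('n) - 2)"
  have "integrable lebesgue (\<lambda>x. \<bar>max 0 (u x)\<bar> powr ?p)"
  proof (rule Bochner_Integration.integrable_bound)
    show "integrable lebesgue (\<lambda>x. \<bar>u x\<bar> powr ?p)" using a(5) by (simp add: D12_def)
    show "AE x in lebesgue. norm (\<bar>max 0 (u x)\<bar> powr ?p) \<le> norm (\<bar>u x\<bar> powr ?p)"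
      using n3 by (auto intro!: powr_mono2)
  qed (use pm in auto)
  then have "D12 (\<lambda>x. max 0 (u x))" using pm wk ki by (auto simp: D12_def)
  moreover have "radial (\<lambda>x. max 0 (u x))"
  proof -
    obtain v where "AE x in lebesgue. u x = v (norm x)" using a(6) by (auto simp: radial_def)
    then have "AE x in lebesgue. max 0 (u x) = (\<lambda>r. max 0 (v r)) (norm x)" by eventually_elim simp
    then show ?thesis unfolding radial_def by (rule exI[of _ "\<lambda>r. max 0 (v r)"])
  qed
  ultimately have ad: "adm (\<lambda>x. max 0 (u x)) ?k" using wk ki Vi by (auto simp: adm_def H1Vr_def)
  have "Fprim f (max 0 t) = Fprim f t" for t by (cases "t \<ge> 0") (auto simp: Fprim_nonpos max_def)
  then have "J (\<lambda>x. max 0 (u x)) = J u" by (simp add: J_def)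
  moreover have "Q (\<lambda>x. max 0 (u x)) ?k \<le> Q u g"
    unfolding Q_def by (intro add_mono integral_mono_AE[OF Vi a(4) Vle] integral_mono[OF ki a(3)] kle)
  ultimately show ?thesis using ad by (auto simp: energy_def)
qed

text \<open>With e = 1 / (4 \<open>cW\<close>) the bound on \<open>J\<close> uses up a quarter of
  \<open>Q\<close>, so half of \<open>Q\<close> minus \<open>J\<close> retains another quarter up to
  a constant.\<close>

lemma energy_coercive: "\<exists>C. \<forall>u g. adm u g \<longrightarrow> Q u g / 4 - C \<le> energy u g"
proof -
  have c: "1 / (4 * cW) > 0" using cW_ge_1 by simp
  obtain C where C: "\<forall>u. u \<in> borel_measurable lebesgue \<longrightarrow> integrable lebesgue (\<lambda>x. W x * (u x)\<^sup>2) \<longrightarrow>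
    \<bar>J u\<bar> \<le> 1 / (4 * cW) * (\<integral>x. W x * (u x)\<^sup>2 \<partial>lebesgue) + C"
    using J_abs_bound[OF c] by blast
  have "Q u g / 4 - C \<le> energy u g" if a: "adm u g" for u g
  proof -
    have "\<bar>J u\<bar> \<le> 1 / (4 * cW) * (\<integral>x. W x * (u x)\<^sup>2 \<partial>lebesgue) + C"
      using C admD(1)[OF a] adm_W(1)[OF a] by blast
    also have "1 / (4 * cW) * (\<integral>x. W x * (u x)\<^sup>2 \<partial>lebesgue) \<le> 1 / (4 * cW) * (cW * Q u g)"
      using c by (intro mult_left_mono adm_W(2)[OF a]) auto
    also have "\<dots> = Q u g / 4" using cW_ge_1 by simp
    finally show ?thesis by (simp add: energy_def)
  qed
  then show ?thesis by blast
qed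

end

section \<open>The minimizer\<close>

context sublinear_problem
begin

text \<open>Since \<open>J\<close> is continuous along almost everywhere convergent bounded sequences, the parallelogram
  identity upgrades a pointwise convergent minimizing sequence to one with strongly convergent
  gradients; no weak compactness is needed.\<close>

theorem minimizer_exists:
  "\<exists>u g. adm u g \<and> (AE x in lebesgue. u x \<ge> 0) \<and> (\<forall>h k. adm h k \<longrightarrow> energy u g \<le> energy h k)"
proof -
  obtain C where C: "\<And>u g. adm u g \<Longrightarrow> Q u g / 4 - C \<le> energy u g" using energy_coercive by blast
  define S where "S = {energy u g |u g. adm u g}"
  have S0: "S \<noteq> {}" using adm_zero by (auto simp: S_def)
  have Sb: "bdd_below S"
  proof (rule bdd_belowI[of _ "- C"])
    fix y assume "y \<in> S"
    then obtain u g where "adm u g" "y = energy u g" by (auto simp: S_def)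
    then show "- C \<le> y" using C[of u g] Q_nonneg[of u g] by linarith
  qed
  define m where "m = Inf S"
  have m_le: "m \<le> energy u g" if "adm u g" for u g
    unfolding m_def using Sb that by (intro cInf_lower) (auto simp: S_def)
  have "\<exists>u g. adm u g \<and> (\<forall>x. u x \<ge> 0) \<and> energy u g < m + 1 / real (Suc k)" for k
  proof -
    have "\<exists>y\<in>S. y < m + 1 / real (Suc k)"
      using cInf_lessD[OF S0, of "m + 1 / real (Suc k)"] by (auto simp: m_def)
    then obtain u g where ug: "adm u g" "energy u g < m + 1 / real (Suc k)" by (auto simp: S_def)
    obtain g' where "adm (\<lambda>x. max 0 (u x)) g'" "energy (\<lambda>x. max 0 (u x)) g' \<le> energy u g"
      using adm_positive_part[OF ug(1)] by blast
    then show ?thesis using ug(2) by (intro exI[of _ "\<lambda>x. max 0 (u x)"] exI[of _ g']) auto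
  qed
  then obtain us gs where a0: "\<And>k. adm (us k) (gs k)" and nn0: "\<And>k x. us k x \<ge> 0"
    and e0: "\<And>k. energy (us k) (gs k) < m + 1 / real (Suc k)" by metis
  \<comment> \<open>All energies are below m + 1, and coercivity converts this into a bound for
    \<open>Q\<close>.\<close>
  define M where "M = 4 * (m + 1 + C)"
  have QM0: "Q (us k) (gs k) \<le> M" for k
  proof -
    have "energy (us k) (gs k) < m + 1" by (rule less_le_trans[OF e0]) simp
    with C[OF a0[of k]] have "Q (us k) (gs k) / 4 - C < m + 1" by (rule le_less_trans)
    then show ?thesis unfolding M_def by (simp add: field_simps)
  qed
  have gM0: "(\<integral>x. (norm (gs k x))\<^sup>2 \<partial>lebesgue) \<le> M" for k
    using Q_ge_grad[of "gs k" "us k"] QM0[of k] by linarith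
  obtain s :: "nat \<Rightarrow> nat" where s: "strict_mono s" and sc: "\<And>r. r > 0 \<Longrightarrow> convergent (\<lambda>j. profile (gs (s j)) r)"
    using profile_convergent_subsequence[of gs M, OF n3 admD(2)[OF a0] admD(3)[OF a0] gM0] by auto
  define U where "U j = us (s j)" for j
  define D where "D j = gs (s j)" for j
  have a: "adm (U j) (D j)" for j by (simp add: U_def D_def a0)
  have nn: "U j x \<ge> 0" for j x by (simp add: U_def nn0)
  have QM: "Q (U j) (D j) \<le> M" for j by (simp add: U_def D_def QM0)
  have gM: "(\<integral>x. (norm (D j x))\<^sup>2 \<partial>lebesgue) \<le> M" for j by (simp add: D_def gM0)
  have elim': "(\<lambda>j. energy (U j) (D j)) \<longlonglongrightarrow> m"
  proof (rule tendsto_sandwich[of "\<lambda>_. m" _ _ "\<lambda>j. m + 1 / real (Suc j)"])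
    show "\<forall>\<^sub>F j in sequentially. energy (U j) (D j) \<le> m + 1 / real (Suc j)"
    proof (rule always_eventually, rule allI)
      fix j
      have "1 / real (Suc (s j)) \<le> 1 / real (Suc j)" using seq_suble[OF s, of j] by (simp add: frac_le)
      then show "energy (U j) (D j) \<le> m + 1 / real (Suc j)" using e0[of "s j"] by (simp add: U_def D_def)
    qed
    have "(\<lambda>j. m + 1 / real (Suc j)) \<longlonglongrightarrow> m + 0"
      using LIMSEQ_inverse_real_of_nat by (intro tendsto_intros) (simp add: inverse_eq_divide)
    then show "(\<lambda>j. m + 1 / real (Suc j)) \<longlonglongrightarrow> m" by simp
  qed (use m_le[OF a] in auto)
  define v where "v r = lim (\<lambda>j. profile (D j) r)" for r
  define u where "u x = v (norm x)" for x :: "real^'n"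
  have vlim: "(\<lambda>j. profile (D j) r) \<longlonglongrightarrow> v r" if "r > 0" for r
    using sc[OF that] by (simp add: v_def D_def convergent_LIMSEQ_iff)
  have pm: "(\<lambda>x::real^'n. profile (D j) (norm x)) \<in> borel_measurable lebesgue" for j
    using profile_norm_measurable[OF n3 admD(2,3)[OF a]] by (intro measurable_completion) auto
  have um: "u \<in> borel_measurable lebesgue"
    unfolding u_def v_def by (rule borel_measurable_lim_metric[OF pm])
  have rep: "AE x in lebesgue. \<forall>j. U j x = profile (D j) (norm x)"
    unfolding AE_all_countable using adm_profile[OF a] by blast
  have Ulim: "AE x in lebesgue. (\<lambda>j. U j x) \<longlonglongrightarrow> u x"
    using rep AE_nonzero by eventually_elim (simp add: u_def vlim)
  have WA: "(\<integral>x. W x * (U j x)\<^sup>2 \<partial>lebesgue) \<le> cW * M" for j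
    using adm_W(2)[OF a[of j]] mult_left_mono[OF QM[of j], of cW] cW_ge_1 by linarith
  note JU = J_tendsto[OF admD(1)[OF a] um adm_W(1)[OF a] WA Ulim]
  \<comment> \<open>The two indices vary independently, so a failure would give sequences p and q
    tending to infinity. The averages along them still converge to u almost everywhere with bounded
    \<open>Q\<close>, and continuity of \<open>J\<close> contradicts the failure.\<close>
  have avg: "\<exists>N. \<forall>p\<ge>N. \<forall>q\<ge>N. \<bar>J (\<lambda>x. (U p x + U q x) / 2) - J u\<bar> < e" if e: "e > 0" for e
  proof (rule ccontr)
    assume "\<not> ?thesis"
    then have "\<forall>N. \<exists>p q. p \<ge> N \<and> q \<ge> N \<and> \<bar>J (\<lambda>x. (U p x + U q x) / 2) - J u\<bar> \<ge> e"
      by (meson not_le)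
    then obtain p q where pq: "\<And>N. p N \<ge> N" "\<And>N. q N \<ge> N"
      and bad: "\<And>N. \<bar>J (\<lambda>x. (U (p N) x + U (q N) x) / 2) - J u\<bar> \<ge> e" by metis
    let ?A = "\<lambda>N x. (U (p N) x + U (q N) x) / 2"
    have fp: "filterlim p sequentially sequentially" "filterlim q sequentially sequentially"
      using pq by (auto intro!: filterlim_at_top_mono[OF filterlim_ident] always_eventually)
    have aA: "adm (?A N) (\<lambda>x. (1/2) *\<^sub>R (D (p N) x + D (q N) x))" for N by (rule adm_average[OF a a])
    have QA: "Q (?A N) (\<lambda>x. (1/2) *\<^sub>R (D (p N) x + D (q N) x)) \<le> M" for N
    proof -
      have "0 \<le> (\<integral>x. (norm (D (p N) x - D (q N) x))\<^sup>2 \<partial>lebesgue) / 4" by simp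
      moreover have "b \<le> M" if "0 \<le> a" "a + b \<le> (c + d) / 2" "c \<le> M" "d \<le> M" for a b c d :: real
        using that by (simp add: field_simps)
      ultimately show ?thesis using Q_parallelogram[OF a[of "p N"] a[of "q N"]] QM[of "p N"] QM[of "q N"] by blast
    qed
    have WAA: "(\<integral>x. W x * (?A N x)\<^sup>2 \<partial>lebesgue) \<le> cW * M" for N
      using adm_W(2)[OF aA[of N]] mult_left_mono[OF QA[of N], of cW] cW_ge_1 by linarith
    have Alim: "AE x in lebesgue. (\<lambda>N. ?A N x) \<longlonglongrightarrow> u x"
      using Ulim
    proof eventually_elim
      case (elim x)
      have "(\<lambda>N. ?A N x) \<longlonglongrightarrow> (u x + u x) / 2"
        using filterlim_compose[OF elim fp(1)] filterlim_compose[OF elim fp(2)] by (intro tendsto_intros) auto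
      then show ?case by simp
    qed
    have "(\<lambda>N. J (?A N)) \<longlonglongrightarrow> J u"
      by (rule J_tendsto(3)[OF admD(1)[OF aA] um adm_W(1)[OF aA] WAA Alim])
    then obtain N where "\<bar>J (?A N) - J u\<bar> < e" using LIMSEQ_D[OF _ e] by fastforce
    then show False using bad[of N] by linarith
  qed
  have Cauchy_grad: "\<exists>N. \<forall>p\<ge>N. \<forall>q\<ge>N. (\<integral>x. (norm (D p x - D q x))\<^sup>2 \<partial>lebesgue) < e" if e: "e > 0" for e
  proof -
    \<comment> \<open>A quarter of the squared distance is bounded by two energy errors and four
      errors in \<open>J\<close>, six terms of size e/32; hence the distance is below 24 e /
      32.\<close>
    let ?e = "e / 32"
    have e': "?e > 0" using e by simp
    obtain N1 where N1: "\<And>p q. p \<ge> N1 \<Longrightarrow> q \<ge> N1 \<Longrightarrow> \<bar>J (\<lambda>x. (U p x + U q x) / 2) - J u\<bar> < ?e"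
      using avg[OF e'] by blast
    obtain N2 where N2: "\<And>p. p \<ge> N2 \<Longrightarrow> \<bar>J (U p) - J u\<bar> < ?e" using LIMSEQ_D[OF JU(3) e'] by auto
    obtain N3 where N3: "\<And>p. p \<ge> N3 \<Longrightarrow> \<bar>energy (U p) (D p) - m\<bar> < ?e" using LIMSEQ_D[OF elim' e'] by auto
    show ?thesis
    proof (intro exI allI impI)
      fix p q assume p: "p \<ge> max N1 (max N2 N3)" and q: "q \<ge> max N1 (max N2 N3)"
      let ?A = "\<lambda>x. (U p x + U q x) / 2" and ?G = "\<lambda>x. (1/2) *\<^sub>R (D p x + D q x)"
      have "m \<le> energy ?A ?G" by (rule m_le[OF adm_average[OF a a]])
      then have "Q ?A ?G \<ge> 2 * m + 2 * J ?A" by (simp add: energy_def)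
      moreover have "(\<integral>x. (norm (D p x - D q x))\<^sup>2 \<partial>lebesgue) / 4 + Q ?A ?G \<le> (Q (U p) (D p) + Q (U q) (D q)) / 2"
        by (rule Q_parallelogram[OF a a])
      moreover have "Q (U p) (D p) = 2 * energy (U p) (D p) + 2 * J (U p)" "Q (U q) (D q) = 2 * energy (U q) (D q) + 2 * J (U q)"
        by (auto simp: energy_def)
      moreover have "\<bar>J ?A - J u\<bar> < ?e" using p q by (intro N1) auto
      moreover have "\<bar>J (U p) - J u\<bar> < ?e" "\<bar>J (U q) - J u\<bar> < ?e" using p q by (intro N2; simp)+
      moreover have "\<bar>energy (U p) (D p) - m\<bar> < ?e" "\<bar>energy (U q) (D q) - m\<bar> < ?e" using p q by (intro N3; simp)+
      moreover have "d < e" if "a \<ge> 2 * m + 2 * j" "d / 4 + a \<le> (b + c) / 2" "b = 2 * x + 2 * j1" "c = 2 * y + 2 * j2"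
          "\<bar>j - j0\<bar> < e / 32" "\<bar>j1 - j0\<bar> < e / 32" "\<bar>j2 - j0\<bar> < e / 32" "\<bar>x - m\<bar> < e / 32" "\<bar>y - m\<bar> < e / 32"
        for a b c d j j0 j1 j2 x y :: real
      proof -
        have "e > 0" by (rule e)
        moreover have "j1 - j0 < e / 32" "j0 - j < e / 32" "j2 - j0 < e / 32" "x - m < e / 32" "y - m < e / 32"
          using that(5-9)[unfolded abs_less_iff] by simp_all
        ultimately show ?thesis using that(1-4) by (simp add: field_simps)
      qed
      ultimately show "(\<integral>x. (norm (D p x - D q x))\<^sup>2 \<partial>lebesgue) < e" by blast
    qed
  qed
  obtain g and t :: "nat \<Rightarrow> nat" where t: "strict_mono t" and gm: "g \<in> borel_measurable lebesgue"
    and Dlim: "AE x in lebesgue. (\<lambda>j. D (t j) x) \<longlonglongrightarrow> g x" and g2: "integrable lebesgue (\<lambda>x. (norm (g x))\<^sup>2)"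
    and Dg: "(\<lambda>j. \<integral>x. (norm (D (t j) x - g x))\<^sup>2 \<partial>lebesgue) \<longlonglongrightarrow> 0"
    by (rule L2_Cauchy_limit[of D lebesgue, OF admD(2)[OF a] admD(3)[OF a] Cauchy_grad])
  have tinf: "filterlim t sequentially sequentially" using t by (rule filterlim_subseq)
  let ?c = "profile_const TYPE('n) * sqrt M"
  let ?\<tau> = "\<lambda>x::real^'n. sqrt (norm x powr (2 - real CARD('n)))"
  have pc: "profile_const TYPE('n) \<ge> 0"
    using n3 sphere_vol_pos[where 'a="real^'n"] by (simp add: profile_const_def)
  have pbd: "\<bar>profile (D j) r\<bar> \<le> ?c * sqrt (r powr (2 - real CARD('n)))" if "r > 0" for j r
  proof -
    have "profile_const TYPE('n) * sqrt (\<integral>x. (norm (D j x))\<^sup>2 \<partial>lebesgue) \<le> ?c"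
      using pc gM by (intro mult_left_mono) auto
    from mult_right_mono[OF this, of "sqrt (r powr (2 - real CARD('n)))"]
    show ?thesis using profile_bound[OF n3 admD(2,3)[OF a] that, of j] by auto
  qed
  have vbd: "\<bar>v r\<bar> \<le> ?c * sqrt (r powr (2 - real CARD('n)))" if "r > 0" for r
    using tendsto_rabs[OF vlim[OF that]] pbd[OF that] by (intro LIMSEQ_le_const2) auto
  \<comment> \<open>The side with u passes to the limit by dominated convergence, the side with the
    gradients by convergence in mean and Cauchy-Schwarz.\<close>
  have wg: "weak_grad u g"
  proof (rule weak_gradI[OF gm])
    fix i :: 'n and \<phi> :: "real^'n \<Rightarrow> real" and G R
    assume CG: "C1grad \<phi> G" and "R > 0" and supp: "\<And>x. norm x > R \<Longrightarrow> \<phi> x = 0"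
    have G0: "G x = 0" if "norm x > R" for x by (rule C1grad_zero_outside[OF CG supp that])
    have Wk: "integrable lebesgue (\<lambda>x. U j x * G x $ i)" "integrable lebesgue (\<lambda>x. D j x $ i * \<phi> x)"
      "(\<integral>x. U j x * G x $ i \<partial>lebesgue) = - (\<integral>x. D j x $ i * \<phi> x \<partial>lebesgue)" for j
      using weak_gradD[where R=R and i=i, OF admD(7)[OF a[of j]] CG supp] by auto
    have Gm: "(\<lambda>x. G x $ i) \<in> borel_measurable lebesgue"
      using C1gradD(2)[OF CG] by (intro measurable_completion) (auto intro!: borel_measurable_continuous_onI continuous_intros)
    obtain b where b: "b > 0" "\<And>x. norm (G x) \<le> b"
      using bounded_continuous_bounded_support[OF C1gradD(2)[OF CG] G0] by metis
    \<comment> \<open>The common decay envelope |x|^(-(n-2)/2) of the profiles, which is integrable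
      on balls, times the bound of the test gradient.\<close>
    let ?dom = "\<lambda>x::real^'n. ?c * b * (indicator {..R} (norm x) * norm x powr ((2 - real CARD('n)) / 2))"
    have dom: "integrable lebesgue ?dom"
    proof -
      have "integrable lborel (\<lambda>x::real^'n. indicator {..R} (norm x) * norm x powr ((2 - real CARD('n)) / 2))"
        by (rule integrable_norm_powr_inside) (use n3 in \<open>simp add: field_simps\<close>)
      then have "integrable lebesgue (\<lambda>x::real^'n. indicator {..R} (norm x) * norm x powr ((2 - real CARD('n)) / 2))"
        by (subst integrable_completion) auto
      then show ?thesis by (rule integrable_mult_right)
    qed
    have bd: "AE x in lebesgue. norm (U (t j) x * G x $ i) \<le> ?dom x" for j
      using rep AE_nonzero
    proof eventually_elim
      case (elim x)
      show ?case
      proof (cases "norm x \<le> R")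
        case True
        have "sqrt (norm x powr (2 - real CARD('n))) = norm x powr ((2 - real CARD('n)) / 2)"
          by (simp add: powr_half_sqrt[symmetric] powr_powr)
        then have "\<bar>U (t j) x\<bar> \<le> ?c * norm x powr ((2 - real CARD('n)) / 2)"
          using pbd[of "norm x" "t j"] elim by simp
        moreover have "\<bar>G x $ i\<bar> \<le> b" using component_le_norm_cart[of "G x" i] b(2)[of x] by linarith
        ultimately have "\<bar>U (t j) x\<bar> * \<bar>G x $ i\<bar> \<le> (?c * norm x powr ((2 - real CARD('n)) / 2)) * b"
          by (intro mult_mono) auto
        then show ?thesis using True by (simp add: abs_mult mult_ac)
      qed (simp add: G0)
    qed
    have lim1: "AE x in lebesgue. (\<lambda>j. U (t j) x * G x $ i) \<longlonglongrightarrow> u x * G x $ i"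
      using Ulim by eventually_elim (intro tendsto_intros filterlim_compose[OF _ tinf], assumption)
    have m1: "(\<lambda>x. u x * G x $ i) \<in> borel_measurable lebesgue" using um Gm by auto
    have m2: "(\<lambda>x. U (t j) x * G x $ i) \<in> borel_measurable lebesgue" for j using Wk(1) by auto
    have i1: "integrable lebesgue (\<lambda>x. u x * G x $ i)"
      by (rule integrable_dominated_convergence[OF m1 m2 dom lim1 bd])
    have c1: "(\<lambda>j. \<integral>x. U (t j) x * G x $ i \<partial>lebesgue) \<longlonglongrightarrow> (\<integral>x. u x * G x $ i \<partial>lebesgue)"
      by (rule integral_dominated_convergence[OF m1 m2 dom lim1 bd])
    have \<phi>m: "\<phi> \<in> borel_measurable lebesgue"
      using borel_measurable_continuous_onI[OF C1gradD(3)[OF CG]] by (intro measurable_completion) auto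
    have \<phi>2: "integrable lebesgue (\<lambda>x. (\<phi> x)\<^sup>2)"
      by (rule integrable_continuous_bounded_support(2)[of _ R]) (use supp in \<open>auto intro!: continuous_intros C1gradD(3)[OF CG]\<close>)
    have comp: "integrable lebesgue (\<lambda>x. h x $ i * \<phi> x) \<and>
        \<bar>\<integral>x. h x $ i * \<phi> x \<partial>lebesgue\<bar> \<le> sqrt (\<integral>x. (norm (h x))\<^sup>2 \<partial>lebesgue) * sqrt (\<integral>x. (\<phi> x)\<^sup>2 \<partial>lebesgue)"
      if hm: "h \<in> borel_measurable lebesgue" and h2: "integrable lebesgue (\<lambda>x. (norm (h x))\<^sup>2)" for h :: "real^'n \<Rightarrow> real^'n"
    proof -
      have him: "(\<lambda>x. h x $ i) \<in> borel_measurable lebesgue"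
        by (rule measurable_compose[OF hm borel_measurable_continuous_onI]) (intro continuous_intros)
      have le: "(h x $ i)\<^sup>2 \<le> (norm (h x))\<^sup>2" for x
        using power_mono[OF component_le_norm_cart[of "h x" i], of 2] by simp
      have hi: "integrable lebesgue (\<lambda>x. (h x $ i)\<^sup>2)"
        by (rule Bochner_Integration.integrable_bound[OF h2]) (use him le in auto)
      note cs = Cauchy_Schwarz_integral[OF him \<phi>m hi \<phi>2]
      have "\<bar>\<integral>x. h x $ i * \<phi> x \<partial>lebesgue\<bar> \<le> sqrt (\<integral>x. (h x $ i)\<^sup>2 \<partial>lebesgue) * sqrt (\<integral>x. (\<phi> x)\<^sup>2 \<partial>lebesgue)"
        using integral_abs_bound[of lebesgue "\<lambda>x. h x $ i * \<phi> x"] cs(2) by linarith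
      also have "\<dots> \<le> sqrt (\<integral>x. (norm (h x))\<^sup>2 \<partial>lebesgue) * sqrt (\<integral>x. (\<phi> x)\<^sup>2 \<partial>lebesgue)"
        by (intro mult_right_mono real_sqrt_le_mono integral_mono[OF hi h2] le) auto
      finally show ?thesis using cs(1) by blast
    qed
    note gc = comp[OF gm g2]
    have c2: "(\<lambda>j. \<integral>x. D (t j) x $ i * \<phi> x \<partial>lebesgue) \<longlonglongrightarrow> (\<integral>x. g x $ i * \<phi> x \<partial>lebesgue)"
    proof -
      have "(\<lambda>j. (\<integral>x. D (t j) x $ i * \<phi> x \<partial>lebesgue) - (\<integral>x. g x $ i * \<phi> x \<partial>lebesgue)) \<longlonglongrightarrow> 0"
      proof (rule Lim_null_comparison)
        show "\<forall>\<^sub>F j in sequentially. norm ((\<integral>x. D (t j) x $ i * \<phi> x \<partial>lebesgue) - (\<integral>x. g x $ i * \<phi> x \<partial>lebesgue))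
            \<le> sqrt (\<integral>x. (norm (D (t j) x - g x))\<^sup>2 \<partial>lebesgue) * sqrt (\<integral>x. (\<phi> x)\<^sup>2 \<partial>lebesgue)"
        proof (rule always_eventually, rule allI)
          fix j
          have dm: "(\<lambda>x. D (t j) x - g x) \<in> borel_measurable lebesgue" using admD(2)[OF a] gm by auto
          have d2: "integrable lebesgue (\<lambda>x. (norm (D (t j) x - g x))\<^sup>2)"
            by (rule L2_integrable_diff[OF admD(2)[OF a] gm admD(3)[OF a] g2])
          have "(\<integral>x. D (t j) x $ i * \<phi> x \<partial>lebesgue) - (\<integral>x. g x $ i * \<phi> x \<partial>lebesgue) = (\<integral>x. (D (t j) x - g x) $ i * \<phi> x \<partial>lebesgue)"
            using Wk(2)[of "t j"] gc by (simp add: left_diff_distrib)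
          then show "norm ((\<integral>x. D (t j) x $ i * \<phi> x \<partial>lebesgue) - (\<integral>x. g x $ i * \<phi> x \<partial>lebesgue))
            \<le> sqrt (\<integral>x. (norm (D (t j) x - g x))\<^sup>2 \<partial>lebesgue) * sqrt (\<integral>x. (\<phi> x)\<^sup>2 \<partial>lebesgue)"
            using comp[OF dm d2] by simp
        qed
        have "(\<lambda>j. sqrt (\<integral>x. (norm (D (t j) x - g x))\<^sup>2 \<partial>lebesgue) * sqrt (\<integral>x. (\<phi> x)\<^sup>2 \<partial>lebesgue)) \<longlonglongrightarrow> sqrt 0 * sqrt (\<integral>x. (\<phi> x)\<^sup>2 \<partial>lebesgue)"
          by (intro tendsto_intros Dg)
        then show "(\<lambda>j. sqrt (\<integral>x. (norm (D (t j) x - g x))\<^sup>2 \<partial>lebesgue) * sqrt (\<integral>x. (\<phi> x)\<^sup>2 \<partial>lebesgue)) \<longlonglongrightarrow> 0" by simp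
      qed
      then show ?thesis by (simp add: LIM_zero_iff)
    qed
    have "(\<integral>x. u x * G x $ i \<partial>lebesgue) = - (\<integral>x. g x $ i * \<phi> x \<partial>lebesgue)"
    proof -
      have "(\<integral>x. U (t j) x * G x $ i \<partial>lebesgue) = - (\<integral>x. D (t j) x $ i * \<phi> x \<partial>lebesgue)" for j by (rule Wk(3))
      then have "(\<lambda>j. \<integral>x. U (t j) x * G x $ i \<partial>lebesgue) = (\<lambda>j. - (\<integral>x. D (t j) x $ i * \<phi> x \<partial>lebesgue))" by (rule ext)
      from c1[unfolded this] tendsto_minus[OF c2] show ?thesis by (rule LIMSEQ_unique)
    qed
    then show "integrable lebesgue (\<lambda>x. u x * G x $ i) \<and> integrable lebesgue (\<lambda>x. g x $ i * \<phi> x) \<and>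
      (\<integral>x. u x * G x $ i \<partial>lebesgue) = - (\<integral>x. g x $ i * \<phi> x \<partial>lebesgue)"
      using i1 gc by blast
  qed
  have u0: "AE x in lebesgue. u x \<ge> 0"
    using Ulim by eventually_elim (auto intro: LIMSEQ_le_const simp: nn)
  \<comment> \<open>Lower semicontinuity of \<open>Q\<close> by Fatou's lemma. The limit of the
    values of \<open>Q\<close> is 2 (m + J u), since energies and values of \<open>J\<close>
    converge; dropping \<open>j0\<close> terms gives a uniform bound up to e.\<close>
  have EF: "integrable lebesgue (\<lambda>x. (norm (g x))\<^sup>2 + V (norm x) * (u x)\<^sup>2) \<and>
      (\<integral>x. (norm (g x))\<^sup>2 + V (norm x) * (u x)\<^sup>2 \<partial>lebesgue) \<le> 2 * (m + J u) + e" if e: "e > 0" for e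
  proof -
    have "(\<lambda>j. 2 * (energy (U (t j)) (D (t j)) + J (U (t j)))) \<longlonglongrightarrow> 2 * (m + J u)"
      using filterlim_compose[OF elim' tinf] filterlim_compose[OF JU(3) tinf] by (intro tendsto_intros) auto
    then obtain j0 where j0: "\<And>j. j \<ge> j0 \<Longrightarrow> \<bar>2 * (energy (U (t j)) (D (t j)) + J (U (t j))) - 2 * (m + J u)\<bar> < e"
      using LIMSEQ_D[OF _ e] by fastforce
    let ?f = "\<lambda>j x. (norm (D (t (j + j0)) x))\<^sup>2 + V (norm x) * (U (t (j + j0)) x)\<^sup>2"
    have fi: "integrable lebesgue (?f j)" for j using admD(3,4)[OF a] by auto
    have fn: "AE x in lebesgue. 0 \<le> ?f j x" for j
      using V_term_nonneg[of "U (t (j + j0))"] by eventually_elim simp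
    have fA: "(\<integral>x. ?f j x \<partial>lebesgue) \<le> 2 * (m + J u) + e" for j
    proof -
      have "(\<integral>x. ?f j x \<partial>lebesgue) = Q (U (t (j + j0))) (D (t (j + j0)))" unfolding Q_def using admD(3,4)[OF a] by simp
      also have "\<dots> = 2 * (energy (U (t (j + j0))) (D (t (j + j0))) + J (U (t (j + j0))))" by (simp add: energy_def)
      also have "\<dots> \<le> 2 * (m + J u) + e" using j0[of "j + j0"] by simp
      finally show ?thesis .
    qed
    have fl: "AE x in lebesgue. (\<lambda>j. ?f j x) \<longlonglongrightarrow> (norm (g x))\<^sup>2 + V (norm x) * (u x)\<^sup>2"
      using Dlim Ulim
    proof eventually_elim
      case (elim x)
      have "(\<lambda>j. D (t (j + j0)) x) \<longlonglongrightarrow> g x" using elim(1) by (rule LIMSEQ_ignore_initial_segment)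
      moreover have "(\<lambda>j. U (t (j + j0)) x) \<longlonglongrightarrow> u x"
        using LIMSEQ_ignore_initial_segment[OF filterlim_compose[OF elim(2) tinf]] .
      ultimately show ?case by (intro tendsto_intros)
    qed
    have fm: "(\<lambda>x. (norm (g x))\<^sup>2 + V (norm x) * (u x)\<^sup>2) \<in> borel_measurable lebesgue" using gm um V_meas by auto
    show ?thesis using Fatou_integrable[OF fi fn fA fl fm] by blast
  qed
  have Vi: "integrable lebesgue (\<lambda>x. V (norm x) * (u x)\<^sup>2)"
  proof -
    have "integrable lebesgue (\<lambda>x. ((norm (g x))\<^sup>2 + V (norm x) * (u x)\<^sup>2) - (norm (g x))\<^sup>2)"
      using EF[of 1] g2 by (intro Bochner_Integration.integrable_diff) auto
    then show ?thesis by simp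
  qed
  \<comment> \<open>The limit inherits the decay estimate, so the critical power is dominated by a
    multiple of W u^2, whose integrability came from \<open>J_tendsto\<close>.\<close>
  have p_int: "integrable lebesgue (\<lambda>x. \<bar>u x\<bar> powr (2 * real CARD('n) / (real CARD('n) - 2)))"
  proof -
    define d where "d = real CARD('n) - 2"
    have d: "d > 0" "real CARD('n) = d + 2" using n3 by (auto simp: d_def)
    have M0: "M \<ge> 0" using QM[of 0] Q_nonneg[of "U 0" "D 0"] by linarith
    show ?thesis
    proof (rule Bochner_Integration.integrable_bound)
      show "integrable lebesgue (\<lambda>x. ?c powr (4 / d) * (W x * (u x)\<^sup>2))" using JU(1) by (rule integrable_mult_right)
      show "AE x in lebesgue. norm (\<bar>u x\<bar> powr (2 * real CARD('n) / (real CARD('n) - 2))) \<le> norm (?c powr (4 / d) * (W x * (u x)\<^sup>2))"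
        using AE_nonzero
      proof eventually_elim
        case (elim x)
        have "\<bar>u x\<bar> powr (2 * (d + 2) / d) \<le> ?c powr (4 / d) * ((u x)\<^sup>2 / (norm x)\<^sup>2)"
          by (rule critical_powr_bound) (use d vbd[of "norm x"] elim pc M0 in \<open>auto simp: u_def\<close>)
        also have "\<dots> \<le> ?c powr (4 / d) * (W x * (u x)\<^sup>2)"
        proof (intro mult_left_mono)
          have "0 \<le> V (norm x) * (u x)\<^sup>2" using V_nonneg elim by simp
          then show "(u x)\<^sup>2 / (norm x)\<^sup>2 \<le> W x * (u x)\<^sup>2" by (simp add: W_def distrib_right)
        qed simp
        finally have "\<bar>u x\<bar> powr (2 * (d + 2) / d) \<le> ?c powr (4 / d) * (W x * (u x)\<^sup>2)" .
        then show ?case by (simp add: d)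
      qed
    qed (use um in auto)
  qed
  have au: "adm u g"
    unfolding adm_def H1Vr_def D12_def radial_def using um p_int wg g2 Vi by (auto simp: u_def)
  have "Q u g \<le> 2 * (m + J u)"
  proof (rule field_le_epsilon)
    fix e :: real assume "e > 0"
    then show "Q u g \<le> 2 * (m + J u) + e" using EF[of e] g2 Vi by (simp add: Q_def)
  qed
  then have "energy u g \<le> m" by (simp add: energy_def)
  then show ?thesis using au u0 m_le by (meson order_trans)
qed

section \<open>First variation and the weak equation\<close>

lemma growth_term_dominated:
  assumes Wu: "integrable lebesgue (\<lambda>x. W x * (u x)\<^sup>2)"
    and Wh: "integrable lebesgue (\<lambda>x. W x * (h x)\<^sup>2)"
  shows "\<exists>d. integrable lebesgue d \<and> (AE x in lebesgue. K (norm x) * (\<bar>h x\<bar> * B (\<bar>u x\<bar> + \<bar>h x\<bar>)) \<le> d x)"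
proof -
  obtain C where C: "C \<ge> 0" and b: "\<forall>x t. x \<noteq> 0 \<longrightarrow> t \<ge> 0 \<longrightarrow>
      K (norm x) * (t * B t) \<le> 1 * ((V (norm x) + 1 / (norm x)\<^sup>2) * t\<^sup>2) + C * w x"
    using weights[of 1] by auto
  let ?d = "\<lambda>x. 2 * (W x * (u x)\<^sup>2) + 2 * (W x * (h x)\<^sup>2) + C * w x"
  have "integrable lebesgue ?d" using Wu Wh w_int by auto
  moreover have "AE x in lebesgue. K (norm x) * (\<bar>h x\<bar> * B (\<bar>u x\<bar> + \<bar>h x\<bar>)) \<le> ?d x"
    using AE_nonzero
  proof eventually_elim
    case (elim x)
    let ?t = "\<bar>u x\<bar> + \<bar>h x\<bar>"
    have "K (norm x) * (\<bar>h x\<bar> * B ?t) \<le> K (norm x) * (?t * B ?t)"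
      using K_nonneg elim B_nonneg[of ?t] by (intro mult_left_mono mult_right_mono) auto
    also have "\<dots> \<le> W x * ?t\<^sup>2 + C * w x" using b[rule_format, of x ?t] elim by (simp add: W_def)
    also have "?t\<^sup>2 \<le> 2 * (u x)\<^sup>2 + 2 * (h x)\<^sup>2"
      using sum_squares_bound[of "\<bar>u x\<bar>" "\<bar>h x\<bar>"] by (simp add: power2_sum)
    then have "W x * ?t\<^sup>2 + C * w x \<le> W x * (2 * (u x)\<^sup>2 + 2 * (h x)\<^sup>2) + C * w x"
      using W_nonneg[OF elim] by (intro add_right_mono mult_left_mono)
    also have "\<dots> = ?d x" by (simp add: algebra_simps)
    finally show ?case .
  qed
  ultimately show ?thesis by blast
qed

lemma L2_inner_integrable:
  fixes g k :: "real^'n \<Rightarrow> real^'n"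
  assumes "g \<in> borel_measurable lebesgue" "k \<in> borel_measurable lebesgue"
    "integrable lebesgue (\<lambda>x. (norm (g x))\<^sup>2)" "integrable lebesgue (\<lambda>x. (norm (k x))\<^sup>2)"
  shows "integrable lebesgue (\<lambda>x. g x \<bullet> k x)"
proof (rule Bochner_Integration.integrable_bound)
  show "integrable lebesgue (\<lambda>x. norm (g x) * norm (k x))"
    by (rule Cauchy_Schwarz_integral(1)) (use assms in auto)
qed (use assms Cauchy_Schwarz_ineq2 in auto)

lemma adm_V_inner_integrable:
  assumes "adm u g" "adm h k"
  shows "integrable lebesgue (\<lambda>x. V (norm x) * u x * h x)"
proof (rule Bochner_Integration.integrable_bound)
  note a = admD[OF assms(1)] and b = admD[OF assms(2)]
  show "integrable lebesgue (\<lambda>x. V (norm x) * (u x)\<^sup>2 + V (norm x) * (h x)\<^sup>2)" using a(4) b(4) by auto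
  show "(\<lambda>x. V (norm x) * u x * h x) \<in> borel_measurable lebesgue" using V_meas a(1) b(1) by auto
  show "AE x in lebesgue. norm (V (norm x) * u x * h x) \<le> norm (V (norm x) * (u x)\<^sup>2 + V (norm x) * (h x)\<^sup>2)"
    using AE_nonzero
  proof eventually_elim
    case (elim x)
    have v: "V (norm x) \<ge> 0" using V_nonneg elim by simp
    have "\<bar>u x * h x\<bar> \<le> (u x)\<^sup>2 + (h x)\<^sup>2"
      using sum_squares_bound[of "\<bar>u x\<bar>" "\<bar>h x\<bar>"] mult_nonneg_nonneg[OF abs_ge_zero[of "u x"] abs_ge_zero[of "h x"]]
      unfolding abs_mult power2_abs by linarith
    then have "V (norm x) * \<bar>u x * h x\<bar> \<le> V (norm x) * ((u x)\<^sup>2 + (h x)\<^sup>2)" using v by (rule mult_left_mono)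
    then show ?case using v by (simp add: abs_mult distrib_left mult.assoc)
  qed
qed

text \<open>Minimality is used along u + t h with t decreasing to 0 through positive values, so only
  an inequality results; replacing h by -h later gives equality. The difference quotients of F are
  dominated because |u + t h| \<le> |u| + |h| for t \<le> 1 and \<open>B\<close> is
  monotone.\<close>

lemma minimizer_variational_inequality:
  assumes u: "adm u g" and min: "\<forall>h k. adm h k \<longrightarrow> energy u g \<le> energy h k" and h: "adm h k"
  shows "integrable lebesgue (\<lambda>x. K (norm x) * f (max 0 (u x)) * h x)"
    and "(\<integral>x. K (norm x) * f (max 0 (u x)) * h x \<partial>lebesgue) \<le>
      (\<integral>x. g x \<bullet> k x \<partial>lebesgue) + (\<integral>x. V (norm x) * u x * h x \<partial>lebesgue)"
proof -
  note a = admD[OF u] and b = admD[OF h]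
  define t where "t j = 1 / real (Suc j)" for j
  have t: "t j > 0" "t j \<le> 1" for j by (auto simp: t_def)
  have tl: "t \<longlonglongrightarrow> 0" unfolding t_def using LIMSEQ_inverse_real_of_nat by (simp add: inverse_eq_divide)
  have tl': "filterlim t (at 0) sequentially"
    unfolding filterlim_at using tl t(1) by (auto simp: less_imp_neq[symmetric])
  let ?q = "\<lambda>j x. K (norm x) * ((Fprim f (u x + t j * h x) - Fprim f (u x)) / t j)"
  let ?l = "\<lambda>x. K (norm x) * f (max 0 (u x)) * h x"
  obtain d where d: "integrable lebesgue d" "AE x in lebesgue. K (norm x) * (\<bar>h x\<bar> * B (\<bar>u x\<bar> + \<bar>h x\<bar>)) \<le> d x"
    using growth_term_dominated[OF adm_W(1)[OF u] adm_W(1)[OF h]] by blast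
  have Fm: "continuous_on UNIV (\<lambda>t. f (max 0 t))"
    by (rule continuous_on_compose2[OF f_cont]) (auto intro!: continuous_intros)
  have fm: "(\<lambda>x. f (max 0 (u x))) \<in> borel_measurable lebesgue"
    using measurable_compose[OF a(1) borel_measurable_continuous_onI[OF Fm]] .
  have lm: "?l \<in> borel_measurable lebesgue" using K_meas fm b(1) by auto
  have qm: "?q j \<in> borel_measurable lebesgue" for j
    using K_meas F_meas[OF a(1)] F_meas[of "\<lambda>x. u x + t j * h x"] a(1) b(1) by auto
  have lim: "AE x in lebesgue. (\<lambda>j. ?q j x) \<longlonglongrightarrow> ?l x"
  proof (rule AE_I2)
    fix x
    have "((\<lambda>s. Fprim f (u x + s * h x)) has_real_derivative f (max 0 (u x + 0 * h x)) * h x) (at 0)"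
      by (rule DERIV_chain2[OF F_deriv]) (auto intro!: derivative_eq_intros)
    then have "(\<lambda>s. (Fprim f (u x + s * h x) - Fprim f (u x)) / s) \<midarrow>0\<rightarrow> f (max 0 (u x)) * h x"
      by (simp add: DERIV_def)
    from tendsto_mult_left[OF filterlim_compose[OF this tl'], of "K (norm x)"]
    show "(\<lambda>j. ?q j x) \<longlonglongrightarrow> ?l x" by (simp add: mult.assoc)
  qed
  have bd: "AE x in lebesgue. norm (?q j x) \<le> d x" for j
    using d(2) AE_nonzero
  proof eventually_elim
    case (elim x)
    let ?T = "\<bar>u x\<bar> + \<bar>h x\<bar>"
    have "\<bar>t j * h x\<bar> \<le> 1 * \<bar>h x\<bar>" unfolding abs_mult using t[of j] by (intro mult_right_mono) auto
    then have "\<bar>u x + t j * h x\<bar> \<le> ?T" by linarith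
    then have "\<bar>Fprim f (u x + t j * h x) - Fprim f (u x)\<bar> \<le> B ?T * \<bar>(u x + t j * h x) - u x\<bar>"
      by (intro F_diff) auto
    then have "\<bar>Fprim f (u x + t j * h x) - Fprim f (u x)\<bar> \<le> (\<bar>h x\<bar> * B ?T) * t j"
      using t[of j] by (simp add: abs_mult mult_ac)
    then have "\<bar>(Fprim f (u x + t j * h x) - Fprim f (u x)) / t j\<bar> \<le> \<bar>h x\<bar> * B ?T"
      using t[of j] by (simp add: divide_le_eq)
    then have "K (norm x) * \<bar>(Fprim f (u x + t j * h x) - Fprim f (u x)) / t j\<bar> \<le> K (norm x) * (\<bar>h x\<bar> * B ?T)"
      using K_nonneg elim(2) by (intro mult_left_mono) auto
    then show ?case using elim K_nonneg[of "norm x"] by (simp add: abs_mult)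
  qed
  show "integrable lebesgue ?l" by (rule integrable_dominated_convergence[OF lm qm d(1) lim bd])
  have c: "(\<lambda>j. \<integral>x. ?q j x \<partial>lebesgue) \<longlonglongrightarrow> (\<integral>x. ?l x \<partial>lebesgue)"
    by (rule integral_dominated_convergence[OF lm qm d(1) lim bd])
  let ?P = "(\<integral>x. g x \<bullet> k x \<partial>lebesgue) + (\<integral>x. V (norm x) * u x * h x \<partial>lebesgue)"
  have gk: "integrable lebesgue (\<lambda>x. g x \<bullet> k x)" by (rule L2_inner_integrable[OF a(2) b(2) a(3) b(3)])
  have uh: "integrable lebesgue (\<lambda>x. V (norm x) * u x * h x)" by (rule adm_V_inner_integrable[OF u h])
  \<comment> \<open>Expanding the quadratic form \<open>Q\<close> at u + t h in the minimality
    inequality and dividing by t > 0; the second-order term leaves an error of order t.\<close>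
  have le: "(\<integral>x. ?q j x \<partial>lebesgue) \<le> ?P + t j * (Q h k / 2)" for j
  proof -
    let ?u = "\<lambda>x. u x + t j * h x" and ?g = "\<lambda>x. g x + t j *\<^sub>R k x"
    have ad: "adm ?u ?g" by (rule adm_add_scaled[OF u h])
    have g_exp: "(norm (?g x))\<^sup>2 = (norm (g x))\<^sup>2 + (2 * t j * (g x \<bullet> k x) + (t j)\<^sup>2 * (norm (k x))\<^sup>2)" for x
      unfolding power2_norm_eq_inner by (simp add: inner_add_left inner_add_right inner_commute algebra_simps power2_eq_square)
    have u_exp: "V (norm x) * (?u x)\<^sup>2 = V (norm x) * (u x)\<^sup>2 + (2 * t j * (V (norm x) * u x * h x) + (t j)\<^sup>2 * (V (norm x) * (h x)\<^sup>2))" for x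
      by (simp add: algebra_simps power2_eq_square)
    have "(\<integral>x. (norm (?g x))\<^sup>2 \<partial>lebesgue) = (\<integral>x. (norm (g x))\<^sup>2 \<partial>lebesgue) +
        (2 * t j * (\<integral>x. g x \<bullet> k x \<partial>lebesgue) + (t j)\<^sup>2 * (\<integral>x. (norm (k x))\<^sup>2 \<partial>lebesgue))"
      unfolding g_exp using a(3) b(3) gk by simp
    moreover have "(\<integral>x. V (norm x) * (?u x)\<^sup>2 \<partial>lebesgue) = (\<integral>x. V (norm x) * (u x)\<^sup>2 \<partial>lebesgue) +
        (2 * t j * (\<integral>x. V (norm x) * u x * h x \<partial>lebesgue) + (t j)\<^sup>2 * (\<integral>x. V (norm x) * (h x)\<^sup>2 \<partial>lebesgue))"
      unfolding u_exp using a(4) b(4) uh by simp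
    ultimately have "Q ?u ?g = Q u g + 2 * t j * ?P + (t j)\<^sup>2 * Q h k"
      unfolding Q_def by (simp only: distrib_left add_ac)
    then have "J ?u - J u \<le> t j * ?P + (t j)\<^sup>2 * Q h k / 2"
      using min[rule_format, OF ad] unfolding energy_def by (simp add: field_simps)
    moreover have "(\<integral>x. ?q j x \<partial>lebesgue) = (J ?u - J u) / t j"
    proof -
      have "(\<integral>x. ?q j x \<partial>lebesgue) = (\<integral>x. (K (norm x) * Fprim f (?u x) - K (norm x) * Fprim f (u x)) / t j \<partial>lebesgue)"
        by (intro Bochner_Integration.integral_cong) (auto simp: right_diff_distrib)
      also have "\<dots> = (J ?u - J u) / t j"
        unfolding J_def
        using KF_integrable[OF a(1) adm_W(1)[OF u]] KF_integrable[OF admD(1)[OF ad] adm_W(1)[OF ad]] by simp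
      finally show ?thesis .
    qed
    ultimately show ?thesis using t[of j] by (simp add: divide_le_eq power2_eq_square algebra_simps)
  qed
  have "(\<lambda>j. ?P + t j * (Q h k / 2)) \<longlonglongrightarrow> ?P + 0 * (Q h k / 2)" by (intro tendsto_intros tl)
  then show "(\<integral>x. ?l x \<partial>lebesgue) \<le> ?P" using LIMSEQ_le[OF c] le by fastforce
qed

theorem solution_if_negative_energy:
  assumes "adm h0 k0" "energy h0 k0 < 0"
  shows "\<exists>u :: real^'n \<Rightarrow> real. radial_solution V K f u
           \<and> (AE x in lebesgue. u x \<ge> 0) \<and> \<not> (AE x in lebesgue. u x = 0)"
proof -
  obtain u g where u: "adm u g" and nn: "AE x in lebesgue. u x \<ge> 0"
    and min: "\<forall>h k. adm h k \<longrightarrow> energy u g \<le> energy h k" using minimizer_exists by blast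
  \<comment> \<open>A function that vanishes almost everywhere has \<open>J\<close> equal to 0 and
    hence nonnegative energy, whereas the minimum is negative.\<close>
  have "\<not> (AE x in lebesgue. u x = 0)"
  proof
    assume z: "AE x in lebesgue. u x = 0"
    have "J u = (\<integral>x. 0 \<partial>(lebesgue :: (real^'n) measure))"
      unfolding J_def
    proof (rule integral_cong_AE)
      show "(\<lambda>x. K (norm x) * Fprim f (u x)) \<in> borel_measurable lebesgue" using K_meas F_meas[OF admD(1)[OF u]] by auto
      show "AE x in lebesgue. K (norm x) * Fprim f (u x) = 0" using z by eventually_elim (simp add: Fprim_nonpos)
    qed auto
    then have "energy u g \<ge> 0" using Q_nonneg[of u g] by (simp add: energy_def)
    then show False using min assms by fastforce
  qed
  moreover have "radial_solution V K f u"
    unfolding radial_solution_def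
  proof (intro conjI allI impI)
    show "H1Vr V u" using u by (simp add: adm_def)
    fix g' gh and h :: "real^'n \<Rightarrow> real" assume g': "weak_grad u g'" and h: "H1Vr V h" and gh: "weak_grad h gh"
    obtain k where k: "weak_grad h k" "integrable lebesgue (\<lambda>x. (norm (k x))\<^sup>2)"
      using h by (auto simp: H1Vr_def D12_def)
    have ah: "adm h k" using h k by (simp add: adm_def)
    \<comment> \<open>The notion of solution quantifies over all weak gradients; uniqueness almost
      everywhere reduces them to the chosen square-integrable ones.\<close>
    have e1: "AE x in lebesgue. g' x = g x" by (rule weak_grad_unique[OF g' admD(7)[OF u]])
    have e2: "AE x in lebesgue. gh x = k x" by (rule weak_grad_unique[OF gh k(1)])
    have im: "(\<lambda>x. g' x \<bullet> gh x) \<in> borel_measurable lebesgue"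
      using g' gh by (auto simp: weak_grad_def)
    have gk: "integrable lebesgue (\<lambda>x. g x \<bullet> k x)"
      by (rule L2_inner_integrable[OF admD(2)[OF u] admD(2)[OF ah] admD(3)[OF u] admD(3)[OF ah]])
    have ae: "AE x in lebesgue. g' x \<bullet> gh x = g x \<bullet> k x" using e1 e2 by eventually_elim simp
    show "integrable lebesgue (\<lambda>x. g' x \<bullet> gh x)" using gk integrable_cong_AE[OF im _ ae] by auto
    have eqi: "(\<integral>x. g' x \<bullet> gh x \<partial>lebesgue) = (\<integral>x. g x \<bullet> k x \<partial>lebesgue)"
      by (rule integral_cong_AE[OF im _ ae]) (use gk in auto)
    show "integrable lebesgue (\<lambda>x. V (norm x) * u x * h x)" by (rule adm_V_inner_integrable[OF u ah])
    note v1 = minimizer_variational_inequality[OF u min ah]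
    note v2 = minimizer_variational_inequality(2)[OF u min adm_scale[OF ah, of "-1"]]
    have mf: "(\<lambda>x. K (norm x) * f (u x) * h x) \<in> borel_measurable lebesgue"
      using K_meas admD(1)[OF ah] measurable_compose[OF admD(1)[OF u] borel_measurable_continuous_onI[OF f_cont]] by auto
    \<comment> \<open>Nonnegativity of the minimizer removes the truncation from the
      equation.\<close>
    have aef: "AE x in lebesgue. K (norm x) * f (u x) * h x = K (norm x) * f (max 0 (u x)) * h x"
      using nn by eventually_elim (simp add: max_def)
    show "integrable lebesgue (\<lambda>x. K (norm x) * f (u x) * h x)" using v1(1) integrable_cong_AE[OF mf _ aef] by auto
    have eqf: "(\<integral>x. K (norm x) * f (u x) * h x \<partial>lebesgue) = (\<integral>x. K (norm x) * f (max 0 (u x)) * h x \<partial>lebesgue)"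
      by (rule integral_cong_AE[OF mf _ aef]) (use v1(1) in auto)
    show "(\<integral>x. g' x \<bullet> gh x \<partial>lebesgue) + (\<integral>x. V (norm x) * u x * h x \<partial>lebesgue) = (\<integral>x. K (norm x) * f (u x) * h x \<partial>lebesgue)"
      using v1(2) v2 unfolding eqi eqf by simp
  qed
  ultimately show ?thesis using nn by blast
qed

end

section \<open>Exponents and the main theorem\<close>

lemma Liminf_pos_eventually_ge:
  fixes h :: "'a \<Rightarrow> real"
  assumes "Liminf F (\<lambda>x. ereal (h x)) > 0"
  shows "\<exists>c>0. \<forall>\<^sub>F x in F. h x > c"
proof -
  obtain c where c: "0 < ereal c" "ereal c < Liminf F (\<lambda>x. ereal (h x))"
    using ereal_dense2[OF assms] by auto
  then show ?thesis using less_LiminfD[OF c(2)] by auto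
qed

lemma Limsup_less_PInf_eventually_le:
  fixes h :: "'a \<Rightarrow> real"
  assumes "Limsup F (\<lambda>x. ereal (h x)) < \<infinity>"
  shows "\<exists>C>0. \<forall>\<^sub>F x in F. h x < C"
proof -
  obtain c where c: "Limsup F (\<lambda>x. ereal (h x)) < ereal c" using ereal_dense2[OF assms] by auto
  have "\<forall>\<^sub>F x in F. h x < max c 1" using Limsup_lessD[OF c] by eventually_elim auto
  then show ?thesis by (intro exI[of _ "max c 1"]) auto
qed

text \<open>The single inequality that integrability near 0 requires. Depending on the sign of N +
  \<open>min a0 (-2)\<close> it is an upper or a lower bound for q, which is why parts of both
  endpoints of \<open>I1\<close> express it.\<close>

lemma I1_exponent_condition:
  assumes N: "N \<ge> (3::real)" and hb0: "b0 > Min {a0, -(N - a0)/2, -(N + 2)/2}" and q: "q \<in> I1 N a0 b0"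
  shows "1 < q" "q * (N + min a0 (-2)) < 2 * (N + b0)"
proof -
  have lo: "q_low1 N a0 b0 < q" and up: "ereal q < q_up1 N a0 b0" using q by (auto simp: I1_def)
  have "q_low1 N a0 b0 \<ge> 1" by (auto simp: q_low1_def)
  then show "1 < q" using lo by linarith
  consider "a0 \<ge> -2" | "-N < a0" "a0 < -2" | "a0 = -N" | "a0 < -N" by linarith
  then show "q * (N + min a0 (-2)) < 2 * (N + b0)"
  proof cases
    case 1
    then have "q < 2 * (N + b0) / (N - 2)" using up N by (auto simp: q_up1_def)
    then show ?thesis using 1 N by (simp add: less_divide_eq)
  next
    case 2
    then have "q < 2 * (N + b0) / (N + a0)" using up N by (auto simp: q_up1_def)
    then show ?thesis using 2 by (simp add: less_divide_eq)
  next
    case 3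
    \<comment> \<open>Here the coefficient of q vanishes and the inequality reads N + b0 > 0. For a0
      = -N the minimum in the assumption on b0 is -N.\<close>
    then have "b0 > -N" using hb0 N by (auto simp: min_def split: if_splits)
    then show ?thesis using 3 N by simp
  next
    case 4
    then have "2 * (N + b0) / (N + a0) < q" using lo by (auto simp: q_low1_def split: if_splits)
    then show ?thesis using 4 N by (simp add: divide_less_eq)
  qed
qed

text \<open>Now N + \<open>max a (-2)\<close> is at least N - 2 > 0, so the inequality needed near
  infinity is always a lower bound for q.\<close>

lemma I2_exponent_condition:
  assumes N: "N \<ge> (3::real)" and q: "q \<in> I2 N a b"
  shows "1 < q" "2 * (N + b) < q * (N + max a (-2))"
proof -
  have lo: "q_low2 N a b < q" using q by (auto simp: I2_def)
  have "q_low2 N a b \<ge> 1" by (auto simp: q_low2_def)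
  then show "1 < q" using lo by linarith
  show "2 * (N + b) < q * (N + max a (-2))"
  proof (cases "a \<le> -2")
    case True
    then have "2 * (N + b) / (N - 2) < q" using lo by (auto simp: q_low2_def)
    then show ?thesis using True N by (simp add: divide_less_eq)
  next
    case False
    then have "2 * (N + b) / (N + a) < q" using lo by (auto simp: q_low2_def)
    then show ?thesis using False N by (simp add: divide_less_eq max_def)
  qed
qed

section \<open>Splitting and integrability of the weights\<close>

lemma continuous_bounded_on_interval:
  fixes p :: "real \<Rightarrow> real"
  assumes "continuous_on {0<..} p" "0 < r"
  shows "\<exists>C\<ge>0. \<forall>t\<in>{r..s}. p t \<le> C"
proof -
  have "compact (p ` {r..s})"
    by (intro compact_continuous_image continuous_on_subset[OF assms(1)]) (use assms(2) in auto)
  then obtain C where C: "C > 0" "\<And>y. y \<in> p ` {r..s} \<Longrightarrow> norm y \<le> C"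
    using compact_imp_bounded bounded_pos by metis
  then show ?thesis by (intro exI[of _ C]) (auto simp: abs_le_iff)
qed

text \<open>The power bound is available only for r < r0, while the weights are split at radius 1;
  compactness bounds the function on the interval between.\<close>

lemma integrable_radial_near_0:
  fixes p :: "real \<Rightarrow> real"
  assumes c: "continuous_on {0<..} p" and nn: "\<And>r. r > 0 \<Longrightarrow> p r \<ge> 0"
    and r0: "r0 > 0" and b: "\<And>r. 0 < r \<Longrightarrow> r < r0 \<Longrightarrow> p r \<le> C * r powr e" and e: "e > - real CARD('n)"
  shows "integrable lebesgue (\<lambda>x::real^'n. indicator {..1} (norm x) * p (norm x))"
proof -
  obtain D where D: "D \<ge> 0" "\<And>t. t \<in> {r0..1} \<Longrightarrow> p t \<le> D" using continuous_bounded_on_interval[OF c r0] by blast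
  have pm: "(\<lambda>x::real^'n. p (norm x)) \<in> borel_measurable lebesgue"
    using radial_weight_measurable[OF c] by (intro measurable_completion) auto
  have i: "integrable lebesgue (\<lambda>x::real^'n. indicator {..1} (norm x) * norm x powr s)" if "s > - real CARD('n)" for s
  proof -
    have "integrable lborel (\<lambda>x::real^'n. indicator {..1} (norm x) * norm x powr s)"
      by (rule integrable_norm_powr_inside) (use that in simp)
    then show ?thesis by (subst integrable_completion) auto
  qed
  show ?thesis
  proof (rule Bochner_Integration.integrable_bound)
    show "integrable lebesgue (\<lambda>x::real^'n. \<bar>C\<bar> * (indicator {..1} (norm x) * norm x powr e) + D * (indicator {..1} (norm x) * norm x powr 0))"
      using i[OF e] i[of 0] by auto
    show "(\<lambda>x::real^'n. indicator {..1} (norm x) * p (norm x)) \<in> borel_measurable lebesgue"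
      using pm indicator_norm_measurable[of "{..1}"] by (intro borel_measurable_times) auto
    show "AE x::real^'n in lebesgue. norm (indicator {..1} (norm x) * p (norm x)) \<le>
        norm (\<bar>C\<bar> * (indicator {..1} (norm x) * norm x powr e) + D * (indicator {..1} (norm x) * norm x powr 0))"
      using AE_norm_neq[of 0]
    proof eventually_elim
      case (elim x)
      then have x: "norm x > 0" by simp
      show ?case
      proof (cases "norm x \<le> 1")
        case True
        have "p (norm x) \<le> \<bar>C\<bar> * norm x powr e + D"
        proof (cases "norm x < r0")
          case l: True
          have "p (norm x) \<le> C * norm x powr e" by (rule b[OF x l])
          also have "\<dots> \<le> \<bar>C\<bar> * norm x powr e" by (intro mult_right_mono) auto
          finally show ?thesis using D(1) by linarith
        next
          case False
          then have "p (norm x) \<le> D" using True by (intro D(2)) auto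
          moreover have "0 \<le> \<bar>C\<bar> * norm x powr e" by simp
          ultimately show ?thesis by linarith
        qed
        then show ?thesis using True nn[OF x] x D(1) by simp
      qed simp
    qed
  qed
qed

lemma integrable_radial_near_infinity:
  fixes p :: "real \<Rightarrow> real"
  assumes c: "continuous_on {0<..} p" and nn: "\<And>r. r > 0 \<Longrightarrow> p r \<ge> 0"
    and b: "\<And>r. r > r0 \<Longrightarrow> p r \<le> C * r powr e" and e: "e < - real CARD('n)"
  shows "integrable lebesgue (\<lambda>x::real^'n. indicator {1<..} (norm x) * p (norm x))"
proof -
  obtain D where D: "D \<ge> 0" "\<And>t. t \<in> {1..r0} \<Longrightarrow> p t \<le> D" using continuous_bounded_on_interval[OF c, of 1 r0] by auto
  have pm: "(\<lambda>x::real^'n. p (norm x)) \<in> borel_measurable lebesgue"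
    using radial_weight_measurable[OF c] by (intro measurable_completion) auto
  have i1: "integrable lebesgue (\<lambda>x::real^'n. indicator {1..} (norm x) * norm x powr e)"
  proof -
    have "integrable lborel (\<lambda>x::real^'n. indicator {1..} (norm x) * norm x powr e)"
      by (rule integrable_norm_powr_outside(1)) (use e in auto)
    then show ?thesis by (subst integrable_completion) auto
  qed
  have i2: "integrable lebesgue (\<lambda>x::real^'n. indicator {..r0} (norm x) * norm x powr 0)"
  proof -
    have "integrable lborel (\<lambda>x::real^'n. indicator {..r0} (norm x) * norm x powr 0)"
      by (rule integrable_norm_powr_inside) auto
    then show ?thesis by (subst integrable_completion) auto
  qed
  show ?thesis
  proof (rule Bochner_Integration.integrable_bound)
    show "integrable lebesgue (\<lambda>x::real^'n. \<bar>C\<bar> * (indicator {1..} (norm x) * norm x powr e) + D * (indicator {..r0} (norm x) * norm x powr 0))"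
      using i1 i2 by auto
    show "(\<lambda>x::real^'n. indicator {1<..} (norm x) * p (norm x)) \<in> borel_measurable lebesgue"
      using pm indicator_norm_measurable[of "{1<..}"] by (intro borel_measurable_times) auto
    show "AE x::real^'n in lebesgue. norm (indicator {1<..} (norm x) * p (norm x)) \<le>
        norm (\<bar>C\<bar> * (indicator {1..} (norm x) * norm x powr e) + D * (indicator {..r0} (norm x) * norm x powr 0))"
    proof (rule AE_I2)
      fix x :: "real^'n"
      show "norm (indicator {1<..} (norm x) * p (norm x)) \<le>
        norm (\<bar>C\<bar> * (indicator {1..} (norm x) * norm x powr e) + D * (indicator {..r0} (norm x) * norm x powr 0))"
      proof (cases "norm x > 1")
        case True
        then have x: "norm x > 0" by linarith
        have "p (norm x) \<le> \<bar>C\<bar> * norm x powr e + D * indicator {..r0} (norm x)"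
        proof (cases "norm x > r0")
          case l: True
          have "p (norm x) \<le> C * norm x powr e" by (rule b[OF l])
          also have "\<dots> \<le> \<bar>C\<bar> * norm x powr e" by (intro mult_right_mono) auto
          finally show ?thesis using l by simp
        next
          case False
          then have "p (norm x) \<le> D" using True by (intro D(2)) auto
          then show ?thesis using False by (simp add: add_increasing)
        qed
        then show ?thesis using True nn[OF x] x D(1) by simp
      qed simp
    qed
  qed
qed

text \<open>A crude form of Young's inequality: replacing both factors by the maximum makes the
  exponents add up to 1.\<close>

lemma powr_weighted_product_le_sum:
  fixes a b l :: real
  assumes "a \<ge> 0" "b \<ge> 0" "0 < l" "l < 1"
  shows "a powr l * b powr (1 - l) \<le> a + b"
proof -
  have "a powr l * b powr (1 - l) \<le> max a b powr l * max a b powr (1 - l)"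
    using assms by (intro mult_mono powr_mono2) auto
  also have "\<dots> = max a b" using assms by (simp add: powr_add[symmetric])
  also have "\<dots> \<le> a + b" using assms by auto
  finally show ?thesis .
qed

text \<open>The weight that remains of \<open>K |t| powr q\<close> after splitting off a multiple of \<open>W t\<^sup>2\<close>.\<close>

definition dual_weight :: "(real \<Rightarrow> real) \<Rightarrow> (real \<Rightarrow> real) \<Rightarrow> real \<Rightarrow> real \<Rightarrow> real" where
  "dual_weight V K q r = K r powr (2 / (2 - q)) * (V r + 1 / r\<^sup>2) powr (- q / (2 - q))"

text \<open>Young's inequality with weights q/2 and 1 - q/2. The second term is chosen so that in
  the product all powers of e and of W cancel and K M t^q remains.\<close>

lemma dual_weight_split:
  assumes q: "1 < q" "q < (2::real)" and K: "K r \<ge> 0" and V: "V r \<ge> 0" and r: "r > 0" and e: "e > 0" and M: "M \<ge> 0" and t: "t \<ge> 0"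
  shows "K r * (M * t powr q) \<le> e * ((V r + 1 / r\<^sup>2) * t\<^sup>2) + (M * e powr (- q/2)) powr (2 / (2 - q)) * dual_weight V K q r"
proof (cases "t = 0")
  case True
  then show ?thesis by (simp add: dual_weight_def)
next
  case False
  define W where "W = V r + 1 / r\<^sup>2"
  have W: "W > 0" using V r by (simp add: W_def add_nonneg_pos)
  define A where "A = e * (W * t\<^sup>2)"
  define D where "D = (M * e powr (- q/2)) powr (2 / (2 - q)) * dual_weight V K q r"
  have A0: "A \<ge> 0" and D0: "D \<ge> 0" using e W by (auto simp: A_def D_def dual_weight_def)
  have s: "2 - q > 0" using q by simp
  have tq: "(t\<^sup>2) powr (q/2) = t powr q"
    using t False by (simp add: powr_powr flip: powr_numeral)
  have "A powr (q/2) = e powr (q/2) * (W powr (q/2) * t powr q)"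
    unfolding A_def using e W by (simp add: powr_mult tq)
  moreover have "D powr (1 - q/2) = (M * e powr (- q/2)) * (K r * W powr (- q/2))"
  proof -
    have ex: "2 / (2 - q) * (1 - q/2) = 1" "- q / (2 - q) * (1 - q/2) = - q/2"
      using s by (auto simp: field_simps)
    have "D powr (1 - q/2) = ((M * e powr (- q/2)) powr (2 / (2 - q))) powr (1 - q/2) *
        ((K r powr (2 / (2 - q))) powr (1 - q/2) * (W powr (- q / (2 - q))) powr (1 - q/2))"
      unfolding D_def dual_weight_def W_def[symmetric] by (simp add: powr_mult)
    also have "\<dots> = (M * e powr (- q/2)) powr 1 * (K r powr 1 * W powr (- q/2))"
      by (simp only: powr_powr ex)
    also have "\<dots> = (M * e powr (- q/2)) * (K r * W powr (- q/2))" using K M by simp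
    finally show ?thesis .
  qed
  ultimately have "A powr (q/2) * D powr (1 - q/2) = (e powr (q/2) * e powr (- q/2)) * (W powr (q/2) * W powr (- q/2)) * (K r * (M * t powr q))"
    by (simp only: mult_ac)
  also have "\<dots> = K r * (M * t powr q)" using e W by (simp add: powr_add[symmetric])
  finally have "K r * (M * t powr q) = A powr (q/2) * D powr (1 - q/2)" by simp
  also have "\<dots> \<le> A + D" by (rule powr_weighted_product_le_sum[OF A0 D0]) (use q in auto)
  finally show ?thesis by (simp add: A_def D_def W_def)
qed

text \<open>The exponent of W is negative, so a lower bound for W bounds the dual weight from above.
  The resulting power of r exceeds -N if and only if q (N + \<alpha>) < 2 (N + \<beta>), the
  inequality extracted from \<open>I1\<close>; its reverse belongs to \<open>I2\<close>.\<close>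

lemma dual_weight_bound:
  assumes q: "1 < q" "q < (2::real)" and r: "r > 0" and K: "0 \<le> K r" "K r \<le> C * r powr \<beta>" and C: "C \<ge> 0"
    and W: "c * r powr \<alpha> \<le> V r + 1 / r\<^sup>2" and c: "c > 0"
  shows "dual_weight V K q r \<le> (C powr (2 / (2 - q)) * c powr (- q / (2 - q))) * r powr ((2 * \<beta> - \<alpha> * q) / (2 - q))"
proof -
  have s: "2 - q > 0" using q by simp
  have "K r powr (2 / (2 - q)) \<le> (C * r powr \<beta>) powr (2 / (2 - q))" using K s by (intro powr_mono2) auto
  also have "\<dots> = C powr (2 / (2 - q)) * r powr (\<beta> * (2 / (2 - q)))" using C by (simp add: powr_mult powr_powr)
  finally have 1: "K r powr (2 / (2 - q)) \<le> C powr (2 / (2 - q)) * r powr (\<beta> * (2 / (2 - q)))" .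
  have "(V r + 1 / r\<^sup>2) powr (- q / (2 - q)) \<le> (c * r powr \<alpha>) powr (- q / (2 - q))"
    by (rule powr_mono2') (use W c r q s in \<open>auto intro!: divide_nonpos_pos mult_pos_pos\<close>)
  also have "\<dots> = c powr (- q / (2 - q)) * r powr (\<alpha> * (- q / (2 - q)))" using c by (simp add: powr_mult powr_powr)
  finally have 2: "(V r + 1 / r\<^sup>2) powr (- q / (2 - q)) \<le> c powr (- q / (2 - q)) * r powr (\<alpha> * (- q / (2 - q)))" .
  have "dual_weight V K q r \<le> (C powr (2 / (2 - q)) * r powr (\<beta> * (2 / (2 - q)))) * (c powr (- q / (2 - q)) * r powr (\<alpha> * (- q / (2 - q))))"
    unfolding dual_weight_def by (intro mult_mono 1 2) auto
  also have "\<dots> = (C powr (2 / (2 - q)) * c powr (- q / (2 - q))) * (r powr (\<beta> * (2 / (2 - q))) * r powr (\<alpha> * (- q / (2 - q))))"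
    by (simp only: mult_ac)
  also have "r powr (\<beta> * (2 / (2 - q))) * r powr (\<alpha> * (- q / (2 - q))) = r powr ((2 * \<beta> - \<alpha> * q) / (2 - q))"
    unfolding powr_add[symmetric] by (simp add: diff_divide_distrib mult.commute)
  finally show ?thesis .
qed

lemma continuous_on_dual_weight:
  assumes "continuous_on {0<..} V" "continuous_on {0<..} K" "\<And>r. r > 0 \<Longrightarrow> V r \<ge> 0" "\<And>r. r > 0 \<Longrightarrow> K r > 0"
  shows "continuous_on {0<..} (dual_weight V K q)"
proof -
  have "V r + 1 / r\<^sup>2 \<noteq> 0" if "r > 0" for r
    using assms(3)[OF that] that by (simp add: add_nonneg_pos less_imp_neq[symmetric])
  moreover have "K r \<noteq> 0" if "r > 0" for r using assms(4)[OF that] by simp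
  ultimately show ?thesis unfolding dual_weight_def
    by (intro continuous_intros assms(1,2)) auto
qed

theorem mainTheorem3:
  fixes V K :: "real \<Rightarrow> real" and a0 a b0 b :: real
    and f :: "real \<Rightarrow> real"
  assumes N3: "CARD('n::finite) \<ge> 3"
    and V_cont: "continuous_on {0<..} V" and V_nonneg: "\<forall>r>0. V r \<ge> 0"
    and V0: "Liminf (at_right 0) (\<lambda>r. ereal (V r / r powr a0)) > 0"
    and Vinf: "Liminf at_top (\<lambda>r. ereal (V r / r powr a)) > 0"
    and K_cont: "continuous_on {0<..} K" and K_pos: "\<forall>r>0. K r > 0"
    and K0: "Limsup (at_right 0) (\<lambda>r. ereal (K r / r powr b0)) < \<infinity>"
    and Kinf: "Limsup at_top (\<lambda>r. ereal (K r / r powr b)) < \<infinity>"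
    and hb0: "b0 > Min {a0, -(real CARD('n) - a0)/2, -(real CARD('n) + 2)/2}"
    and hb: "b < max a (-2)"
    and f_cont: "continuous_on UNIV f" and f0: "f 0 = 0"
    and f7: "\<exists>q1 q2. q1 < 2 \<and> q2 < 2 \<and> q1 \<in> I1 (real CARD('n)) a0 b0
               \<and> q2 \<in> I2 (real CARD('n)) a b
               \<and> (SUP t\<in>{0<..}. ereal (\<bar>f t\<bar> / min (t powr (q1 - 1)) (t powr (q2 - 1)))) < \<infinity>"
    and f8: "\<exists>\<theta><2. Liminf (at_right 0) (\<lambda>t. ereal (Fprim f t / t powr \<theta>)) > 0"
  shows "\<exists>u :: real^'n \<Rightarrow> real. radial_solution V K f u
           \<and> (AE x in lebesgue. u x \<ge> 0) \<and> \<not> (AE x in lebesgue. u x = 0)"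
proof -
  obtain q1 q2 where q: "q1 < 2" "q2 < 2" and q1: "q1 \<in> I1 (real CARD('n)) a0 b0" and q2: "q2 \<in> I2 (real CARD('n)) a b"
    and sup: "(SUP t\<in>{0<..}. ereal (\<bar>f t\<bar> / min (t powr (q1 - 1)) (t powr (q2 - 1)))) < \<infinity>" using f7 by blast
  let ?N = "real CARD('n)"
  have N: "?N \<ge> 3" using N3 by simp
  note E1 = I1_exponent_condition[OF N hb0 q1] and E2 = I2_exponent_condition[OF N q2]
  let ?\<mu> = "\<lambda>t. min (t powr (q1 - 1)) (t powr (q2 - 1))"
  obtain M where M: "M > 0" "\<And>t. t > 0 \<Longrightarrow> \<bar>f t\<bar> \<le> M * ?\<mu> t"
  proof -
    obtain c where c: "(SUP t\<in>{0<..}. ereal (\<bar>f t\<bar> / ?\<mu> t)) < ereal c" using ereal_dense2[OF sup] by auto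
    have "\<bar>f t\<bar> \<le> max c 1 * ?\<mu> t" if "t > 0" for t
    proof -
      have "ereal (\<bar>f t\<bar> / ?\<mu> t) \<le> (SUP t\<in>{0<..}. ereal (\<bar>f t\<bar> / ?\<mu> t))"
        by (rule SUP_upper) (use that in auto)
      then have "ereal (\<bar>f t\<bar> / ?\<mu> t) < ereal c" using c by (rule le_less_trans)
      then have "\<bar>f t\<bar> / ?\<mu> t \<le> max c 1" by simp
      moreover have "?\<mu> t > 0" using that by simp
      ultimately show ?thesis by (simp only: pos_divide_le_eq)
    qed
    then show ?thesis using that[of "max c 1"] by auto
  qed
  \<comment> \<open>The minimum of the two powers is increasing because both exponents exceed 1, and
    t B(t) lies below both M t^q1 and M t^q2. Thus the exponent can be chosen according to |x|,
    whatever the size of u(x).\<close>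
  define B where "B t = M * ?\<mu> t" for t
  have fB: "\<bar>f t\<bar> \<le> B t" if "t \<ge> 0" for t
    using M that f0 by (cases "t = 0") (auto simp: B_def)
  have Bmono: "B s \<le> B t" if "0 \<le> s" "s \<le> t" for s t
    unfolding B_def using M(1) E1(1) E2(1) that
    by (intro mult_left_mono min.mono powr_mono2) auto
  have tB: "t * B t \<le> M * t powr q1" "t * B t \<le> M * t powr q2" if "t \<ge> 0" for t
  proof -
    have p: "t * t powr (s - 1) = t powr s" for s
      using that by (cases "t = 0") (auto simp: powr_diff)
    have "t * ?\<mu> t \<le> t * t powr (q1 - 1)" "t * ?\<mu> t \<le> t * t powr (q2 - 1)"
      using that by (auto intro!: mult_left_mono)
    then have "t * ?\<mu> t \<le> t powr q1" "t * ?\<mu> t \<le> t powr q2" by (auto simp: p)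
    then show "t * B t \<le> M * t powr q1" "t * B t \<le> M * t powr q2"
      unfolding B_def using M(1) by (auto simp: mult.left_commute[of t M])
  qed
  define w :: "real^'n \<Rightarrow> real" where "w x = indicator {..1} (norm x) * dual_weight V K q1 (norm x)
      + indicator {1<..} (norm x) * dual_weight V K q2 (norm x)" for x
  have dnn: "dual_weight V K s r \<ge> 0" for s r by (simp add: dual_weight_def)
  have dc: "continuous_on {0<..} (dual_weight V K s)" for s
    by (rule continuous_on_dual_weight) (use V_cont K_cont V_nonneg K_pos in auto)
  have w1: "integrable lebesgue (\<lambda>x::real^'n. indicator {..1} (norm x) * dual_weight V K q1 (norm x))"
  proof -
    obtain c where c: "c > 0" "\<forall>\<^sub>F r in at_right 0. V r / r powr a0 > c" using Liminf_pos_eventually_ge[OF V0] by blast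
    obtain C where C: "C > 0" "\<forall>\<^sub>F r in at_right 0. K r / r powr b0 < C" using Limsup_less_PInf_eventually_le[OF K0] by blast
    have "\<forall>\<^sub>F r in at_right 0. V r / r powr a0 > c \<and> K r / r powr b0 < C" using c(2) C(2) by eventually_elim simp
    then obtain r0 where r0: "r0 > 0" "\<And>r. 0 < r \<Longrightarrow> r < r0 \<Longrightarrow> V r / r powr a0 > c \<and> K r / r powr b0 < C"
      by (auto simp: eventually_at_right_field)
    define \<alpha> where "\<alpha> = min a0 (-2)"
    show ?thesis
    proof (rule integrable_radial_near_0[OF dc dnn r0(1)])
      fix r :: real assume r: "0 < r" "r < r0"
      show "dual_weight V K q1 r \<le> (C powr (2 / (2 - q1)) * (min c 1) powr (- q1 / (2 - q1))) * r powr ((2 * b0 - \<alpha> * q1) / (2 - q1))"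
      proof (rule dual_weight_bound)
        show "K r \<le> C * r powr b0" using r0(2)[OF r] r by (simp add: divide_less_eq)
        \<comment> \<open>The larger term of W near 0 is V for a0 \<le> -2 and 1/r^2 otherwise; the
          constant \<open>min c 1\<close> serves both cases.\<close>
        show "min c 1 * r powr \<alpha> \<le> V r + 1 / r\<^sup>2"
        proof (cases "a0 \<le> -2")
          case True
          have "min c 1 * r powr \<alpha> \<le> c * r powr a0" using True by (simp add: \<alpha>_def mult_right_mono)
          also have "\<dots> \<le> V r" using r0(2)[OF r] r by (simp add: less_divide_eq)
          finally show ?thesis using r by (simp add: add_increasing2)
        next
          case False
          have "min c 1 * r powr \<alpha> \<le> 1 * r powr (-2)" using False by (intro mult_mono) (auto simp: \<alpha>_def)
          also have "\<dots> = 1 / r\<^sup>2" using r by (simp add: powr_minus_divide)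
          finally show ?thesis using V_nonneg r by (simp add: add_increasing)
        qed
      qed (use E1(1) q r K_pos C c in \<open>auto intro: less_imp_le\<close>)
    next
      show "(2 * b0 - \<alpha> * q1) / (2 - q1) > - ?N"
        using E1(2) q by (simp add: less_divide_eq \<alpha>_def algebra_simps)
    qed
  qed
  have w2: "integrable lebesgue (\<lambda>x::real^'n. indicator {1<..} (norm x) * dual_weight V K q2 (norm x))"
  proof -
    obtain c where c: "c > 0" "\<forall>\<^sub>F r in at_top. V r / r powr a > c" using Liminf_pos_eventually_ge[OF Vinf] by blast
    obtain C where C: "C > 0" "\<forall>\<^sub>F r in at_top. K r / r powr b < C" using Limsup_less_PInf_eventually_le[OF Kinf] by blast
    have "\<forall>\<^sub>F r in at_top. V r / r powr a > c \<and> K r / r powr b < C \<and> r > (0::real)"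
      using c(2) C(2) eventually_gt_at_top[of 0] by eventually_elim simp
    then obtain r0 where r0: "\<And>r. r > r0 \<Longrightarrow> V r / r powr a > c \<and> K r / r powr b < C \<and> r > 0"
      by (auto simp: eventually_at_top_dense)
    define \<alpha> where "\<alpha> = max a (-2)"
    show ?thesis
    proof (rule integrable_radial_near_infinity[OF dc dnn])
      fix r :: real assume r': "r > r0"
      have r: "r > 0" using r0[OF r'] by simp
      show "dual_weight V K q2 r \<le> (C powr (2 / (2 - q2)) * (min c 1) powr (- q2 / (2 - q2))) * r powr ((2 * b - \<alpha> * q2) / (2 - q2))"
      proof (rule dual_weight_bound)
        show "K r \<le> C * r powr b" using r0[OF r'] r by (simp add: divide_less_eq)
        show "min c 1 * r powr \<alpha> \<le> V r + 1 / r\<^sup>2"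
        proof (cases "a \<ge> -2")
          case True
          have "min c 1 * r powr \<alpha> \<le> c * r powr a" using True by (simp add: \<alpha>_def mult_right_mono)
          also have "\<dots> \<le> V r" using r0[OF r'] r by (simp add: less_divide_eq)
          finally show ?thesis using r by (simp add: add_increasing2)
        next
          case False
          have "min c 1 * r powr \<alpha> \<le> 1 * r powr (-2)" using False by (intro mult_mono) (auto simp: \<alpha>_def)
          also have "\<dots> = 1 / r\<^sup>2" using r by (simp add: powr_minus_divide)
          finally show ?thesis using V_nonneg r by (simp add: add_increasing)
        qed
      qed (use E2(1) q r K_pos C c in \<open>auto intro: less_imp_le\<close>)
    next
      show "(2 * b - \<alpha> * q2) / (2 - q2) < - ?N"
        using E2(2) q by (simp add: divide_less_eq \<alpha>_def algebra_simps)
    qed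
  qed
  interpret sublinear_problem V K f B w
  proof
    show "integrable lebesgue w" unfolding w_def using w1 w2 by (rule Bochner_Integration.integrable_add)
    show "w x \<ge> 0" for x unfolding w_def using dnn by simp
    fix e :: real assume e: "e > 0"
    \<comment> \<open>The sum of the two Young constants, so that the same C works inside and
      outside the unit ball.\<close>
    define C where "C = (M * e powr (- q1/2)) powr (2 / (2 - q1)) + (M * e powr (- q2/2)) powr (2 / (2 - q2))"
    have C0: "C \<ge> 0" by (simp add: C_def)
    have "K (norm x) * (t * B t) \<le> e * ((V (norm x) + 1 / (norm x)\<^sup>2) * t\<^sup>2) + C * w x"
      if x: "x \<noteq> 0" and t: "t \<ge> 0" for x :: "real^'n" and t
    proof -
      have r: "norm x > 0" using x by simp
      have k: "K (norm x) \<ge> 0" using K_pos r by (simp add: less_imp_le)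
      have v: "V (norm x) \<ge> 0" using V_nonneg r by simp
      have main: "K (norm x) * (t * B t) \<le> e * ((V (norm x) + 1 / (norm x)\<^sup>2) * t\<^sup>2) + C * dual_weight V K s (norm x)"
        if s: "1 < s" "s < 2" "t * B t \<le> M * t powr s" "(M * e powr (- s/2)) powr (2 / (2 - s)) \<le> C" for s
      proof -
        have "K (norm x) * (t * B t) \<le> K (norm x) * (M * t powr s)" by (rule mult_left_mono[OF s(3) k])
        also have "\<dots> \<le> e * ((V (norm x) + 1 / (norm x)\<^sup>2) * t\<^sup>2) + (M * e powr (- s/2)) powr (2 / (2 - s)) * dual_weight V K s (norm x)"
          by (rule dual_weight_split[where K=K and V=V and r="norm x", OF s(1,2) k v r e _ t]) (use M(1) in simp)
        also have "\<dots> \<le> e * ((V (norm x) + 1 / (norm x)\<^sup>2) * t\<^sup>2) + C * dual_weight V K s (norm x)"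
          by (intro add_left_mono mult_right_mono s(4) dnn)
        finally show ?thesis .
      qed
      show ?thesis
      proof (cases "norm x \<le> 1")
        case True
        then have "w x = dual_weight V K q1 (norm x)" by (simp add: w_def)
        then show ?thesis using main[OF E1(1) q(1) tB(1)[OF t]] by (simp add: C_def)
      next
        case False
        then have "w x = dual_weight V K q2 (norm x)" by (simp add: w_def)
        then show ?thesis using main[OF E2(1) q(2) tB(2)[OF t]] by (simp add: C_def)
      qed
    qed
    then show "\<exists>C\<ge>0. \<forall>x t. x \<noteq> 0 \<longrightarrow> t \<ge> 0 \<longrightarrow>
      K (norm x) * (t * B t) \<le> e * ((V (norm x) + 1 / (norm x)\<^sup>2) * t\<^sup>2) + C * w x" using C0 by blast
  qed (use N3 V_cont V_nonneg K_cont K_pos f_cont f0 fB Bmono in \<open>auto intro: less_imp_le\<close>)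
  \<comment> \<open>A bump on the annulus 1 \<le> |x| \<le> 3, positive in its interior. Its support
    avoids the origin, where V and K may be singular.\<close>
  define \<phi> where "\<phi> x = sstep (norm x - 1) * sstep (3 - norm x)" for x :: "real^'n"
  obtain G where G: "C1grad \<phi> G"
  proof -
    have "\<phi> = (\<lambda>x. sstep (1 * (norm x - 1)) * sstep (2 + 1 - norm x))" by (simp add: \<phi>_def fun_eq_iff)
    then show ?thesis
      using that C1grad_mult[OF C1grad_inner_cutoff[of 1 1] C1grad_cutoff[of 2]] by simp
  qed
  have \<phi>0: "\<phi> x = 0" if "norm x \<notin> {1..3}" for x using that by (auto simp: \<phi>_def not_le sstep_eq_0)
  have \<phi>b: "0 \<le> \<phi> x" "\<phi> x \<le> 1" for x
    using sstep_bounds by (auto simp: \<phi>_def intro!: mult_nonneg_nonneg mult_le_one)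
  have \<phi>supp: "\<phi> x = 0" if "norm x > 3" for x using \<phi>0 that by auto
  have \<phi>c: "continuous_on UNIV \<phi>" by (rule C1gradD(3)[OF G])
  \<comment> \<open>One statement for the three integrals needed: the critical power of \<phi>, the
    potential term V \<phi>^2, and the term K \<phi>^\<kappa>.\<close>
  have annulus: "integrable lebesgue (\<lambda>x. h (norm x) * p (\<phi> x))"
    if h: "continuous_on {0<..} h" and p: "continuous_on {0..} p" "p 0 = 0" for h p :: "real \<Rightarrow> real"
  proof -
    let ?S = "cball (0::real^'n) 3 - ball 0 1"
    have m: "(\<lambda>x. indicator ?S x *\<^sub>R (h (norm x) * p (\<phi> x))) \<in> borel_measurable lborel \<and> integrable lborel (\<lambda>x. indicator ?S x *\<^sub>R (h (norm x) * p (\<phi> x)))"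
    proof -
      have "integrable lborel (\<lambda>x. indicator ?S x *\<^sub>R (h (norm x) * p (\<phi> x)))"
      proof (rule borel_integrable_compact)
        show "compact ?S" by (intro compact_diff) auto
        show "continuous_on ?S (\<lambda>x. h (norm x) * p (\<phi> x))"
          by (intro continuous_intros continuous_on_compose2[OF h] continuous_on_compose2[OF p(1) continuous_on_subset[OF \<phi>c]])
            (use \<phi>b in \<open>auto simp: not_less\<close>)
      qed
      then show ?thesis by auto
    qed
    moreover have "(\<lambda>x. indicator ?S x *\<^sub>R (h (norm x) * p (\<phi> x))) = (\<lambda>x. h (norm x) * p (\<phi> x))"
    proof
      fix x show "indicator ?S x *\<^sub>R (h (norm x) * p (\<phi> x)) = h (norm x) * p (\<phi> x)"
        using \<phi>0[of x] p(2) by (cases "norm x \<in> {1..3}") auto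
    qed
    ultimately show ?thesis by (simp add: integrable_completion)
  qed
  have adm\<phi>: "adm \<phi> G"
  proof -
    have G0: "G x = 0" if "norm x > 3" for x by (rule C1grad_zero_outside[OF G \<phi>supp that])
    have g2: "integrable lebesgue (\<lambda>x. (norm (G x))\<^sup>2)"
      by (rule integrable_continuous_bounded_support(2)[of _ 3]) (use G0 in \<open>auto intro!: continuous_intros C1gradD(2)[OF G]\<close>)
    have "integrable lebesgue (\<lambda>x. 1 * \<bar>\<phi> x\<bar> powr (2 * ?N / (?N - 2)))"
      by (rule annulus[where h="\<lambda>_. 1" and p="\<lambda>t. \<bar>t\<bar> powr (2 * ?N / (?N - 2))"])
        (use N in \<open>auto intro!: continuous_intros continuous_on_powr'\<close>)
    moreover have "\<phi> \<in> borel_measurable lebesgue"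
      using borel_measurable_continuous_onI[OF \<phi>c] by (intro measurable_completion) auto
    moreover have "radial \<phi>" unfolding radial_def \<phi>_def by (intro exI[of _ "\<lambda>r. sstep (r - 1) * sstep (3 - r)"]) auto
    moreover have "integrable lebesgue (\<lambda>x. V (norm x) * (\<phi> x)\<^sup>2)"
      by (rule annulus[OF V_cont, where p="\<lambda>t. t\<^sup>2"]) (auto intro!: continuous_intros)
    ultimately show ?thesis unfolding adm_def H1Vr_def D12_def using weak_grad_C1grad[OF G] g2 by auto
  qed
  obtain \<theta> where \<theta>: "\<theta> < 2" "Liminf (at_right 0) (\<lambda>t. ereal (Fprim f t / t powr \<theta>)) > 0" using f8 by blast
  obtain c where c: "c > 0" "\<forall>\<^sub>F t in at_right 0. Fprim f t / t powr \<theta> > c" using Liminf_pos_eventually_ge[OF \<theta>(2)] by blast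
  obtain \<delta> where \<delta>: "\<delta> > 0" "\<And>t. 0 < t \<Longrightarrow> t < \<delta> \<Longrightarrow> Fprim f t / t powr \<theta> > c"
    using c(2) by (auto simp: eventually_at_right_field)
  \<comment> \<open>The given \<theta> may be zero or negative. Raising it to at least 1 only
    weakens the lower bound for t \<le> 1, keeps the exponent below 2, and makes the power
    continuous with value 0 at t = 0.\<close>
  define \<kappa> where "\<kappa> = max \<theta> 1"
  have \<kappa>: "1 \<le> \<kappa>" "\<kappa> < 2" using \<theta> by (auto simp: \<kappa>_def)
  have Flow: "c * t powr \<kappa> \<le> Fprim f t" if "0 \<le> t" "t < min \<delta> 1" for t
  proof (cases "t = 0")
    case False
    then have t: "0 < t" "t < \<delta>" "t \<le> 1" using that by auto
    have "t powr \<kappa> \<le> t powr \<theta>" using t by (intro powr_mono') (auto simp: \<kappa>_def)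
    then have "c * t powr \<kappa> \<le> c * t powr \<theta>" using c by simp
    also have "\<dots> \<le> Fprim f t" using \<delta>(2)[OF t(1,2)] t by (simp add: less_divide_eq)
    finally show ?thesis .
  qed (simp add: Fprim_nonpos)
  define I where "I = (\<integral>x. K (norm x) * \<phi> x powr \<kappa> \<partial>lebesgue)"
  have Ii: "integrable lebesgue (\<lambda>x. K (norm x) * \<phi> x powr \<kappa>)"
    by (rule annulus[OF K_cont, where p="\<lambda>t. t powr \<kappa>"]) (use \<kappa> in \<open>auto intro!: continuous_on_powr' continuous_on_id continuous_on_const\<close>)
  have Inn: "AE x in lebesgue. 0 \<le> K (norm x) * \<phi> x powr \<kappa>"
    using AE_nonzero by eventually_elim (auto intro!: mult_nonneg_nonneg K_nonneg)
  have I0: "I > 0"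
  proof -
    have "I \<noteq> 0"
    proof
      assume "I = 0"
      then have "AE x in lebesgue. K (norm x) * \<phi> x powr \<kappa> = 0"
        unfolding I_def using integral_nonneg_eq_0_iff_AE[OF Ii Inn] by blast
      then have z: "AE x::real^'n in lebesgue. \<not> (1 < norm x \<and> norm x < 3)"
      proof eventually_elim
        case (elim x)
        show ?case
        proof
          assume x: "1 < norm x \<and> norm x < 3"
          have "\<phi> x > 0" unfolding \<phi>_def using x by (intro mult_pos_pos sstep_pos) auto
          then have "\<phi> x powr \<kappa> > 0" by simp
          moreover have "K (norm x) > 0" by (rule K_pos[rule_format]) (use x in auto)
          ultimately show False using elim by simp
        qed
      qed
      let ?A = "{x::real^'n. 1 < norm x} \<inter> {x. norm x < 3}"
      have "open ?A" by (intro open_Int open_Collect_less continuous_intros)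
      moreover have "2 *\<^sub>R axis (undefined::'n) (1::real) \<in> ?A" by (simp add: norm_axis_1)
      ultimately have "\<not> negligible ?A" using open_not_negligible by blast
      moreover have "?A \<in> sets lebesgue" using \<open>open ?A\<close> by auto
      then have "?A \<in> null_sets lebesgue" using z by (subst AE_iff_null_sets) simp_all
      ultimately show False by (simp add: negligible_iff_null_sets)
    qed
    moreover have "I \<ge> 0" unfolding I_def by (rule integral_nonneg_AE[OF Inn])
    ultimately show ?thesis by simp
  qed
  \<comment> \<open>The energy of t \<phi> is at most t^2 Q/2 - c t^\<kappa> I. Since \<kappa> < 2
    and I > 0, the second term dominates for small t, so the energy is negative.\<close>
  have "((\<lambda>t. t powr (2 - \<kappa>) * (Q \<phi> G / 2)) \<longlongrightarrow> 0 powr (2 - \<kappa>) * (Q \<phi> G / 2)) (at_right 0)"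
    using \<kappa> by (intro tendsto_intros tendsto_powr') (auto simp: eventually_at_right_field gt_ex)
  then have "\<forall>\<^sub>F t in at_right 0. t powr (2 - \<kappa>) * (Q \<phi> G / 2) < c * I"
    using c I0 by (intro order_tendstoD(2)) auto
  then obtain d where d: "d > 0" "\<And>t. 0 < t \<Longrightarrow> t < d \<Longrightarrow> t powr (2 - \<kappa>) * (Q \<phi> G / 2) < c * I"
    by (auto simp: eventually_at_right_field)
  define t where "t = min d (min \<delta> 1) / 2"
  have t: "0 < t" "t < d" "t < min \<delta> 1" using d \<delta> by (auto simp: t_def)
  have at: "adm (\<lambda>x. t * \<phi> x) (\<lambda>x. t *\<^sub>R G x)" by (rule adm_scale[OF adm\<phi>])
  have "Q (\<lambda>x. t * \<phi> x) (\<lambda>x. t *\<^sub>R G x) = t\<^sup>2 * Q \<phi> G"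
  proof -
    have V2: "V (norm x) * (t * \<phi> x)\<^sup>2 = t\<^sup>2 * (V (norm x) * (\<phi> x)\<^sup>2)" for x by (simp add: power_mult_distrib)
    have G2: "(norm (t *\<^sub>R G x))\<^sup>2 = t\<^sup>2 * (norm (G x))\<^sup>2" for x by (simp add: power_mult_distrib)
    show ?thesis unfolding Q_def V2 G2 by (simp add: distrib_left)
  qed
  moreover have "J (\<lambda>x. t * \<phi> x) \<ge> c * t powr \<kappa> * I"
  proof -
    have "c * t powr \<kappa> * I = (\<integral>x. (c * t powr \<kappa>) * (K (norm x) * \<phi> x powr \<kappa>) \<partial>lebesgue)" by (simp add: I_def)
    also have "\<dots> \<le> J (\<lambda>x. t * \<phi> x)"
      unfolding J_def
    proof (rule integral_mono_AE)
      show "integrable lebesgue (\<lambda>x. K (norm x) * Fprim f (t * \<phi> x))"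
        by (rule KF_integrable[OF admD(1)[OF at] adm_W(1)[OF at]])
      show "AE x in lebesgue. (c * t powr \<kappa>) * (K (norm x) * \<phi> x powr \<kappa>) \<le> K (norm x) * Fprim f (t * \<phi> x)"
        using AE_nonzero
      proof eventually_elim
        case (elim x)
        have "t * \<phi> x \<le> t * 1" using t \<phi>b(2)[of x] by (intro mult_left_mono) auto
        then have "t * \<phi> x < min \<delta> 1" using t(3) by linarith
        then have "c * (t * \<phi> x) powr \<kappa> \<le> Fprim f (t * \<phi> x)" using t \<phi>b(1)[of x] by (intro Flow) auto
        then have "K (norm x) * (c * (t * \<phi> x) powr \<kappa>) \<le> K (norm x) * Fprim f (t * \<phi> x)"
          using K_nonneg elim by (intro mult_left_mono) auto
        then show ?case using t \<phi>b(1)[of x] by (simp add: powr_mult mult_ac)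
      qed
    qed (use Ii in auto)
    finally show ?thesis .
  qed
  moreover have "t\<^sup>2 * (Q \<phi> G / 2) < c * t powr \<kappa> * I"
  proof -
    have "t\<^sup>2 = t powr \<kappa> * t powr (2 - \<kappa>)" using t by (simp add: powr_add[symmetric])
    then have "t\<^sup>2 * (Q \<phi> G / 2) = t powr \<kappa> * (t powr (2 - \<kappa>) * (Q \<phi> G / 2))" by (simp only: mult.assoc)
    also have "\<dots> < t powr \<kappa> * (c * I)" using d(2)[OF t(1,2)] t(1) by (intro mult_strict_left_mono) auto
    finally show ?thesis by (simp add: mult_ac)
  qed
  ultimately have "energy (\<lambda>x. t * \<phi> x) (\<lambda>x. t *\<^sub>R G x) < 0" by (simp add: energy_def)
  then show ?thesis by (rule solution_if_negative_energy[OF at])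
qed

end
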